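(* Let $\mathbb{K}$ be a field of characteristic zero and $\alpha\in\mathbb{K}^\times$. For every bounded open interval $I\subset\mathbb{R}$ of length greater than $2$, the map $$\varphi_I: H^0\big(\mathbb{V}_\alpha(I)\big)\to\mathbb{K}\mathbf{q}\oplus\mathbb{K}\mathbf{p},\qquad [f]\mapsto\Big(\sum_{x\in\mathbb{Z}}f(x)A(x)\Big)\mathbf{q}+\Big(\sum_{x\in\mathbb{Z}}f(x)B(x)\Big)\mathbf{p}$$ is a well-defined isomorphism, and the cohomology of $\mathbb{V}_\alpha(I)$ is concentrated in degree $0$. Consequently, $\mathbb{V}_\alpha$ is a locally constant $\mathbf{D}_1^1$-algebra in cochain complexes with monoidal structure $\oplus$, and $\mathcal{O}^{c\ell}_\alpha:=\mathrm{Sym}(\mathbb{V}_\alpha)$ is a locally constant $\mathbf{D}_1^1$-algebra in differential graded commutative algebras with monoidal structure $\otimes$; moreover the maps $\mathcal{O}^{c\ell}_\alpha(I)\to\mathbb{K}[\mathbf{q},\mathbf{p}]$ of differential graded commutative algebras induced by the maps $\varphi_I$ are quasi-isomorphisms, and they are compatible with the operations, i.e. they give an equivalence of $\mathbf{D}_1^1$-algebras $\mathcal{O}^{c\ell}_\alpha\simeq\gamma^*\mathbb{K}[\mathbf{q},\mathbf{p}]$.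
   Context: For a set $S$, $\mathrm{Map}(S,\mathbb{K})$ is the vector space of functions $S\to\mathbb{K}$; for $S\subset T$, functions on $S$ are identified with functions on $T$ supported in $S$ (extension by $0$). Cochain complexes have differential of degree $+1$. The operator $Q_\alpha$ on $\mathrm{Map}(\mathbb{Z},\mathbb{K})$ is $(Q_\alpha h)(x)=h(x-1)-(\alpha+\alpha^{-1})h(x)+h(x+1)$. For $a<b$ real, $\mathbb{V}_\alpha(a,b)$ is the cone of $Q_\alpha:\mathrm{Map}(\mathbb{Z}\cap(a+1,b-1),\mathbb{K})\to\mathrm{Map}(\mathbb{Z}\cap(a,b),\mathbb{K})$, i.e. the two-term complex with source in degree $-1$, target in degree $0$, and differential $Q_\alpha$. The functions $A,B:\mathbb{Z}\to\mathbb{K}$ are $A(x)=\frac{\alpha^x+\alpha^{-x}}{2}$ and $B(x)=\frac{\alpha^x-\alpha^{-x}}{\alpha-\alpha^{-1}}$, the latter being understood as $B(0)=0$ and $B(x)=\frac{x}{|x|}\big(\alpha^{|x|-1}+\alpha^{|x|-3}+\cdots+\alpha^{3-|x|}+\alpha^{1-|x|}\big)$ for $x\neq0$ (which makes sense also if $\alpha=\alpha^{-1}$). $\mathbf{D}_1^1$ is the colored operad whose colors are bounded open intervals of $\mathbb{R}$ of length greater than $2$, with exactly one operation $(I_1,\dots,I_n)\to J$ if $I_1,\dots,I_n$ are pairwise disjoint and contained in $J$, and none otherwise. An algebra $F$ over it in a symmetric monoidal category assigns to every such interval $I$ an object $F(I)$, and to every such operation a morphism from the monoidal product of the $F(I_i)$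 to $F(J)$, compatibly with compositions, permutations and units. It is locally constant if $F(I)\to F(J)$ is a quasi-isomorphism for all $I\subset J$. For $\mathbb{V}_\alpha$ the operation is the sum $(f_1,\dots,f_n)\mapsto\sum_jf_j$ of the extensions by zero; for $\mathrm{Sym}(\mathbb{V}_\alpha)$ (graded symmetric algebra, with differential extended by the Leibniz rule) it is the induced one, i.e. the multiplication in $\mathrm{Sym}(\mathbb{V}_\alpha(J))$ of the images of the factors. $\gamma^*\mathbb{K}[\mathbf{q},\mathbf{p}]$ is the $\mathbf{D}_1^1$-algebra with constant value the polynomial algebra $\mathbb{K}[\mathbf{q},\mathbf{p}]$ in degree $0$, with operations given by multiplication of polynomials. The map $\mathcal{O}^{c\ell}_\alpha(I)\to\mathbb{K}[\mathbf{q},\mathbf{p}]$ induced by $\varphi_I$ is $\mathrm{Sym}$ of the chain map $\mathbb{V}_\alpha(I)\to\mathbb{K}\mathbf{q}\oplus\mathbb{K}\mathbf{p}$ that is zero in degree $-1$ and $f\mapsto \varphi_I([f])$ in degree $0$. *)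

theory Defs
  imports
    "HOL-Library.Poly_Mapping"
    "HOL-Combinatorics.Permutations"
    "HOL-Computational_Algebra.Polynomial"
    "HOL-Algebra.Module"
    "HOL-Algebra.AbelCoset"
    "HOL-Algebra.Ideal"
begin

section \<open>Linear algebra over a type-class field\<close>

definition scalars :: "'k::field ring" where
  "scalars = \<lparr>carrier = UNIV, mult = (*), one = 1, zero = 0, add = (+)\<rparr>"

text \<open>A vector space is a \<^const>\<open>module\<close> over \<^const>\<open>scalars\<close>. The record type of
  modules extends that of rings; the fields \<^const>\<open>mult\<close> and \<^const>\<open>one\<close> play no role.\<close>

definition linear_map ::
  "('k::field,'v,'y) module_scheme \<Rightarrow> ('k,'w,'z) module_scheme \<Rightarrow> ('v \<Rightarrow> 'w) \<Rightarrow> bool" where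
  "linear_map M N f \<longleftrightarrow>
     f \<in> carrier M \<rightarrow> carrier N \<and>
     (\<forall>x\<in>carrier M. \<forall>y\<in>carrier M. f (x \<oplus>\<^bsub>M\<^esub> y) = f x \<oplus>\<^bsub>N\<^esub> f y) \<and>
     (\<forall>c. \<forall>x\<in>carrier M. f (c \<odot>\<^bsub>M\<^esub> x) = c \<odot>\<^bsub>N\<^esub> f x)"

definition linear_iso ::
  "('k::field,'v,'y) module_scheme \<Rightarrow> ('k,'w,'z) module_scheme \<Rightarrow> ('v \<Rightarrow> 'w) \<Rightarrow> bool" where
  "linear_iso M N f \<longleftrightarrow> linear_map M N f \<and> bij_betw f (carrier M) (carrier N)"

definition span_of :: "('k::field,'v,'z) module_scheme \<Rightarrow> 'v set \<Rightarrow> 'v set" where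
  "span_of M S = \<Inter>{H. submodule H scalars M \<and> S \<subseteq> H}"

definition quot_mod :: "('k::field,'v) module \<Rightarrow> 'v set \<Rightarrow> ('k,'v set) module" where
  "quot_mod M N = \<lparr>carrier = a_rcosets\<^bsub>M\<^esub> N, mult = undefined, one = undefined,
     zero = N, add = set_add M, smult = (\<lambda>c X. \<Union>x\<in>X. N +>\<^bsub>M\<^esub> (c \<odot>\<^bsub>M\<^esub> x))\<rparr>"

text \<open>The map induced by \<open>f\<close> from a quotient into the quotient of \<open>M'\<close> by \<open>N'\<close>.\<close>

definition quot_map :: "('k::field,'w) module \<Rightarrow> 'w set \<Rightarrow> ('v \<Rightarrow> 'w) \<Rightarrow> 'v set \<Rightarrow> 'w set" where
  "quot_map M' N' f X = (\<Union>x\<in>X. N' +>\<^bsub>M'\<^esub> f x)"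


section \<open>Cochain complexes\<close>

record ('k,'v) cochain =
  Comp :: "int \<Rightarrow> ('k,'v) module"
  Diff :: "int \<Rightarrow> 'v \<Rightarrow> 'v"

definition cochain_complex :: "('k::field,'v,'z) cochain_scheme \<Rightarrow> bool" where
  "cochain_complex V \<longleftrightarrow>
     (\<forall>n. module scalars (Comp V n)) \<and>
     (\<forall>n. linear_map (Comp V n) (Comp V (n + 1)) (Diff V n)) \<and>
     (\<forall>n. \<forall>x\<in>carrier (Comp V n). Diff V (n + 1) (Diff V n x) = \<zero>\<^bsub>Comp V (n + 2)\<^esub>)"

definition chain_map ::
  "('k::field,'v,'y) cochain_scheme \<Rightarrow> ('k,'w,'z) cochain_scheme \<Rightarrow> (int \<Rightarrow> 'v \<Rightarrow> 'w) \<Rightarrow> bool" where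
  "chain_map V W f \<longleftrightarrow>
     (\<forall>n. linear_map (Comp V n) (Comp W n) (f n)) \<and>
     (\<forall>n. \<forall>x\<in>carrier (Comp V n). f (n + 1) (Diff V n x) = Diff W n (f n x))"

definition cocycles :: "('k::field,'v,'z) cochain_scheme \<Rightarrow> int \<Rightarrow> ('k,'v) module" where
  "cocycles V n = (Comp V n)\<lparr>carrier :=
     {x \<in> carrier (Comp V n). Diff V n x = \<zero>\<^bsub>Comp V (n + 1)\<^esub>}\<rparr>"

definition coboundaries :: "('k::field,'v,'z) cochain_scheme \<Rightarrow> int \<Rightarrow> 'v set" where
  "coboundaries V n = Diff V (n - 1) ` carrier (Comp V (n - 1))"

definition cohom :: "('k::field,'v,'z) cochain_scheme \<Rightarrow> int \<Rightarrow> ('k,'v set) module" where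
  "cohom V n = quot_mod (cocycles V n) (coboundaries V n)"

definition cohom_class :: "('k::field,'v,'z) cochain_scheme \<Rightarrow> int \<Rightarrow> 'v \<Rightarrow> 'v set" where
  "cohom_class V n x = coboundaries V n +>\<^bsub>cocycles V n\<^esub> x"

definition cohom_map ::
  "('k::field,'w,'z) cochain_scheme \<Rightarrow> (int \<Rightarrow> 'v \<Rightarrow> 'w) \<Rightarrow> int \<Rightarrow> 'v set \<Rightarrow> 'w set" where
  "cohom_map W f n = quot_map (cocycles W n) (coboundaries W n) (f n)"

definition quasi_iso ::
  "('k::field,'v,'y) cochain_scheme \<Rightarrow> ('k,'w,'z) cochain_scheme \<Rightarrow> (int \<Rightarrow> 'v \<Rightarrow> 'w) \<Rightarrow> bool" where
  "quasi_iso V W f \<longleftrightarrow> chain_map V W f \<and>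
     (\<forall>n. linear_iso (cohom V n) (cohom W n) (cohom_map W f n))"

text \<open>The direct sum of a list of complexes; its elements are lists of components.\<close>

definition direct_sum :: "('k::field,'v) cochain list \<Rightarrow> ('k,'v list) cochain" where
  "direct_sum Vs = \<lparr>
     Comp = (\<lambda>n. \<lparr>
       carrier = {vs. list_all2 (\<lambda>V v. v \<in> carrier (Comp V n)) Vs vs},
       mult = undefined, one = undefined,
       zero = map (\<lambda>V. \<zero>\<^bsub>Comp V n\<^esub>) Vs,
       add = (\<lambda>us vs. map (\<lambda>i. us ! i \<oplus>\<^bsub>Comp (Vs ! i) n\<^esub> vs ! i) [0..<length Vs]),
       smult = (\<lambda>c vs. map (\<lambda>i. c \<odot>\<^bsub>Comp (Vs ! i) n\<^esub> (vs ! i)) [0..<length Vs])\<rparr>),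
     Diff = (\<lambda>n vs. map (\<lambda>i. Diff (Vs ! i) n (vs ! i)) [0..<length Vs])\<rparr>"


section \<open>Differential graded commutative algebras\<close>

text \<open>\<open>Mult A m n\<close> is the multiplication of elements of degrees \<open>m\<close> and \<open>n\<close>.\<close>

record ('k,'v) dga = "('k,'v) cochain" +
  Mult :: "int \<Rightarrow> int \<Rightarrow> 'v \<Rightarrow> 'v \<Rightarrow> 'v"
  Unit :: 'v

definition sgn_pow :: "int \<Rightarrow> 'k::field" where
  "sgn_pow n = (- 1) powi n"

definition dgca :: "('k::field,'v) dga \<Rightarrow> bool" where
  "dgca A \<longleftrightarrow> cochain_complex A \<and>
     (\<forall>m n. \<forall>a\<in>carrier (Comp A m). linear_map (Comp A n) (Comp A (m + n)) (Mult A m n a)) \<and>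
     (\<forall>m n. \<forall>b\<in>carrier (Comp A n).
        linear_map (Comp A m) (Comp A (m + n)) (\<lambda>a. Mult A m n a b)) \<and>
     (\<forall>l m n. \<forall>a\<in>carrier (Comp A l). \<forall>b\<in>carrier (Comp A m). \<forall>c\<in>carrier (Comp A n).
        Mult A (l + m) n (Mult A l m a b) c = Mult A l (m + n) a (Mult A m n b c)) \<and>
     Unit A \<in> carrier (Comp A 0) \<and>
     (\<forall>n. \<forall>a\<in>carrier (Comp A n). Mult A 0 n (Unit A) a = a \<and> Mult A n 0 a (Unit A) = a) \<and>
     (\<forall>m n. \<forall>a\<in>carrier (Comp A m). \<forall>b\<in>carrier (Comp A n).
        Mult A m n a b = sgn_pow (m * n) \<odot>\<^bsub>Comp A (m + n)\<^esub> Mult A n m b a) \<and>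
     (\<forall>m n. \<forall>a\<in>carrier (Comp A m). \<forall>b\<in>carrier (Comp A n).
        Diff A (m + n) (Mult A m n a b) =
          Mult A (m + 1) n (Diff A m a) b \<oplus>\<^bsub>Comp A (m + n + 1)\<^esub>
          sgn_pow m \<odot>\<^bsub>Comp A (m + n + 1)\<^esub> Mult A m (n + 1) a (Diff A n b))"

definition dga_hom :: "('k::field,'v) dga \<Rightarrow> ('k,'w) dga \<Rightarrow> (int \<Rightarrow> 'v \<Rightarrow> 'w) \<Rightarrow> bool" where
  "dga_hom A B f \<longleftrightarrow> chain_map A B f \<and> f 0 (Unit A) = Unit B \<and>
     (\<forall>m n. \<forall>a\<in>carrier (Comp A m). \<forall>b\<in>carrier (Comp A n).
        f (m + n) (Mult A m n a b) = Mult B m n (f m a) (f n b))"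


section \<open>Words of homogeneous elements\<close>

text \<open>With concatenation as addition on lists, \<open>'a list \<Rightarrow>\<^sub>0 'k\<close> is the free associative
  \<open>'k\<close>-algebra on \<open>'a\<close>, and its ring structure is the one of \<open>Poly_Mapping\<close>.\<close>

instantiation list :: (type) monoid_add
begin

definition zero_list :: "'a list" where "zero_list = []"

definition plus_list :: "'a list \<Rightarrow> 'a list \<Rightarrow> 'a list" where "plus_list = (@)"

instance
  by standard (simp_all add: zero_list_def plus_list_def)

end

text \<open>A letter \<open>(n, v)\<close> is an element \<open>v\<close> together with its degree \<open>n\<close>.\<close>

type_synonym 'v word = "(int \<times> 'v) list"

definition wdeg :: "'v word \<Rightarrow> int" where
  "wdeg w = sum_list (map fst w)"

definition pscale :: "'k::field \<Rightarrow> ('a \<Rightarrow>\<^sub>0 'k) \<Rightarrow> ('a \<Rightarrow>\<^sub>0 'k)" where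
  "pscale c x = Poly_Mapping.map ((*) c) x"

definition free_mod :: "'a set \<Rightarrow> ('k::field, 'a \<Rightarrow>\<^sub>0 'k) module" where
  "free_mod S = \<lparr>carrier = {x. Poly_Mapping.keys x \<subseteq> S}, mult = undefined, one = undefined,
     zero = 0, add = (+), smult = pscale\<rparr>"

definition free_alg :: "'a set \<Rightarrow> ('a list \<Rightarrow>\<^sub>0 'k::field) ring" where
  "free_alg S = \<lparr>carrier = {x. Poly_Mapping.keys x \<subseteq> lists S},
     mult = (*), one = 1, zero = 0, add = (+)\<rparr>"

text \<open>Linear extension of a function on basis elements to a map into the module \<open>M\<close>, and,
  for maps between free modules, without reference to a carrier.\<close>

definition lin_ext ::
  "('k::field,'v,'z) module_scheme \<Rightarrow> ('a \<Rightarrow> 'v) \<Rightarrow> ('a \<Rightarrow>\<^sub>0 'k) \<Rightarrow> 'v" where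
  "lin_ext M g x =
     (\<Oplus>\<^bsub>M\<^esub>w\<in>Poly_Mapping.keys x. Poly_Mapping.lookup x w \<odot>\<^bsub>M\<^esub> g w)"

definition free_ext :: "('a \<Rightarrow> ('b \<Rightarrow>\<^sub>0 'k::field)) \<Rightarrow> ('a \<Rightarrow>\<^sub>0 'k) \<Rightarrow> ('b \<Rightarrow>\<^sub>0 'k)" where
  "free_ext g x = (\<Sum>w\<in>Poly_Mapping.keys x. pscale (Poly_Mapping.lookup x w) (g w))"

text \<open>The Leibniz rule on words, with differential \<open>d i\<close> at position \<open>i\<close>.\<close>

definition word_diff ::
  "(nat \<Rightarrow> int \<Rightarrow> 'v \<Rightarrow> 'v) \<Rightarrow> 'v word \<Rightarrow> ('v word \<Rightarrow>\<^sub>0 'k::field)" where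
  "word_diff d w = (\<Sum>i<length w.
     Poly_Mapping.single (w[i := (fst (w ! i) + 1, d i (fst (w ! i)) (snd (w ! i)))])
       (sgn_pow (wdeg (take i w))))"

text \<open>The product in an algebra of the letters of a word.\<close>

fun word_prod :: "('k::field,'v) dga \<Rightarrow> 'v word \<Rightarrow> 'v" where
  "word_prod A [] = Unit A"
| "word_prod A ((n, a) # w) = Mult A n (wdeg w) a (word_prod A w)"


section \<open>Graded symmetric algebras\<close>

definition letters :: "('k::field,'v,'z) cochain_scheme \<Rightarrow> (int \<times> 'v) set" where
  "letters V = {(n, v). v \<in> carrier (Comp V n)}"

text \<open>The tensor algebra modulo graded commutativity; the linear relations presenting the
  tensor algebra are imposed at the same time.\<close>

definition sym_rels :: "('k::field,'v,'z) cochain_scheme \<Rightarrow> ('v word \<Rightarrow>\<^sub>0 'k) set" where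
  "sym_rels V =
     {Poly_Mapping.single [(n, u \<oplus>\<^bsub>Comp V n\<^esub> v)] 1
        - Poly_Mapping.single [(n, u)] 1 - Poly_Mapping.single [(n, v)] 1 | n u v.
        u \<in> carrier (Comp V n) \<and> v \<in> carrier (Comp V n)} \<union>
     {Poly_Mapping.single [(n, c \<odot>\<^bsub>Comp V n\<^esub> u)] 1 - Poly_Mapping.single [(n, u)] c | n c u.
        u \<in> carrier (Comp V n)} \<union>
     {Poly_Mapping.single [(m, u), (n, v)] 1
        - Poly_Mapping.single [(n, v), (m, u)] (sgn_pow (m * n)) | m n u v.
        u \<in> carrier (Comp V m) \<and> v \<in> carrier (Comp V n)}"

definition sym_words :: "('k::field,'v,'z) cochain_scheme \<Rightarrow> int \<Rightarrow> 'v word set" where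
  "sym_words V n = {w \<in> lists (letters V). wdeg w = n}"

definition sym_free ::
  "('k::field,'v,'z) cochain_scheme \<Rightarrow> int \<Rightarrow> ('k, 'v word \<Rightarrow>\<^sub>0 'k) module" where
  "sym_free V n = free_mod (sym_words V n)"

definition sym_ideal ::
  "('k::field,'v,'z) cochain_scheme \<Rightarrow> int \<Rightarrow> ('v word \<Rightarrow>\<^sub>0 'k) set" where
  "sym_ideal V n = (Idl\<^bsub>free_alg (letters V)\<^esub> (sym_rels V)) \<inter> carrier (sym_free V n)"

definition Sym ::
  "('k::field,'v,'z) cochain_scheme \<Rightarrow> ('k, ('v word \<Rightarrow>\<^sub>0 'k) set) dga" where
  "Sym V = \<lparr>
     Comp = (\<lambda>n. quot_mod (sym_free V n) (sym_ideal V n)),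
     Diff = (\<lambda>n. quot_map (sym_free V (n + 1)) (sym_ideal V (n + 1))
                   (free_ext (word_diff (\<lambda>_. Diff V)))),
     Mult = (\<lambda>m n X Y. \<Union>x\<in>X. \<Union>y\<in>Y. sym_ideal V (m + n) +>\<^bsub>sym_free V (m + n)\<^esub> (x * y)),
     Unit = sym_ideal V 0 +>\<^bsub>sym_free V 0\<^esub> 1\<rparr>"

definition sym_gen ::
  "('k::field,'v,'z) cochain_scheme \<Rightarrow> int \<Rightarrow> 'v \<Rightarrow> ('v word \<Rightarrow>\<^sub>0 'k) set" where
  "sym_gen V n v = sym_ideal V n +>\<^bsub>sym_free V n\<^esub> Poly_Mapping.single [(n, v)] 1"

text \<open>The algebra map out of a symmetric algebra which extends \<open>g\<close>. For well-defined maps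
  the image of a coset is a singleton.\<close>

definition sym_ext ::
  "('k::field,'w) dga \<Rightarrow> (int \<Rightarrow> 'v \<Rightarrow> 'w) \<Rightarrow> int \<Rightarrow> ('v word \<Rightarrow>\<^sub>0 'k) set \<Rightarrow> 'w" where
  "sym_ext A g n X = the_elem
     (lin_ext (Comp A n) (\<lambda>w. word_prod A (map (\<lambda>(m, v). (m, g m v)) w)) ` X)"

definition sym_map :: "('k::field,'w,'z) cochain_scheme \<Rightarrow> (int \<Rightarrow> 'v \<Rightarrow> 'w) \<Rightarrow>
    int \<Rightarrow> ('v word \<Rightarrow>\<^sub>0 'k) set \<Rightarrow> ('w word \<Rightarrow>\<^sub>0 'k) set" where
  "sym_map W f = sym_ext (Sym W) (\<lambda>n v. sym_gen W n (f n v))"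


section \<open>Tensor products of algebras\<close>

text \<open>The tensor product of a list of algebras, as the free module on words with one
  homogeneous letter from each factor, modulo multilinearity.\<close>

definition tensor_words :: "('k::field,'v) dga list \<Rightarrow> int \<Rightarrow> 'v word set" where
  "tensor_words As n =
     {w. list_all2 (\<lambda>A (m, a). a \<in> carrier (Comp A m)) As w \<and> wdeg w = n}"

definition tensor_free ::
  "('k::field,'v) dga list \<Rightarrow> int \<Rightarrow> ('k, 'v word \<Rightarrow>\<^sub>0 'k) module" where
  "tensor_free As n = free_mod (tensor_words As n)"

definition tensor_rels :: "('k::field,'v) dga list \<Rightarrow> int \<Rightarrow> ('v word \<Rightarrow>\<^sub>0 'k) set" where
  "tensor_rels As n =
     {Poly_Mapping.single (w[i := (m, u \<oplus>\<^bsub>Comp (As ! i) m\<^esub> v)]) 1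
        - Poly_Mapping.single (w[i := (m, u)]) 1 - Poly_Mapping.single (w[i := (m, v)]) 1
      | w i m u v. w \<in> tensor_words As n \<and> i < length As \<and> m = fst (w ! i) \<and>
          u \<in> carrier (Comp (As ! i) m) \<and> v \<in> carrier (Comp (As ! i) m)} \<union>
     {Poly_Mapping.single (w[i := (m, c \<odot>\<^bsub>Comp (As ! i) m\<^esub> u)]) 1
        - Poly_Mapping.single (w[i := (m, u)]) c
      | w i m c u. w \<in> tensor_words As n \<and> i < length As \<and> m = fst (w ! i) \<and>
          u \<in> carrier (Comp (As ! i) m)}"

definition tensor_null :: "('k::field,'v) dga list \<Rightarrow> int \<Rightarrow> ('v word \<Rightarrow>\<^sub>0 'k) set" where
  "tensor_null As n = span_of (tensor_free As n) (tensor_rels As n)"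

text \<open>The product of elementary tensors: \<open>a\<^sub>i\<close> has to pass all \<open>b\<^sub>j\<close> with \<open>j < i\<close>.\<close>

definition word_mult :: "('k::field,'v) dga list \<Rightarrow> 'v word \<Rightarrow> 'v word \<Rightarrow> ('v word \<Rightarrow>\<^sub>0 'k)" where
  "word_mult As w w' = Poly_Mapping.single
     (map (\<lambda>i. (fst (w ! i) + fst (w' ! i),
                Mult (As ! i) (fst (w ! i)) (fst (w' ! i)) (snd (w ! i)) (snd (w' ! i))))
        [0..<length As])
     (\<Prod>i<length As. \<Prod>j<i. sgn_pow (fst (w ! i) * fst (w' ! j)))"

definition tensor :: "('k::field,'v) dga list \<Rightarrow> ('k, ('v word \<Rightarrow>\<^sub>0 'k) set) dga" where
  "tensor As = \<lparr>
     Comp = (\<lambda>n. quot_mod (tensor_free As n) (tensor_null As n)),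
     Diff = (\<lambda>n. quot_map (tensor_free As (n + 1)) (tensor_null As (n + 1))
                   (free_ext (word_diff (\<lambda>i. Diff (As ! i))))),
     Mult = (\<lambda>m n X Y. \<Union>x\<in>X. \<Union>y\<in>Y. tensor_null As (m + n) +>\<^bsub>tensor_free As (m + n)\<^esub>
               free_ext (\<lambda>w. free_ext (word_mult As w) y) x),
     Unit = tensor_null As 0 +>\<^bsub>tensor_free As 0\<^esub>
              Poly_Mapping.single (map (\<lambda>A. (0, Unit A)) As) 1\<rparr>"

definition elem_tensor :: "('k::field,'v) dga list \<Rightarrow> 'v word \<Rightarrow> ('v word \<Rightarrow>\<^sub>0 'k) set" where
  "elem_tensor As w =
     tensor_null As (wdeg w) +>\<^bsub>tensor_free As (wdeg w)\<^esub> Poly_Mapping.single w 1"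

text \<open>The map out of a tensor product given on elementary tensors by \<open>g\<close>.\<close>

definition tensor_ext ::
  "('k::field,'w) dga \<Rightarrow> ('v word \<Rightarrow> 'w) \<Rightarrow> int \<Rightarrow> ('v word \<Rightarrow>\<^sub>0 'k) set \<Rightarrow> 'w" where
  "tensor_ext B g n X = the_elem (lin_ext (Comp B n) g ` X)"

text \<open>The Koszul sign of rearranging the letters of \<open>w\<close> to \<open>permute_list \<sigma> w\<close>.\<close>

definition koszul :: "(nat \<Rightarrow> nat) \<Rightarrow> 'v word \<Rightarrow> 'k::field" where
  "koszul \<sigma> w = (\<Prod>(i, j)\<in>{(i, j). i < j \<and> j < length w \<and> \<sigma> j < \<sigma> i}.
     sgn_pow (fst (w ! \<sigma> i) * fst (w ! \<sigma> j)))"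


section \<open>The colored operad and its algebras\<close>

text \<open>The pair \<open>(a, b)\<close> stands for the open interval from \<open>a\<close> to \<open>b\<close>.\<close>

type_synonym ival = "real \<times> real"

definition ivl :: "ival \<Rightarrow> real set" where
  "ivl I = {fst I<..<snd I}"

definition color :: "ival \<Rightarrow> bool" where
  "color I \<longleftrightarrow> snd I - fst I > 2"

text \<open>\<open>D11 Is J\<close>: there is an operation (then exactly one) from \<open>Is\<close> to \<open>J\<close>.\<close>

definition D11 :: "ival list \<Rightarrow> ival \<Rightarrow> bool" where
  "D11 Is J \<longleftrightarrow> (\<forall>I\<in>set Is. color I \<and> ivl I \<subseteq> ivl J) \<and> color J \<and>
     (\<forall>i<length Is. \<forall>j<length Is. i \<noteq> j \<longrightarrow> ivl (Is ! i) \<inter> ivl (Is ! j) = {})"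

text \<open>Algebras in cochain complexes with \<open>\<oplus>\<close>. The last three conditions are compatibility
  with units, compositions and permutations.\<close>

definition D11_algebra_sum ::
  "(ival \<Rightarrow> ('k::field,'v) cochain) \<Rightarrow>
   (ival list \<Rightarrow> ival \<Rightarrow> int \<Rightarrow> 'v list \<Rightarrow> 'v) \<Rightarrow> bool" where
  "D11_algebra_sum F \<mu> \<longleftrightarrow>
     (\<forall>I. color I \<longrightarrow> cochain_complex (F I)) \<and>
     (\<forall>Is J. D11 Is J \<longrightarrow> chain_map (direct_sum (map F Is)) (F J) (\<mu> Is J)) \<and>
     (\<forall>I n. color I \<longrightarrow> (\<forall>v\<in>carrier (Comp (F I) n). \<mu> [I] I n [v] = v)) \<and>
     (\<forall>Iss Js K n vss.
        D11 Js K \<and> list_all2 D11 Iss Js \<and>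
        list_all2 (\<lambda>Is vs. vs \<in> carrier (Comp (direct_sum (map F Is)) n)) Iss vss \<longrightarrow>
        \<mu> Js K n (map (\<lambda>i. \<mu> (Iss ! i) (Js ! i) n (vss ! i)) [0..<length Js]) =
        \<mu> (concat Iss) K n (concat vss)) \<and>
     (\<forall>Is J \<sigma> n vs.
        D11 Is J \<and> \<sigma> permutes {..<length Is} \<and>
        vs \<in> carrier (Comp (direct_sum (map F Is)) n) \<longrightarrow>
        \<mu> (permute_list \<sigma> Is) J n (permute_list \<sigma> vs) = \<mu> Is J n vs)"

definition locally_constant_sum ::
  "(ival \<Rightarrow> ('k::field,'v) cochain) \<Rightarrow>
   (ival list \<Rightarrow> ival \<Rightarrow> int \<Rightarrow> 'v list \<Rightarrow> 'v) \<Rightarrow> bool" where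
  "locally_constant_sum F \<mu> \<longleftrightarrow>
     (\<forall>I J. D11 [I] J \<longrightarrow> quasi_iso (F I) (F J) (\<lambda>n v. \<mu> [I] J n [v]))"

text \<open>Algebras in differential graded commutative algebras with \<open>\<otimes>\<close>. The structure
  isomorphisms of \<open>\<otimes>\<close> are determined by their values on elementary tensors, where the
  associativity isomorphism concatenates words and the braiding permutes letters with the
  Koszul sign; the compatibility conditions are stated there.\<close>

definition D11_algebra_tensor ::
  "(ival \<Rightarrow> ('k::field,'v) dga) \<Rightarrow>
   (ival list \<Rightarrow> ival \<Rightarrow> int \<Rightarrow> ('v word \<Rightarrow>\<^sub>0 'k) set \<Rightarrow> 'v) \<Rightarrow> bool" where
  "D11_algebra_tensor F \<mu> \<longleftrightarrow>
     (\<forall>I. color I \<longrightarrow> dgca (F I)) \<and>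
     (\<forall>Is J. D11 Is J \<longrightarrow> dga_hom (tensor (map F Is)) (F J) (\<mu> Is J)) \<and>
     (\<forall>I n. color I \<longrightarrow>
        (\<forall>a\<in>carrier (Comp (F I) n). \<mu> [I] I n (elem_tensor [F I] [(n, a)]) = a)) \<and>
     (\<forall>Iss Js K ws.
        D11 Js K \<and> list_all2 D11 Iss Js \<and>
        list_all2 (\<lambda>Is w. w \<in> tensor_words (map F Is) (wdeg w)) Iss ws \<longrightarrow>
        \<mu> Js K (wdeg (concat ws)) (elem_tensor (map F Js)
          (map (\<lambda>i. (wdeg (ws ! i), \<mu> (Iss ! i) (Js ! i) (wdeg (ws ! i))
                       (elem_tensor (map F (Iss ! i)) (ws ! i)))) [0..<length Js])) =
        \<mu> (concat Iss) K (wdeg (concat ws)) (elem_tensor (map F (concat Iss)) (concat ws))) \<and>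
     (\<forall>Is J \<sigma> n w.
        D11 Is J \<and> \<sigma> permutes {..<length Is} \<and> w \<in> tensor_words (map F Is) n \<longrightarrow>
        \<mu> (permute_list \<sigma> Is) J n
          (elem_tensor (map F (permute_list \<sigma> Is)) (permute_list \<sigma> w)) =
        koszul \<sigma> w \<odot>\<^bsub>Comp (F J) n\<^esub> \<mu> Is J n (elem_tensor (map F Is) w))"

definition locally_constant_tensor ::
  "(ival \<Rightarrow> ('k::field,'v) dga) \<Rightarrow>
   (ival list \<Rightarrow> ival \<Rightarrow> int \<Rightarrow> ('v word \<Rightarrow>\<^sub>0 'k) set \<Rightarrow> 'v) \<Rightarrow> bool" where
  "locally_constant_tensor F \<mu> \<longleftrightarrow>
     (\<forall>I J. D11 [I] J \<longrightarrow>
        quasi_iso (F I) (F J) (\<lambda>n a. \<mu> [I] J n (elem_tensor [F I] [(n, a)])))"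

definition compatible_with_operations ::
  "(ival \<Rightarrow> ('k::field,'v) dga) \<Rightarrow>
   (ival list \<Rightarrow> ival \<Rightarrow> int \<Rightarrow> ('v word \<Rightarrow>\<^sub>0 'k) set \<Rightarrow> 'v) \<Rightarrow>
   (ival \<Rightarrow> ('k,'w) dga) \<Rightarrow>
   (ival list \<Rightarrow> ival \<Rightarrow> int \<Rightarrow> ('w word \<Rightarrow>\<^sub>0 'k) set \<Rightarrow> 'w) \<Rightarrow>
   (ival \<Rightarrow> int \<Rightarrow> 'v \<Rightarrow> 'w) \<Rightarrow> bool" where
  "compatible_with_operations F \<mu> G \<nu> \<Phi> \<longleftrightarrow>
     (\<forall>Is J n w. D11 Is J \<and> w \<in> tensor_words (map F Is) n \<longrightarrow>
        \<Phi> J n (\<mu> Is J n (elem_tensor (map F Is) w)) =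
        \<nu> Is J n (elem_tensor (map G Is) (map2 (\<lambda>I (m, a). (m, \<Phi> I m a)) Is w)))"

definition D11_equivalence ::
  "(ival \<Rightarrow> ('k::field,'v) dga) \<Rightarrow>
   (ival list \<Rightarrow> ival \<Rightarrow> int \<Rightarrow> ('v word \<Rightarrow>\<^sub>0 'k) set \<Rightarrow> 'v) \<Rightarrow>
   (ival \<Rightarrow> ('k,'w) dga) \<Rightarrow>
   (ival list \<Rightarrow> ival \<Rightarrow> int \<Rightarrow> ('w word \<Rightarrow>\<^sub>0 'k) set \<Rightarrow> 'w) \<Rightarrow>
   (ival \<Rightarrow> int \<Rightarrow> 'v \<Rightarrow> 'w) \<Rightarrow> bool" where
  "D11_equivalence F \<mu> G \<nu> \<Phi> \<longleftrightarrow>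
     D11_algebra_tensor F \<mu> \<and> D11_algebra_tensor G \<nu> \<and>
     (\<forall>I. color I \<longrightarrow> dga_hom (F I) (G I) (\<Phi> I) \<and> quasi_iso (F I) (G I) (\<Phi> I)) \<and>
     compatible_with_operations F \<mu> G \<nu> \<Phi>"


section \<open>The algebras under consideration\<close>

definition Map :: "int set \<Rightarrow> ('k::field, int \<Rightarrow> 'k) module" where
  "Map S = \<lparr>carrier = {f. \<forall>x. x \<notin> S \<longrightarrow> f x = 0}, mult = undefined, one = undefined,
     zero = (\<lambda>_. 0), add = (\<lambda>f g x. f x + g x), smult = (\<lambda>c f x. c * f x)\<rparr>"

definition Q :: "'k::field \<Rightarrow> (int \<Rightarrow> 'k) \<Rightarrow> int \<Rightarrow> 'k" where
  "Q \<alpha> h x = h (x - 1) - (\<alpha> + inverse \<alpha>) * h x + h (x + 1)"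

definition VV :: "'k::field \<Rightarrow> ival \<Rightarrow> ('k, int \<Rightarrow> 'k) cochain" where
  "VV \<alpha> I = \<lparr>
     Comp = (\<lambda>n. if n = -1 then Map {x. fst I + 1 < real_of_int x \<and> real_of_int x < snd I - 1}
                 else if n = 0 then Map {x. fst I < real_of_int x \<and> real_of_int x < snd I}
                 else Map {}),
     Diff = (\<lambda>n. if n = -1 then Q \<alpha> else (\<lambda>_ _. 0))\<rparr>"

text \<open>Extension by zero is the identity on functions.\<close>

definition VV_op :: "ival list \<Rightarrow> ival \<Rightarrow> int \<Rightarrow> (int \<Rightarrow> 'k::field) list \<Rightarrow> int \<Rightarrow> 'k" where
  "VV_op Is J n fs = (\<lambda>x. \<Sum>f\<leftarrow>fs. f x)"

definition Ocl :: "'k::field \<Rightarrow> ival \<Rightarrow> ('k, ((int \<Rightarrow> 'k) word \<Rightarrow>\<^sub>0 'k) set) dga" where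
  "Ocl \<alpha> I = Sym (VV \<alpha> I)"

definition Ocl_op :: "'k::field \<Rightarrow> ival list \<Rightarrow> ival \<Rightarrow> int \<Rightarrow>
    (((int \<Rightarrow> 'k) word \<Rightarrow>\<^sub>0 'k) set word \<Rightarrow>\<^sub>0 'k) set \<Rightarrow> ((int \<Rightarrow> 'k) word \<Rightarrow>\<^sub>0 'k) set" where
  "Ocl_op \<alpha> Is J = tensor_ext (Ocl \<alpha> J)
     (\<lambda>w. word_prod (Ocl \<alpha> J)
       (map2 (\<lambda>I (n, a). (n, sym_map (VV \<alpha> J) (\<lambda>m v. VV_op [I] J m [v]) n a)) Is w))"

definition Afun :: "'k::field_char_0 \<Rightarrow> int \<Rightarrow> 'k" where
  "Afun \<alpha> x = (\<alpha> powi x + \<alpha> powi (- x)) / 2"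

definition Bfun :: "'k::field_char_0 \<Rightarrow> int \<Rightarrow> 'k" where
  "Bfun \<alpha> x = (if x = 0 then 0
     else of_int (sgn x) * (\<Sum>k<nat \<bar>x\<bar>. \<alpha> powi (\<bar>x\<bar> - 1 - 2 * int k)))"

text \<open>Polynomials in \<open>q\<close> and \<open>p\<close> are polynomials in \<open>p\<close> with coefficients in the
  polynomials in \<open>q\<close>.\<close>

definition qvar :: "'k::field poly poly" where "qvar = [:[:0, 1:]:]"

definition pvar :: "'k::field poly poly" where "pvar = [:0, 1:]"

definition cst :: "'k::field \<Rightarrow> 'k poly poly" where "cst c = [:[:c:]:]"

definition Kqp_mod :: "'k::field poly poly set \<Rightarrow> ('k, 'k poly poly) module" where
  "Kqp_mod S = \<lparr>carrier = S, mult = undefined, one = undefined,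
     zero = 0, add = (+), smult = (\<lambda>c x. cst c * x)\<rparr>"

definition Kqp :: "('k::field, 'k poly poly) dga" where
  "Kqp = \<lparr>Comp = (\<lambda>n. Kqp_mod (if n = 0 then UNIV else {0})), Diff = (\<lambda>_ _. 0),
     Mult = (\<lambda>_ _. (*)), Unit = 1\<rparr>"

text \<open>The span of the two generators, as a subspace of the polynomial algebra.\<close>

definition Kq_plus_Kp :: "('k::field, 'k poly poly) module" where
  "Kq_plus_Kp = Kqp_mod {cst a * qvar + cst b * pvar | a b. True}"

definition const_alg :: "('k::field,'v) dga \<Rightarrow> ival \<Rightarrow> ('k,'v) dga" where
  "const_alg A I = A"

definition const_op :: "('k::field,'v) dga \<Rightarrow> ival list \<Rightarrow> ival \<Rightarrow> int \<Rightarrow>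
    ('v word \<Rightarrow>\<^sub>0 'k) set \<Rightarrow> 'v" where
  "const_op A Is J = tensor_ext A (word_prod A)"

definition phi_fun :: "'k::field_char_0 \<Rightarrow> (int \<Rightarrow> 'k) \<Rightarrow> 'k poly poly" where
  "phi_fun \<alpha> f =
     cst (Sum_any (\<lambda>x. f x * Afun \<alpha> x)) * qvar + cst (Sum_any (\<lambda>x. f x * Bfun \<alpha> x)) * pvar"

definition phi :: "'k::field_char_0 \<Rightarrow> (int \<Rightarrow> 'k) set \<Rightarrow> 'k poly poly" where
  "phi \<alpha> X = the_elem (phi_fun \<alpha> ` X)"

definition phi_chain :: "'k::field_char_0 \<Rightarrow> ival \<Rightarrow> int \<Rightarrow> (int \<Rightarrow> 'k) \<Rightarrow> 'k poly poly" where
  "phi_chain \<alpha> I n f = (if n = 0 then phi \<alpha> (cohom_class (VV \<alpha> I) 0 f) else 0)"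

definition Phi :: "'k::field_char_0 \<Rightarrow> ival \<Rightarrow> int \<Rightarrow>
    ((int \<Rightarrow> 'k) word \<Rightarrow>\<^sub>0 'k) set \<Rightarrow> 'k poly poly" where
  "Phi \<alpha> I = sym_ext Kqp (phi_chain \<alpha> I)"

end

theory Submission
  imports Defs
begin

text \<open>The kernel of \<open>Q\<close> on all functions on the integers is spanned by \<open>A\<close> and \<open>B\<close>, and the
  addition formula \<open>B (x - y) = B x * A y - A x * B y\<close> shows that \<open>y \<mapsto> B (x - y)\<close>, cut off at
  \<open>y < x\<close>, is a Green's function for \<open>Q\<close>. Hence a function on an interval is in the image of \<open>Q\<close>
  iff it pairs to zero with \<open>A\<close> and \<open>B\<close>, and these pairings are independent on two adjacent points.

  For the symmetric algebra, split degree \<open>0\<close> as the span of two functions dual to \<open>A\<close> and \<open>B\<close> plus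
  the image of \<open>Q\<close>, and extend the homotopy \<open>Q g \<mapsto> g\<close> to a derivation \<open>s\<close> of degree \<open>-1\<close>. The
  anticommutator of \<open>s\<close> with the differential is a derivation that multiplies a product of
  generators by the number of its factors from the contractible summand. In characteristic zero
  every cocycle is therefore cohomologous to a polynomial in the two dual functions.\<close>

text \<open>Calculations in \<open>Sym\<close> and \<open>tensor\<close> are done on
  representatives, that is on linear combinations of words, with membership in the ideal in place of
  equality. Two obstacles shape this. The set \<open>sym_ideal\<close> is cut out of a two-sided
  ideal of the whole free algebra, which offers no induction inside one degree; it is therefore
  identified with an inductively generated homogeneous set. And a word does not show how many of its
  factors are contractible, since a letter of degree 0 is in general a sum of both kinds; words are
  therefore rewritten in letters of one kind each before they get a weight.

  On the side of the operad, an operation into a commutative algebra pushes every input forward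
  along its inclusion and multiplies. One locale for such functors yields the algebra structures of
  \<open>Ocl\<close> and of the constant algebra, and a natural transformation of functors yields
  compatibility with the operations. Local constancy of \<open>Ocl\<close> needs no second homotopy:
  \<open>Phi\<close> is a natural quasi-isomorphism to a constant target, so two out of three
  applies.\<close>

section \<open>Vector spaces as modules over \<open>scalars\<close>\<close>

lemma scalars_simps [simp]:
  "carrier scalars = UNIV" "mult scalars = (*)" "one scalars = 1" "zero scalars = 0" "add scalars = (+)"
  by (simp_all add: scalars_def)

lemma cring_scalars: "cring (scalars :: 'k::field ring)"
proof (rule cringI)
  show "abelian_group (scalars :: 'k ring)"
    by (rule abelian_groupI) (auto simp: algebra_simps intro: exI[of _ "- x" for x])
  show "Group.comm_monoid (scalars :: 'k ring)"
    by (rule comm_monoidI) (auto simp: algebra_simps)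
qed (auto simp: algebra_simps)

text \<open>Additive inverses come from the scalars: \<open>(-1) \<odot> x\<close> is one, by
  distributivity and the rules for \<open>1\<close> and \<open>0\<close>. Free modules, quotients,
  function spaces and polynomials are all recognized as modules through this rule.\<close>

lemma vector_spaceI:
  fixes M :: "('k::field,'v,'z) module_scheme" (structure)
  assumes "\<And>x y. x \<in> carrier M \<Longrightarrow> y \<in> carrier M \<Longrightarrow> x \<oplus> y \<in> carrier M"
    and "\<zero> \<in> carrier M"
    and "\<And>x y z. x \<in> carrier M \<Longrightarrow> y \<in> carrier M \<Longrightarrow> z \<in> carrier M \<Longrightarrow> (x \<oplus> y) \<oplus> z = x \<oplus> (y \<oplus> z)"
    and "\<And>x y. x \<in> carrier M \<Longrightarrow> y \<in> carrier M \<Longrightarrow> x \<oplus> y = y \<oplus> x"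
    and "\<And>x. x \<in> carrier M \<Longrightarrow> \<zero> \<oplus> x = x"
    and "\<And>c x. x \<in> carrier M \<Longrightarrow> c \<odot> x \<in> carrier M"
    and "\<And>a b x. x \<in> carrier M \<Longrightarrow> (a + b) \<odot> x = a \<odot> x \<oplus> b \<odot> x"
    and "\<And>a x y. x \<in> carrier M \<Longrightarrow> y \<in> carrier M \<Longrightarrow> a \<odot> (x \<oplus> y) = a \<odot> x \<oplus> a \<odot> y"
    and "\<And>a b x. x \<in> carrier M \<Longrightarrow> (a * b) \<odot> x = a \<odot> (b \<odot> x)"
    and "\<And>x. x \<in> carrier M \<Longrightarrow> 1 \<odot> x = x"
    and "\<And>x. x \<in> carrier M \<Longrightarrow> 0 \<odot> x = \<zero>"
  shows "module scalars M"
proof (rule moduleI[OF cring_scalars])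
  show "abelian_group M"
  proof (rule abelian_groupI)
    fix x assume x: "x \<in> carrier M"
    have "(-1) \<odot> x \<oplus> x = (-1 + 1) \<odot> x"
      using assms(7)[OF x, of "-1" 1] assms(10)[OF x] by simp
    then show "\<exists>y\<in>carrier M. y \<oplus> x = \<zero>"
      using x assms(6,11) by auto
  qed (use assms in auto)
qed (use assms in auto)

lemma linear_mapI:
  assumes "\<And>x. x \<in> carrier M \<Longrightarrow> f x \<in> carrier N"
    and "\<And>x y. x \<in> carrier M \<Longrightarrow> y \<in> carrier M \<Longrightarrow> f (x \<oplus>\<^bsub>M\<^esub> y) = f x \<oplus>\<^bsub>N\<^esub> f y"
    and "\<And>c x. x \<in> carrier M \<Longrightarrow> f (c \<odot>\<^bsub>M\<^esub> x) = c \<odot>\<^bsub>N\<^esub> f x"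
  shows "linear_map M N f"
  using assms by (auto simp: linear_map_def)

lemma linear_mapD:
  assumes "linear_map M N f"
  shows "x \<in> carrier M \<Longrightarrow> f x \<in> carrier N"
    and "x \<in> carrier M \<Longrightarrow> y \<in> carrier M \<Longrightarrow> f (x \<oplus>\<^bsub>M\<^esub> y) = f x \<oplus>\<^bsub>N\<^esub> f y"
    and "x \<in> carrier M \<Longrightarrow> f (c \<odot>\<^bsub>M\<^esub> x) = c \<odot>\<^bsub>N\<^esub> f x"
  using assms by (auto simp: linear_map_def)

text \<open>Linearity is tested on the carrier only. The module hypothesis keeps multiples and sums
  of carrier elements in the carrier, where \<open>f\<close> and \<open>g\<close> agree.\<close>

lemma linear_map_cong:
  assumes "linear_map M N f" "module scalars M" "\<And>x. x \<in> carrier M \<Longrightarrow> f x = g x"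
  shows "linear_map M N g"
proof -
  interpret module scalars M by fact
  note D = linear_mapD[OF assms(1)]
  show ?thesis
  proof (rule linear_mapI)
    show "g (c \<odot>\<^bsub>M\<^esub> x) = c \<odot>\<^bsub>N\<^esub> g x" if "x \<in> carrier M" for c x
      using D(3)[OF that, of c] assms(3)[OF that] assms(3)[of "c \<odot>\<^bsub>M\<^esub> x"] that by simp
  qed (use D assms(3) in force)+
qed

lemma linear_map_comp:
  "linear_map M N f \<Longrightarrow> linear_map N P g \<Longrightarrow> linear_map M P (\<lambda>x. g (f x))"
  by (intro linear_mapI) (simp_all add: linear_mapD)

lemma linear_map_zero:
  assumes "linear_map M N f" "module scalars M" "module scalars N"
  shows "f \<zero>\<^bsub>M\<^esub> = \<zero>\<^bsub>N\<^esub>"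
proof -
  interpret M: module scalars M by fact
  interpret N: module scalars N by fact
  have "f (0 \<odot>\<^bsub>M\<^esub> \<zero>\<^bsub>M\<^esub>) = 0 \<odot>\<^bsub>N\<^esub> f \<zero>\<^bsub>M\<^esub>"
    by (rule linear_mapD(3)[OF assms(1)]) simp
  moreover have "f \<zero>\<^bsub>M\<^esub> \<in> carrier N"
    using linear_mapD(1)[OF assms(1)] by simp
  ultimately show ?thesis
    using M.smult_l_null[of "\<zero>\<^bsub>M\<^esub>"] N.smult_l_null[of "f \<zero>\<^bsub>M\<^esub>"] by simp
qed

lemma minus_one_smult:
  assumes "module scalars M" "x \<in> carrier M"
  shows "(-1) \<odot>\<^bsub>M\<^esub> x = \<ominus>\<^bsub>M\<^esub> x"
proof -
  interpret M: module scalars M by fact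
  have "(-1) \<odot>\<^bsub>M\<^esub> x \<oplus>\<^bsub>M\<^esub> x = \<zero>\<^bsub>M\<^esub>"
    using M.smult_l_distr[of "-1" 1 x] M.smult_l_null[of x] M.smult_one[of x] assms(2) by simp
  then show ?thesis
    using M.minus_equality[of "(-1) \<odot>\<^bsub>M\<^esub> x" x] assms(2) M.smult_closed[of "-1" x] by simp
qed

lemma linear_map_diff:
  assumes "linear_map M N f" "module scalars M" "module scalars N" "x \<in> carrier M" "y \<in> carrier M"
  shows "f (x \<ominus>\<^bsub>M\<^esub> y) = f x \<ominus>\<^bsub>N\<^esub> f y"
proof -
  interpret M: module scalars M by fact
  interpret N: module scalars N by fact
  have "f (\<ominus>\<^bsub>M\<^esub> y) = \<ominus>\<^bsub>N\<^esub> f y"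
    using minus_one_smult[OF assms(2,5)] minus_one_smult[OF assms(3), of "f y"]
      linear_mapD[OF assms(1)] assms(5) by metis
  then show ?thesis
    using linear_mapD[OF assms(1)] assms(4,5) by (simp add: a_minus_def)
qed

lemma diff_eq_zero_iff:
  assumes "module scalars M" "x \<in> carrier M" "y \<in> carrier M"
  shows "x \<ominus>\<^bsub>M\<^esub> y = \<zero>\<^bsub>M\<^esub> \<longleftrightarrow> x = y"
proof -
  interpret M: module scalars M by fact
  show ?thesis
    using assms(2,3) by (metis M.a_inv_closed M.minus_eq M.minus_equality M.minus_minus M.r_neg)
qed

lemma submodule_vsI:
  assumes "module scalars M" "H \<subseteq> carrier M" "\<zero>\<^bsub>M\<^esub> \<in> H"
    and "\<And>x y. x \<in> H \<Longrightarrow> y \<in> H \<Longrightarrow> x \<oplus>\<^bsub>M\<^esub> y \<in> H"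
    and "\<And>c x. x \<in> H \<Longrightarrow> c \<odot>\<^bsub>M\<^esub> x \<in> H"
  shows "submodule H scalars M"
proof -
  interpret module scalars M by fact
  show ?thesis
  proof (rule submoduleI)
    show "\<ominus>\<^bsub>M\<^esub> a \<in> H" if "a \<in> H" for a
      using minus_one_smult[OF assms(1), of a] assms(2,5) that by (metis subsetD)
  qed (use assms in auto)
qed

lemma submodule_vsD:
  assumes "module scalars M" "submodule H scalars M"
  shows "H \<subseteq> carrier M" "\<zero>\<^bsub>M\<^esub> \<in> H"
    and "x \<in> H \<Longrightarrow> y \<in> H \<Longrightarrow> x \<oplus>\<^bsub>M\<^esub> y \<in> H"
    and "x \<in> H \<Longrightarrow> c \<odot>\<^bsub>M\<^esub> x \<in> H"
    and "x \<in> H \<Longrightarrow> \<ominus>\<^bsub>M\<^esub> x \<in> H"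
    and "x \<in> H \<Longrightarrow> y \<in> H \<Longrightarrow> x \<ominus>\<^bsub>M\<^esub> y \<in> H"
proof -
  interpret module scalars M by fact
  note E = submoduleE[OF assms(2)]
  show "H \<subseteq> carrier M" "x \<in> H \<Longrightarrow> y \<in> H \<Longrightarrow> x \<oplus>\<^bsub>M\<^esub> y \<in> H"
    "x \<in> H \<Longrightarrow> c \<odot>\<^bsub>M\<^esub> x \<in> H" "x \<in> H \<Longrightarrow> \<ominus>\<^bsub>M\<^esub> x \<in> H"
    "x \<in> H \<Longrightarrow> y \<in> H \<Longrightarrow> x \<ominus>\<^bsub>M\<^esub> y \<in> H"
    using E by (auto simp: a_minus_def)
  show "\<zero>\<^bsub>M\<^esub> \<in> H"
    using subgroup.one_closed[OF submodule.axioms(1)[OF assms(2)]] by simp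
qed

section \<open>Quotient spaces and maps on cosets\<close>

text \<open>Operations on cosets are defined by unions over representatives. The locale turns them
  into operations on representatives, once for cohomology, symmetric algebras and tensor products
  alike.\<close>

locale quotient_space =
  fixes M :: "('k::field,'v) module" (structure) and N :: "'v set"
  assumes vs: "module scalars M" and sub: "submodule N scalars M"
begin

sublocale M: module scalars M by (rule vs)

sublocale A: abelian_subgroup N M
  by (rule abelian_subgroupI3)
    (use submodule.axioms(1)[OF sub] M.abelian_group_axioms in \<open>auto simp: additive_subgroup_def\<close>)

lemmas N_closed = submodule_vsD[OF vs sub]

lemma coset_eq_iff:
  "x \<in> carrier M \<Longrightarrow> y \<in> carrier M \<Longrightarrow> N +> x = N +> y \<longleftrightarrow> x \<ominus> y \<in> N"
  unfolding a_minus_def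
  by (metis A.a_rcos_module A.a_repr_independence' A.a_rcos_self)

lemma mem_coset: "x \<in> carrier M \<Longrightarrow> z \<in> N +> x \<longleftrightarrow> z \<in> carrier M \<and> N +> z = N +> x"
  by (metis A.a_elemrcos_carrier A.a_rcos_self A.a_repr_independence')

lemma self_coset: "x \<in> carrier M \<Longrightarrow> x \<in> N +> x"
  by (rule A.a_rcos_self)

text \<open>This collapses the unions in \<open>smult\<close>, \<open>quot_map\<close> and
  \<open>Mult\<close> to the value at one representative, once that value is known to depend on the
  coset only.\<close>

lemma UN_coset:
  assumes "x \<in> carrier M" and "\<And>z. z \<in> carrier M \<Longrightarrow> N +> z = N +> x \<Longrightarrow> F z = F x"
  shows "(\<Union>z\<in>N +> x. F z) = F x"
  using assms mem_coset[OF assms(1)] self_coset[OF assms(1)] by blast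

lemma carrier_quot: "carrier (quot_mod M N) = (\<lambda>x. N +> x) ` carrier M"
  by (auto simp: quot_mod_def A_RCOSETS_def' )

lemma quot_add:
  "x \<in> carrier M \<Longrightarrow> y \<in> carrier M \<Longrightarrow> (N +> x) \<oplus>\<^bsub>quot_mod M N\<^esub> (N +> y) = N +> (x \<oplus> y)"
  by (simp add: quot_mod_def A.a_rcos_sum)

lemma coset_zero: "N +> \<zero> = N"
  using M.a_coset_add_zero A.a_subset by blast

lemma quot_zero: "\<zero>\<^bsub>quot_mod M N\<^esub> = N +> \<zero>"
  by (simp add: quot_mod_def coset_zero)

lemma smult_diff: "x \<in> carrier M \<Longrightarrow> y \<in> carrier M \<Longrightarrow> c \<odot> (x \<ominus> y) = c \<odot> x \<ominus> c \<odot> y"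
  by (simp add: a_minus_def M.smult_r_distr M.smult_r_minus)

lemma quot_smult: "x \<in> carrier M \<Longrightarrow> c \<odot>\<^bsub>quot_mod M N\<^esub> (N +> x) = N +> (c \<odot> x)"
  unfolding quot_mod_def
  apply simp
  apply (rule UN_coset)
   apply simp
  apply (simp add: coset_eq_iff smult_diff[symmetric] N_closed)
  done

lemma quot_module: "module scalars (quot_mod M N)"
  by (rule vector_spaceI)
    (auto simp: carrier_quot quot_add quot_smult quot_zero M.add.m_ac M.smult_l_distr[simplified]
      M.smult_r_distr M.smult_assoc1[simplified] M.smult_one[simplified] M.smult_l_null[simplified])

lemma coset_linear: "linear_map M (quot_mod M N) (\<lambda>x. N +> x)"
  by (rule linear_mapI) (auto simp: carrier_quot quot_add quot_smult)

lemma linear_map_quotI: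
  assumes "\<And>x. x \<in> carrier M \<Longrightarrow> f (N +> x) = g x" and "linear_map M P g"
  shows "linear_map (quot_mod M N) P f"
  using linear_mapD[OF assms(2)] assms(1)
  by (intro linear_mapI) (auto simp: carrier_quot quot_add quot_smult)

text \<open>A linear map that kills \<open>N\<close> is constant on each coset, so the image of a
  coset is a singleton and \<open>the_elem\<close> has a meaning. This is what
  \<open>sym_ext\<close> relies on.\<close>

lemma the_elem_coset:
  assumes "linear_map M P g" "module scalars P" "\<And>z. z \<in> N \<Longrightarrow> g z = \<zero>\<^bsub>P\<^esub>" "x \<in> carrier M"
  shows "the_elem (g ` (N +> x)) = g x"
proof -
  interpret P: module scalars P by fact
  have "g z = g x" if "z \<in> N +> x" for z
  proof -
    have z: "z \<in> carrier M" "z \<ominus> x \<in> N"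
      using that mem_coset[OF assms(4), of z] coset_eq_iff[of z x] assms(4) by auto
    have "g z \<ominus>\<^bsub>P\<^esub> g x = \<zero>\<^bsub>P\<^esub>"
      using linear_map_diff[OF assms(1) vs assms(2) z(1) assms(4)] assms(3)[OF z(2)] by simp
    then show ?thesis
      using z assms(4) linear_mapD(1)[OF assms(1)] diff_eq_zero_iff[OF assms(2)] by metis
  qed
  then have "g ` (N +> x) = {g x}"
    using self_coset[OF assms(4)] by blast
  then show ?thesis by simp
qed

end

lemma quot_map_coset:
  assumes "quotient_space M N" "quotient_space M' N'" "linear_map M M' f" "f ` N \<subseteq> N'" "x \<in> carrier M"
  shows "quot_map M' N' f (N +>\<^bsub>M\<^esub> x) = N' +>\<^bsub>M'\<^esub> f x"
proof -
  interpret Q: quotient_space M N by fact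
  interpret Q': quotient_space M' N' by fact
  show ?thesis
    unfolding quot_map_def
  proof (rule Q.UN_coset[OF assms(5)])
    fix z assume z: "z \<in> carrier M" "N +>\<^bsub>M\<^esub> z = N +>\<^bsub>M\<^esub> x"
    then have "f (z \<ominus>\<^bsub>M\<^esub> x) \<in> N'"
      using assms(4,5) Q.coset_eq_iff by auto
    then show "N' +>\<^bsub>M'\<^esub> f z = N' +>\<^bsub>M'\<^esub> f x"
      using linear_map_diff[OF assms(3) Q.vs Q'.vs z(1) assms(5)] linear_mapD(1)[OF assms(3)] z(1) assms(5)
      by (simp add: Q'.coset_eq_iff)
  qed
qed

lemma quot_map_linear:
  assumes "quotient_space M N" "quotient_space M' N'" "linear_map M M' f" "f ` N \<subseteq> N'"
  shows "linear_map (quot_mod M N) (quot_mod M' N') (quot_map M' N' f)"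
  by (rule quotient_space.linear_map_quotI[OF assms(1) quot_map_coset[OF assms]
        linear_map_comp[OF assms(3) quotient_space.coset_linear[OF assms(2)]]])


section \<open>Cohomology and quasi-isomorphisms in terms of cocycles\<close>

lemma cochain_complexD:
  assumes "cochain_complex V"
  shows "module scalars (Comp V n)" "linear_map (Comp V n) (Comp V (n + 1)) (Diff V n)"
    and "x \<in> carrier (Comp V n) \<Longrightarrow> Diff V n x \<in> carrier (Comp V (n + 1))"
    and "x \<in> carrier (Comp V n) \<Longrightarrow> Diff V (n + 1) (Diff V n x) = \<zero>\<^bsub>Comp V (n + 2)\<^esub>"
  using assms by (auto simp: cochain_complex_def dest: linear_mapD(1) intro: linear_mapD(1))

lemma chain_mapD:
  assumes "chain_map V W f"
  shows "linear_map (Comp V n) (Comp W n) (f n)"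
    and "x \<in> carrier (Comp V n) \<Longrightarrow> f n x \<in> carrier (Comp W n)"
    and "x \<in> carrier (Comp V n) \<Longrightarrow> f (n + 1) (Diff V n x) = Diff W n (f n x)"
  using assms by (auto simp: chain_map_def intro: linear_mapD(1))

lemma chain_map_comp:
  assumes "chain_map V W f" "chain_map W U g"
  shows "chain_map V U (\<lambda>n x. g n (f n x))"
  unfolding chain_map_def
  using chain_mapD[OF assms(1)] chain_mapD[OF assms(2)] linear_map_comp by metis

lemma cocycles_simps [simp]:
  "carrier (cocycles V n) = {x \<in> carrier (Comp V n). Diff V n x = \<zero>\<^bsub>Comp V (n + 1)\<^esub>}"
  "add (cocycles V n) = add (Comp V n)" "zero (cocycles V n) = zero (Comp V n)"
  "smult (cocycles V n) = smult (Comp V n)"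
  by (simp_all add: cocycles_def)

lemma submodule_cocycles:
  assumes "cochain_complex V"
  shows "submodule (carrier (cocycles V n)) scalars (Comp V n)"
proof -
  note D = cochain_complexD[OF assms]
  interpret M: module scalars "Comp V n" by (rule D)
  interpret N: module scalars "Comp V (n + 1)" by (rule D)
  show ?thesis
    using linear_mapD[OF D(2)[of n]] linear_map_zero[OF D(2) D(1) D(1), of n] M.smult_closed N.smult_r_null
    by (intro submodule_vsI[OF D(1)]) auto
qed

lemma module_cocycles:
  assumes "cochain_complex V"
  shows "module scalars (cocycles V n)"
proof -
  have "module scalars (Comp V n\<lparr>carrier := carrier (cocycles V n)\<rparr>)"
    by (rule submodule.submodule_is_module[OF submodule_cocycles[OF assms] cochain_complexD(1)[OF assms]])
  then show ?thesis
    by (simp only: cocycles_def) simp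
qed

lemma minus_cocycles:
  assumes "cochain_complex V" "x \<in> carrier (cocycles V n)" "y \<in> carrier (cocycles V n)"
  shows "x \<ominus>\<^bsub>cocycles V n\<^esub> y = x \<ominus>\<^bsub>Comp V n\<^esub> y"
  using minus_one_smult[OF module_cocycles[OF assms(1)] assms(3)]
    minus_one_smult[OF cochain_complexD(1)[OF assms(1)], of y n] assms(3)
  by (simp add: a_minus_def)

lemma linear_map_image_submodule:
  assumes "module scalars M" "module scalars N" "linear_map M N f"
  shows "submodule (f ` carrier M) scalars N"
proof -
  interpret M: module scalars M by fact
  show ?thesis
  proof (rule submodule_vsI[OF assms(2)])
    show "f ` carrier M \<subseteq> carrier N"
      using linear_mapD(1)[OF assms(3)] by auto
    show "\<zero>\<^bsub>N\<^esub> \<in> f ` carrier M"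
      using linear_map_zero[OF assms(3,1,2)] M.zero_closed by (metis imageI)
    show "x \<oplus>\<^bsub>N\<^esub> y \<in> f ` carrier M" if "x \<in> f ` carrier M" "y \<in> f ` carrier M" for x y
      using that linear_mapD(2)[OF assms(3)] M.a_closed by (auto simp flip: linear_mapD(2)[OF assms(3)])
    show "c \<odot>\<^bsub>N\<^esub> x \<in> f ` carrier M" if "x \<in> f ` carrier M" for c x
      using that linear_mapD(3)[OF assms(3)] M.smult_closed by (auto simp flip: linear_mapD(3)[OF assms(3)])
  qed
qed

text \<open>The square of the differential being zero says that \<open>Diff\<close> maps into the
  cocycles; the coboundaries are then the image of a linear map into them, hence a
  submodule.\<close>

lemma quotient_space_cohom:
  assumes "cochain_complex V"
  shows "quotient_space (cocycles V n) (coboundaries V n)"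
proof -
  note D = cochain_complexD[OF assms]
  have "linear_map (Comp V (n - 1)) (Comp V n) (Diff V (n - 1))"
    using D(2)[of "n - 1"] by simp
  moreover have "Diff V n (Diff V (n - 1) x) = \<zero>\<^bsub>Comp V (n + 1)\<^esub>"
    if "x \<in> carrier (Comp V (n - 1))" for x
    using D(4)[OF that] by (simp add: algebra_simps)
  ultimately have "linear_map (Comp V (n - 1)) (cocycles V n) (Diff V (n - 1))"
    by (auto simp: linear_map_def)
  then show ?thesis
    unfolding quotient_space_def coboundaries_def
    using linear_map_image_submodule[OF D(1) module_cocycles[OF assms]] module_cocycles[OF assms] by blast
qed

lemma carrier_cohom:
  "cochain_complex V \<Longrightarrow> carrier (cohom V n) = cohom_class V n ` carrier (cocycles V n)"
  unfolding cohom_def cohom_class_def using quotient_space.carrier_quot[OF quotient_space_cohom] by metis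

lemma cohom_class_eq_iff:
  assumes "cochain_complex V" "x \<in> carrier (cocycles V n)" "y \<in> carrier (cocycles V n)"
  shows "cohom_class V n x = cohom_class V n y \<longleftrightarrow> x \<ominus>\<^bsub>Comp V n\<^esub> y \<in> coboundaries V n"
  unfolding cohom_class_def
  using quotient_space.coset_eq_iff[OF quotient_space_cohom[OF assms(1)] assms(2,3)] minus_cocycles[OF assms]
  by simp

lemma coboundary_zero:
  assumes "cochain_complex V"
  shows "\<zero>\<^bsub>Comp V n\<^esub> \<in> coboundaries V n"
  using quotient_space.N_closed(2)[OF quotient_space_cohom[OF assms], of n] by simp

lemma linear_map_cocycles:
  assumes "cochain_complex V" "cochain_complex W" "chain_map V W f"
  shows "linear_map (cocycles V n) (cocycles W n) (f n)"
proof -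
  note F = chain_mapD[OF assms(3)]
  have "f (n + 1) \<zero>\<^bsub>Comp V (n + 1)\<^esub> = \<zero>\<^bsub>Comp W (n + 1)\<^esub>"
    by (rule linear_map_zero[OF F(1) cochain_complexD(1)[OF assms(1)] cochain_complexD(1)[OF assms(2)]])
  then show ?thesis
    using linear_mapD[OF F(1)[of n]] F(3)[of _ n] by (intro linear_mapI) (auto, metis)
qed

lemma chain_map_coboundaries:
  assumes "chain_map V W f" "x \<in> coboundaries V n"
  shows "f n x \<in> coboundaries W n"
  using assms(2) chain_mapD(2,3)[OF assms(1), of _ "n - 1"] by (auto simp: coboundaries_def)

lemma cohom_map_class:
  assumes "cochain_complex V" "cochain_complex W" "chain_map V W f" "x \<in> carrier (cocycles V n)"
  shows "cohom_map W f n (cohom_class V n x) = cohom_class W n (f n x)"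
  unfolding cohom_map_def cohom_class_def
  by (rule quot_map_coset[OF quotient_space_cohom[OF assms(1)] quotient_space_cohom[OF assms(2)]
        linear_map_cocycles[OF assms(1-3)] _ assms(4)])
    (use chain_map_coboundaries[OF assms(3)] in blast)

lemma cohom_map_linear:
  assumes "cochain_complex V" "cochain_complex W" "chain_map V W f"
  shows "linear_map (cohom V n) (cohom W n) (cohom_map W f n)"
  unfolding cohom_def cohom_map_def
  by (rule quot_map_linear[OF quotient_space_cohom[OF assms(1)] quotient_space_cohom[OF assms(2)]
        linear_map_cocycles[OF assms(1-3)]])
    (use chain_map_coboundaries[OF assms(3)] in blast)

text \<open>Injectivity of a linear map is the vanishing of its kernel, so both halves of
  bijectivity on cohomology can be expressed by cocycles, without mentioning classes.\<close>

lemma quasi_isoI: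
  assumes V: "cochain_complex V" and W: "cochain_complex W" and f: "chain_map V W f"
    and inj: "\<And>n x. x \<in> carrier (cocycles V n) \<Longrightarrow> f n x \<in> coboundaries W n \<Longrightarrow> x \<in> coboundaries V n"
    and surj: "\<And>n y. y \<in> carrier (cocycles W n) \<Longrightarrow>
      \<exists>x\<in>carrier (cocycles V n). f n x \<ominus>\<^bsub>Comp W n\<^esub> y \<in> coboundaries W n"
  shows "quasi_iso V W f"
  unfolding quasi_iso_def linear_iso_def
proof (intro conjI allI f cohom_map_linear[OF V W f])
  fix n
  note L = linear_map_cocycles[OF V W f, of n]
  interpret V: quotient_space "cocycles V n" "coboundaries V n"
    by (rule quotient_space_cohom[OF V])
  show "bij_betw (cohom_map W f n) (carrier (cohom V n)) (carrier (cohom W n))"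
  proof (rule bij_betwI')
    fix X Y assume "X \<in> carrier (cohom V n)" "Y \<in> carrier (cohom V n)"
    then obtain x y where x: "x \<in> carrier (cocycles V n)" "X = cohom_class V n x"
      and y: "y \<in> carrier (cocycles V n)" "Y = cohom_class V n y"
      unfolding carrier_cohom[OF V] by blast
    have D: "f n (x \<ominus>\<^bsub>cocycles V n\<^esub> y) = f n x \<ominus>\<^bsub>cocycles W n\<^esub> f n y"
      by (rule linear_map_diff[OF L V.vs module_cocycles[OF W] x(1) y(1)])
    have C: "x \<ominus>\<^bsub>cocycles V n\<^esub> y \<in> carrier (cocycles V n)"
      by (rule V.M.minus_closed[OF x(1) y(1)])
    have "cohom_class W n (f n x) = cohom_class W n (f n y) \<longleftrightarrow> f n (x \<ominus>\<^bsub>cocycles V n\<^esub> y) \<in> coboundaries W n"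
      using cohom_class_eq_iff[OF W] minus_cocycles[OF W] linear_mapD(1)[OF L x(1)] linear_mapD(1)[OF L y(1)] D
      by metis
    also have "\<dots> \<longleftrightarrow> x \<ominus>\<^bsub>cocycles V n\<^esub> y \<in> coboundaries V n"
      using inj[OF C] chain_map_coboundaries[OF f] by blast
    also have "\<dots> \<longleftrightarrow> X = Y"
      using cohom_class_eq_iff[OF V x(1) y(1)] minus_cocycles[OF V x(1) y(1)] x(2) y(2) by simp
    finally show "cohom_map W f n X = cohom_map W f n Y \<longleftrightarrow> X = Y"
      using cohom_map_class[OF V W f] x y by simp
  next
    fix X assume "X \<in> carrier (cohom V n)"
    then show "cohom_map W f n X \<in> carrier (cohom W n)"
      using linear_mapD(1)[OF cohom_map_linear[OF V W f]] by blast
  next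
    fix Y assume "Y \<in> carrier (cohom W n)"
    then obtain y where y: "y \<in> carrier (cocycles W n)" "Y = cohom_class W n y"
      unfolding carrier_cohom[OF W] by blast
    obtain x where x: "x \<in> carrier (cocycles V n)" "f n x \<ominus>\<^bsub>Comp W n\<^esub> y \<in> coboundaries W n"
      using surj[OF y(1)] by blast
    have "cohom_map W f n (cohom_class V n x) = Y"
      using cohom_map_class[OF V W f x(1)] cohom_class_eq_iff[OF W linear_mapD(1)[OF L x(1)] y(1)] x(2) y(2)
      by simp
    then show "\<exists>X\<in>carrier (cohom V n). Y = cohom_map W f n X"
      using x(1) unfolding carrier_cohom[OF V] by blast
  qed
qed

lemma quasi_isoD:
  assumes V: "cochain_complex V" and W: "cochain_complex W" and q: "quasi_iso V W f"
  shows "chain_map V W f"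
    and "x \<in> carrier (cocycles V n) \<Longrightarrow> f n x \<in> coboundaries W n \<Longrightarrow> x \<in> coboundaries V n"
    and "y \<in> carrier (cocycles W n) \<Longrightarrow>
      \<exists>x\<in>carrier (cocycles V n). f n x \<ominus>\<^bsub>Comp W n\<^esub> y \<in> coboundaries W n"
proof -
  show f: "chain_map V W f"
    using q by (simp add: quasi_iso_def)
  note L = linear_map_cocycles[OF V W f, of n]
  interpret V: quotient_space "cocycles V n" "coboundaries V n"
    by (rule quotient_space_cohom[OF V])
  interpret W: quotient_space "cocycles W n" "coboundaries W n"
    by (rule quotient_space_cohom[OF W])
  have bij: "bij_betw (cohom_map W f n) (carrier (cohom V n)) (carrier (cohom W n))"
    using q by (simp add: quasi_iso_def linear_iso_def)
  show "x \<in> coboundaries V n" if x: "x \<in> carrier (cocycles V n)" "f n x \<in> coboundaries W n"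
  proof -
    have "cohom_class W n (f n x) = coboundaries W n"
      unfolding cohom_class_def by (rule W.A.a_rcos_const[OF x(2)])
    moreover have z: "\<zero>\<^bsub>cocycles V n\<^esub> \<in> carrier (cocycles V n)"
      by (rule V.M.zero_closed)
    moreover have "cohom_class W n (f n \<zero>\<^bsub>cocycles V n\<^esub>) = coboundaries W n"
      unfolding cohom_class_def linear_map_zero[OF L V.vs W.vs] by (rule W.coset_zero)
    ultimately have "cohom_map W f n (cohom_class V n x) = cohom_map W f n (cohom_class V n \<zero>\<^bsub>cocycles V n\<^esub>)"
      using cohom_map_class[OF V W f] x(1) by metis
    then have "cohom_class V n x = cohom_class V n \<zero>\<^bsub>cocycles V n\<^esub>"
      using bij_betw_imp_inj_on[OF bij] x(1) z unfolding carrier_cohom[OF V] by (meson imageI inj_on_def)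
    then show ?thesis
      unfolding cohom_class_def V.coset_zero using V.self_coset[OF x(1)] by simp
  qed
  show "\<exists>x\<in>carrier (cocycles V n). f n x \<ominus>\<^bsub>Comp W n\<^esub> y \<in> coboundaries W n"
    if y: "y \<in> carrier (cocycles W n)"
  proof -
    have "cohom_class W n y \<in> carrier (cohom W n)"
      unfolding carrier_cohom[OF W] using y by blast
    then obtain x where x: "x \<in> carrier (cocycles V n)"
      "cohom_map W f n (cohom_class V n x) = cohom_class W n y"
      using bij_betw_imp_surj_on[OF bij] unfolding carrier_cohom[OF V] by (metis (no_types, lifting) imageE)
    then have "f n x \<ominus>\<^bsub>Comp W n\<^esub> y \<in> coboundaries W n"
      using cohom_class_eq_iff[OF W linear_mapD(1)[OF L x(1)] y] cohom_map_class[OF V W f x(1)] by simp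
    then show ?thesis using x(1) by blast
  qed
qed

text \<open>Two out of three, in the case where \<open>g\<close> and the composite are known. It is
  applied with \<open>Phi\<close> on the larger interval as \<open>g\<close> and \<open>Phi\<close>
  on the smaller one as \<open>h\<close>, which gives local constancy of \<open>Ocl\<close>.\<close>

lemma quasi_iso_cancel_left:
  assumes V: "cochain_complex V" and W: "cochain_complex W" and U: "cochain_complex U"
    and f: "chain_map V W f" and g: "quasi_iso W U g" and gf: "quasi_iso V U h"
    and h: "\<And>n x. x \<in> carrier (Comp V n) \<Longrightarrow> h n x = g n (f n x)"
  shows "quasi_iso V W f"
proof (rule quasi_isoI[OF V W f])
  note G = quasi_isoD[OF W U g] and H = quasi_isoD[OF V U gf]
  fix n
  note L = linear_map_cocycles[OF V W f, of n]
  show "x \<in> coboundaries V n" if "x \<in> carrier (cocycles V n)" "f n x \<in> coboundaries W n" for x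
    using that H(2)[of x n] h[of x n] chain_map_coboundaries[OF G(1)] by simp
  show "\<exists>x\<in>carrier (cocycles V n). f n x \<ominus>\<^bsub>Comp W n\<^esub> y \<in> coboundaries W n"
    if y: "y \<in> carrier (cocycles W n)" for y
  proof -
    note LG = linear_map_cocycles[OF W U G(1), of n]
    obtain x where x: "x \<in> carrier (cocycles V n)" "h n x \<ominus>\<^bsub>Comp U n\<^esub> g n y \<in> coboundaries U n"
      using H(3)[OF linear_mapD(1)[OF LG y]] by blast
    have fx: "f n x \<in> carrier (cocycles W n)"
      by (rule linear_mapD(1)[OF L x(1)])
    have "g n (f n x \<ominus>\<^bsub>cocycles W n\<^esub> y) \<in> coboundaries U n"
      using x linear_map_diff[OF LG module_cocycles[OF W] module_cocycles[OF U] fx y] h[of x n]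
        minus_cocycles[OF U linear_mapD(1)[OF LG fx] linear_mapD(1)[OF LG y]] by simp
    moreover have "f n x \<ominus>\<^bsub>cocycles W n\<^esub> y \<in> carrier (cocycles W n)"
      using submodule_vsD(6)[OF module_cocycles[OF W] module.carrier_is_submodule[OF module_cocycles[OF W]]] fx y
      by blast
    ultimately show ?thesis
      using G(2) x(1) minus_cocycles[OF W fx y] by metis
  qed
qed


section \<open>Free modules\<close>

abbreviation keys where "keys \<equiv> Poly_Mapping.keys"
abbreviation lookup where "lookup \<equiv> Poly_Mapping.lookup"
abbreviation single where "single \<equiv> Poly_Mapping.single"

lemma lookup_pscale [simp]: "lookup (pscale c x) w = c * lookup x w"
  by (simp add: pscale_def Poly_Mapping.map.rep_eq when_def)

lemma pscale_simps [simp]: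
  "pscale c 0 = 0" "pscale 0 x = 0" "pscale 1 x = x" "pscale a (pscale b x) = pscale (a * b) x"
  "pscale c (single w d) = single w (c * d)"
  by (auto intro!: poly_mapping_eqI simp: lookup_single when_def)

lemma pscale_distribs:
  "pscale c (x + y) = pscale c x + pscale c y" "pscale c (x - y) = pscale c x - pscale c y"
  "pscale (a + b) x = pscale a x + pscale b x" "pscale (a - b) x = pscale a x - pscale b x"
  "pscale (- a) x = - pscale a x" "pscale c (- x) = - pscale c x"
  by (auto intro!: poly_mapping_eqI simp: lookup_add lookup_minus algebra_simps)

lemma pscale_sum: "pscale c (sum f A) = (\<Sum>a\<in>A. pscale c (f a))"
  by (induction A rule: infinite_finite_induct) (simp_all add: pscale_distribs)

lemma keys_pscale: "keys (pscale c x) \<subseteq> keys x"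
  by (auto simp: in_keys_iff)

lemma pscale_conv_mult: "pscale c x = single 0 c * (x :: 'a::monoid_add \<Rightarrow>\<^sub>0 'k::field)"
  unfolding pscale_def by (rule mult_map_scale_conv_mult)

lemma poly_mapping_sum_single: "x = (\<Sum>w\<in>keys x. single w (lookup x w))"
  by (rule poly_mapping_eqI) (simp add: lookup_sum lookup_single when_def in_keys_iff sum.delta)

text \<open>Partial sums over subsets of the keys have their keys in \<open>S\<close> again, so the
  bound on the keys is available in the induction step. With \<open>S\<close> a set of words of one
  degree this is induction inside a homogeneous component.\<close>

lemma poly_mapping_keys_induct [consumes 1, case_names zero single_add]:
  fixes x :: "'a \<Rightarrow>\<^sub>0 'b::comm_monoid_add"
  assumes "keys x \<subseteq> S"
    and "P 0"
    and "\<And>w c x. w \<in> S \<Longrightarrow> keys x \<subseteq> S \<Longrightarrow> P x \<Longrightarrow> P (single w c + x)"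
  shows "P x"
proof -
  let ?s = "\<lambda>F. \<Sum>w\<in>F. single w (lookup x w)"
  have "P (?s F) \<and> keys (?s F) \<subseteq> S" if "finite F" "F \<subseteq> S" for F
    using that
  proof (induction F)
    case (insert w F)
    then show ?case
      using assms(3)[of w "?s F" "lookup x w"]
        keys_add[of "single w (lookup x w)" "?s F"]
      by (auto split: if_splits)
  qed (simp add: assms(2))
  from this[of "keys x"] show ?thesis
    using assms(1) poly_mapping_sum_single[of x] by simp
qed

lemma pscale_mult_left: "pscale c x * y = pscale c (x * (y :: 'a::monoid_add \<Rightarrow>\<^sub>0 'k::field))"
  by (simp add: pscale_conv_mult mult.assoc)

text \<open>Scalars are central even though words do not commute: \<open>single 0 c\<close> is
  supported at the neutral element of the monoid, and the field is commutative.\<close>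

lemma pscale_mult_right: "x * pscale c y = pscale c (x * (y :: 'a::monoid_add \<Rightarrow>\<^sub>0 'k::field))"
proof -
  have "x * single 0 c = single 0 c * x"
    by (rule poly_mapping_keys_induct[of x UNIV]) (simp_all add: algebra_simps mult_single)
  then show ?thesis
    by (simp add: pscale_conv_mult flip: mult.assoc)
qed

lemma free_mod_simps [simp]:
  "carrier (free_mod S) = {x. keys x \<subseteq> S}" "add (free_mod S) = (+)"
  "zero (free_mod S) = 0" "smult (free_mod S) = pscale"
  by (simp_all add: free_mod_def)

lemma keys_closed:
  "keys x \<subseteq> S \<Longrightarrow> keys y \<subseteq> S \<Longrightarrow> keys (x + y) \<subseteq> S"
  "keys x \<subseteq> S \<Longrightarrow> keys y \<subseteq> S \<Longrightarrow> keys (x - y) \<subseteq> S"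
  "keys x \<subseteq> S \<Longrightarrow> keys (pscale c x) \<subseteq> S"
  "w \<in> S \<Longrightarrow> keys (single w c) \<subseteq> S"
  using keys_add[of x y] keys_diff[of x y] keys_pscale[of c x] by auto

lemma module_free_mod: "module scalars (free_mod S)"
  by (rule vector_spaceI) (simp_all add: keys_closed algebra_simps pscale_distribs)

lemma minus_free_mod:
  assumes "keys x \<subseteq> S" "keys y \<subseteq> S"
  shows "x \<ominus>\<^bsub>free_mod S\<^esub> y = x - y"
  using minus_one_smult[OF module_free_mod, of y S] assms by (simp add: a_minus_def pscale_distribs)

text \<open>The standard way of comparing evaluations below: both sides are linear in the
  representative, so it is enough to look at single words with coefficient 1.\<close>

lemma free_linear_map_eqI:
  assumes f: "linear_map (free_mod S) M f" and g: "linear_map (free_mod S) M g" and M: "module scalars M"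
    and eq: "\<And>w. w \<in> S \<Longrightarrow> f (single w 1) = g (single w 1)"
    and x: "keys x \<subseteq> S"
  shows "f x = g x"
  using x
proof (induction rule: poly_mapping_keys_induct)
  case zero
  show ?case
    using linear_map_zero[OF f module_free_mod M] linear_map_zero[OF g module_free_mod M] by simp
next
  case (single_add w c x)
  have "h (single w c + x) = c \<odot>\<^bsub>M\<^esub> h (single w 1) \<oplus>\<^bsub>M\<^esub> h x"
    if h: "linear_map (free_mod S) M h" for h
    using linear_mapD(2)[OF h, of "single w c" x]
      linear_mapD(3)[OF h, of "single w 1" c] single_add
    by (simp add: keys_closed)
  then show ?case
    using f g eq single_add by metis
qed

text \<open>The keys of a sum may be fewer than those of the summands because of cancellation.
  Summing over a common finite superset puts all terms over the same index set, which additivity of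
  \<open>lin_ext\<close> needs.\<close>

lemma lin_ext_superset:
  assumes M: "module scalars M" and "finite T" "keys x \<subseteq> T" and g: "g \<in> T \<rightarrow> carrier M"
  shows "lin_ext M g x = (\<Oplus>\<^bsub>M\<^esub>w\<in>T. lookup x w \<odot>\<^bsub>M\<^esub> g w)"
proof -
  interpret M: module scalars M by fact
  have c: "lookup x w \<odot>\<^bsub>M\<^esub> g w \<in> carrier M" if "w \<in> T" for w
    using g that M.smult_closed by (simp add: Pi_iff)
  show ?thesis
    unfolding lin_ext_def
    by (rule M.add.finprod_mono_neutral_cong_left[OF assms(2,3)])
      (use c g assms(3) M.smult_l_null[simplified] in \<open>auto simp: in_keys_iff Pi_iff\<close>)
qed

lemma linear_map_lin_ext:
  assumes M: "module scalars M" and g: "\<And>w. w \<in> S \<Longrightarrow> g w \<in> carrier M"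
  shows "linear_map (free_mod S) M (lin_ext M g)"
proof (rule linear_mapI)
  interpret M: module scalars M by fact
  have c: "lookup x w \<odot>\<^bsub>M\<^esub> g w \<in> carrier M" if "w \<in> S" for w x
    using g that M.smult_closed by simp
  show "lin_ext M g x \<in> carrier M" if "x \<in> carrier (free_mod S)" for x
    unfolding lin_ext_def using that c by (intro M.add.finprod_closed) auto
  show "lin_ext M g (x \<oplus>\<^bsub>free_mod S\<^esub> y) = lin_ext M g x \<oplus>\<^bsub>M\<^esub> lin_ext M g y"
    if "x \<in> carrier (free_mod S)" "y \<in> carrier (free_mod S)" for x y
  proof -
    let ?T = "keys x \<union> keys y"
    have T: "?T \<subseteq> S" "g \<in> ?T \<rightarrow> carrier M" using that g by auto
    have "lin_ext M g (x + y) = (\<Oplus>\<^bsub>M\<^esub>w\<in>?T. lookup (x + y) w \<odot>\<^bsub>M\<^esub> g w)"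
      using T keys_add[of x y] by (intro lin_ext_superset[OF M]) auto
    also have "\<dots> = (\<Oplus>\<^bsub>M\<^esub>w\<in>?T. lookup x w \<odot>\<^bsub>M\<^esub> g w \<oplus>\<^bsub>M\<^esub> lookup y w \<odot>\<^bsub>M\<^esub> g w)"
      using T c M.smult_l_distr[simplified] by (intro M.finsum_cong') (auto simp: lookup_add subset_iff Pi_iff)
    also have "\<dots> = (\<Oplus>\<^bsub>M\<^esub>w\<in>?T. lookup x w \<odot>\<^bsub>M\<^esub> g w) \<oplus>\<^bsub>M\<^esub> (\<Oplus>\<^bsub>M\<^esub>w\<in>?T. lookup y w \<odot>\<^bsub>M\<^esub> g w)"
      using T c by (intro M.finsum_addf) auto
    also have "\<dots> = lin_ext M g x \<oplus>\<^bsub>M\<^esub> lin_ext M g y"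
      using T by (simp add: lin_ext_superset[OF M, of ?T])
    finally show ?thesis by simp
  qed
  show "lin_ext M g (a \<odot>\<^bsub>free_mod S\<^esub> x) = a \<odot>\<^bsub>M\<^esub> lin_ext M g x"
    if "x \<in> carrier (free_mod S)" for a x
  proof -
    have T: "keys x \<subseteq> S" "g \<in> keys x \<rightarrow> carrier M"
      using that g by auto
    have "lin_ext M g (pscale a x) = (\<Oplus>\<^bsub>M\<^esub>w\<in>keys x. a \<odot>\<^bsub>M\<^esub> (lookup x w \<odot>\<^bsub>M\<^esub> g w))"
      using T g by (subst lin_ext_superset[OF M finite_keys keys_pscale])
        (auto simp: M.smult_assoc1[simplified] subset_iff intro!: M.add.finprod_cong' c)
    also have "\<dots> = a \<odot>\<^bsub>M\<^esub> lin_ext M g x"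
      unfolding lin_ext_def using T c by (intro M.finsum_smult_ldistr[symmetric]) auto
    finally show ?thesis by simp
  qed
qed

lemma lin_ext_single:
  assumes M: "module scalars M" and "g w \<in> carrier M"
  shows "lin_ext M g (single w c) = c \<odot>\<^bsub>M\<^esub> g w"
proof -
  interpret M: module scalars M by fact
  show ?thesis
    using assms(2) M.smult_closed
    by (subst lin_ext_superset[OF M, of "{w}"]) (simp_all add: M.add.finprod_singleton_swap)
qed

lemma free_ext_superset:
  assumes "finite T" "keys x \<subseteq> T"
  shows "free_ext g x = (\<Sum>w\<in>T. pscale (lookup x w) (g w))"
  unfolding free_ext_def by (rule sum.mono_neutral_left[OF assms]) (auto simp: in_keys_iff)

lemma free_ext_add: "free_ext g (x + y) = free_ext g x + free_ext g y"
  using keys_add[of x y]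
  by (simp add: free_ext_superset[of "keys x \<union> keys y"]
      lookup_add pscale_distribs sum.distrib)

lemma free_ext_pscale: "free_ext g (pscale c x) = pscale c (free_ext g x)"
  unfolding free_ext_superset[OF finite_keys keys_pscale] by (simp add: free_ext_def pscale_sum)

lemma free_ext_simps [simp]: "free_ext g 0 = 0" "free_ext g (single w c) = pscale c (g w)"
  by (simp_all add: free_ext_superset[of "{}"] free_ext_superset[of "{w}"])

lemma free_ext_minus: "free_ext g (x - y) = free_ext g x - free_ext g y"
  using free_ext_add[of g "x - y" y] by (simp add: algebra_simps)

lemma keys_free_ext:
  assumes "\<And>w. w \<in> S \<Longrightarrow> keys (g w) \<subseteq> T" "keys x \<subseteq> S"
  shows "keys (free_ext g x) \<subseteq> T"
  using assms(2)
  by (induction rule: poly_mapping_keys_induct) (simp_all add: free_ext_add keys_closed assms(1))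

lemma linear_map_free_ext:
  assumes "\<And>w. w \<in> S \<Longrightarrow> keys (g w) \<subseteq> T"
  shows "linear_map (free_mod S) (free_mod T) (free_ext g)"
  by (rule linear_mapI) (simp_all add: free_ext_add free_ext_pscale keys_free_ext[OF assms])


section \<open>Graded symmetric algebras\<close>

lemma wdeg_simps [simp]:
  "wdeg [] = 0" "wdeg (a # w) = fst a + wdeg w" "wdeg (u @ v) = wdeg u + wdeg v"
  by (simp_all add: wdeg_def)

lemma mult_single_word [simp]:
  "single u a * single v b = single (u @ v) (a * b)"
  by (simp add: mult_single plus_list_def)

lemma one_word: "1 = single [] (1 :: 'k::field)"
  by (simp flip: single_one add: zero_list_def)

lemma sgn_pow_if: "sgn_pow n = (if even n then 1 else - 1)"
  by (simp add: sgn_pow_def power_int_minus_one_minus)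

lemma sgn_pow_simps [simp]:
  "sgn_pow 0 = 1" "sgn_pow 1 = - 1" "sgn_pow (- n) = sgn_pow n" "sgn_pow n * sgn_pow n = 1"
  by (simp_all add: sgn_pow_if)

lemma sgn_pow_add: "sgn_pow (m + n) = sgn_pow m * sgn_pow n"
  by (simp add: sgn_pow_if)

text \<open>On words, the derivation of degree \<open>k\<close> of the free algebra that extends \<open>\<delta>\<close>. Besides the
  differential (\<open>k = 1\<close>), the contracting homotopy (\<open>k = -1\<close>) is of this form.\<close>

fun wder :: "int \<Rightarrow> (int \<Rightarrow> 'v \<Rightarrow> 'v) \<Rightarrow> 'v word \<Rightarrow> ('v word \<Rightarrow>\<^sub>0 'k::field)" where
  "wder k \<delta> [] = 0"
| "wder k \<delta> ((n, v) # w) = single ((n + k, \<delta> n v) # w) 1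
     + pscale (sgn_pow (k * n)) (single [(n, v)] 1 * wder k \<delta> w)"

abbreviation der :: "int \<Rightarrow> (int \<Rightarrow> 'v \<Rightarrow> 'v) \<Rightarrow> ('v word \<Rightarrow>\<^sub>0 'k::field) \<Rightarrow> ('v word \<Rightarrow>\<^sub>0 'k)" where
  "der k \<delta> \<equiv> free_ext (wder k \<delta>)"

lemma word_diff_Nil [simp]: "word_diff d [] = 0"
  by (simp add: word_diff_def)

lemma word_diff_Cons:
  "word_diff d ((n, v) # w) = single ((n + 1, d 0 n v) # w) 1
     + pscale (sgn_pow n) (single [(n, v)] 1 * word_diff (\<lambda>i. d (Suc i)) w)"
  by (simp add: word_diff_def sum.lessThan_Suc_shift sum_distrib_left pscale_sum sgn_pow_add del: sum.lessThan_Suc)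

text \<open>The differential of \<open>Sym\<close> is a sum over positions. As the recursive
  derivation of degree 1 it falls under the general lemmas on derivations. The version for tensor
  products keeps its dependence on the position.\<close>

lemma word_diff_eq_wder: "word_diff (\<lambda>_. d) w = wder 1 d w"
proof (induction w)
  case (Cons a w)
  then show ?case by (cases a) (simp add: word_diff_Cons)
qed simp

lemma wder_append:
  "wder k \<delta> (u @ v) = wder k \<delta> u * single v 1
     + pscale (sgn_pow (k * wdeg u)) (single u 1 * wder k \<delta> v)"
proof (induction u)
  case (Cons a u)
  obtain n x where a: "a = (n, x)" by (cases a)
  have "single [(n, x)] 1 * (single u 1 * z) = single ((n, x) # u) (1::'b) * z" for z
    by (simp flip: mult.assoc)
  then show ?case
    unfolding append_Cons a wder.simps Cons
    by (simp add: algebra_simps pscale_distribs pscale_mult_left pscale_mult_right sgn_pow_add)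
qed (simp flip: one_word)

text \<open>The sign in the graded Leibniz rule sees the degree of the left factor only, so
  \<open>x\<close> is homogeneous and \<open>y\<close> is arbitrary. Bilinearity reduces the claim
  to \<open>wder_append\<close>.\<close>

lemma der_mult:
  assumes "keys x \<subseteq> {w. wdeg w = m}"
  shows "der k \<delta> (x * y) = der k \<delta> x * y + pscale (sgn_pow (k * m)) (x * der k \<delta> y)"
  using assms
proof (induction rule: poly_mapping_keys_induct)
  case (single_add u c x)
  have "der k \<delta> (single u c * y) =
      der k \<delta> (single u c) * y + pscale (sgn_pow (k * m)) (single u c * der k \<delta> y)"
    using subset_UNIV[of "keys y"]
  proof (induction rule: poly_mapping_keys_induct)
    case (single_add v d y)
    note IH = this
    have "der k \<delta> (single u c * single v d) =
      der k \<delta> (single u c) * single v d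
        + pscale (sgn_pow (k * m)) (single u c * der k \<delta> (single v d))"
    proof -
      have "z * single v d = pscale d (z * single v 1)"
        "single u c * z = pscale c (single u 1 * z)" for z :: "'a word \<Rightarrow>\<^sub>0 'b"
        using pscale_mult_right[of z d "single v 1"]
          pscale_mult_left[of c "single u 1" z] by simp_all
      then show ?thesis
        using \<open>u \<in> {w. wdeg w = m}\<close>
        by (simp add: wder_append pscale_distribs pscale_mult_left pscale_mult_right algebra_simps)
    qed
    then show ?case
      using IH by (simp add: distrib_left free_ext_add pscale_distribs algebra_simps del: mult_single_word)
  qed simp_all
  then show ?case
    using single_add by (simp add: distrib_right free_ext_add pscale_distribs algebra_simps)
qed simp

lemma lettersI [intro]: "v \<in> carrier (Comp V n) \<Longrightarrow> (n, v) \<in> letters V"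
  by (simp add: letters_def)

lemma sym_words_simps [simp]:
  "[] \<in> sym_words V n \<longleftrightarrow> n = 0"
  "(m, v) # w \<in> sym_words V n \<longleftrightarrow> v \<in> carrier (Comp V m) \<and> w \<in> sym_words V (n - m)"
  by (auto simp: sym_words_def letters_def)

lemma sym_words_append: "u \<in> sym_words V m \<Longrightarrow> v \<in> sym_words V n \<Longrightarrow> u @ v \<in> sym_words V (m + n)"
  by (auto simp: sym_words_def)

lemma sym_words_wdeg: "w \<in> sym_words V n \<Longrightarrow> wdeg w = n"
  by (simp add: sym_words_def)

lemma keys_mult_words:
  assumes "keys x \<subseteq> S" "keys y \<subseteq> T" "\<And>u v. u \<in> S \<Longrightarrow> v \<in> T \<Longrightarrow> u @ v \<in> U"
  shows "keys (x * y) \<subseteq> U"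
  using keys_mult[of x y] assms by (force simp: plus_list_def)

lemma keys_mult_sym:
  "keys x \<subseteq> sym_words V m \<Longrightarrow> keys y \<subseteq> sym_words V n \<Longrightarrow>
    keys (x * y) \<subseteq> sym_words V (m + n)"
  by (rule keys_mult_words) (auto intro: sym_words_append)

lemma wder_keys:
  assumes "\<And>n v. v \<in> carrier (Comp V n) \<Longrightarrow> \<delta> n v \<in> carrier (Comp V (n + k))" "w \<in> sym_words V n"
  shows "keys (wder k \<delta> w :: 'v word \<Rightarrow>\<^sub>0 'k::field) \<subseteq> sym_words V (n + k)"
  using assms(2)
proof (induction w arbitrary: n)
  case (Cons a w)
  obtain m v where a: "a = (m, v)" by (cases a)
  have "keys (single [(m, v)] (1 :: 'k)) \<subseteq> sym_words V m"
    "keys (wder k \<delta> w :: 'v word \<Rightarrow>\<^sub>0 'k) \<subseteq> sym_words V (n - m + k)"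
    using Cons.prems a Cons.IH[of "n - m"] by simp_all
  note keys_mult_sym[OF this]
  moreover have "m + (n - m + k) = n + k" "n + k - (m + k) = n - m" by simp_all
  ultimately show ?case
    using Cons.prems assms(1)[of v m] by (simp add: a keys_closed)
qed simp

lemma der_keys:
  assumes "\<And>n v. v \<in> carrier (Comp V n) \<Longrightarrow> \<delta> n v \<in> carrier (Comp V (n + k))"
    "keys x \<subseteq> sym_words V n"
  shows "keys (der k \<delta> x) \<subseteq> sym_words V (n + k)"
  by (rule keys_free_ext[OF wder_keys assms(2)]) (use assms(1) in auto)

section \<open>The homogeneous parts of the ideal of relations\<close>

text \<open>The part of degree \<open>n\<close> of the two-sided ideal, spanned by relations
  multiplied with a word on either side. Since degrees are recorded in the generators, induction
  never leaves degree \<open>n\<close>, in contrast to the ideal generated in the free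
  algebra.\<close>

inductive_set symI :: "('k::field,'v,'z) cochain_scheme \<Rightarrow> int \<Rightarrow> ('v word \<Rightarrow>\<^sub>0 'k) set" for V n where
  zero: "0 \<in> symI V n"
| add: "x \<in> symI V n \<Longrightarrow> y \<in> symI V n \<Longrightarrow> x + y \<in> symI V n"
| gen: "r \<in> sym_rels V \<Longrightarrow> keys r \<subseteq> sym_words V k \<Longrightarrow> a \<in> lists (letters V) \<Longrightarrow>
    b \<in> lists (letters V) \<Longrightarrow> n = wdeg a + k + wdeg b \<Longrightarrow>
    single a c * r * single b 1 \<in> symI V n"

lemma symI_keys: "x \<in> symI V n \<Longrightarrow> keys x \<subseteq> sym_words V n"
proof (induction rule: symI.induct)
  case (gen r k a b c)
  show ?case
    unfolding gen(5) by (intro keys_mult_sym gen(2) keys_closed) (use gen in \<open>auto simp: sym_words_def\<close>)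
qed (auto simp: keys_closed)

lemma symI_pscale: "x \<in> symI V n \<Longrightarrow> pscale c x \<in> symI V n"
proof (induction rule: symI.induct)
  case (gen r k a b d)
  have "pscale c (single a d * r * single b 1) =
    single a (c * d) * r * single b 1"
    by (simp flip: pscale_mult_left)
  then show ?case using symI.gen[OF gen] by metis
qed (auto simp: pscale_distribs intro: symI.intros)

lemma symI_minus: "x \<in> symI V n \<Longrightarrow> y \<in> symI V n \<Longrightarrow> x - y \<in> symI V n"
  using symI.add[OF _ symI_pscale[of y V n "-1"]] by (simp add: pscale_distribs)

lemma symI_word_left:
  "x \<in> symI V n \<Longrightarrow> w \<in> sym_words V m \<Longrightarrow> single w d * x \<in> symI V (m + n)"
proof (induction rule: symI.induct)
  case (gen r k a b c)
  have "single (w @ a) (d * c) * r * single b 1 \<in> symI V (m + n)"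
    by (rule symI.gen[OF gen(1,2)]) (use gen in \<open>auto simp: sym_words_def\<close>)
  then show ?case by (simp flip: mult.assoc)
qed (auto simp: distrib_left intro: symI.intros)

lemma symI_word_right:
  "x \<in> symI V n \<Longrightarrow> w \<in> sym_words V m \<Longrightarrow> x * single w d \<in> symI V (n + m)"
proof (induction rule: symI.induct)
  case (gen r k a b c)
  have "pscale d (single a c * r * single (b @ w) 1) \<in> symI V (n + m)"
    by (rule symI_pscale, rule symI.gen[OF gen(1,2)]) (use gen in \<open>auto simp: sym_words_def\<close>)
  moreover have "single w d = pscale d (single w 1)" by simp
  ultimately show ?case
    by (simp only: pscale_mult_right mult.assoc mult_single_word mult_1)
qed (auto simp: distrib_right intro: symI.intros)

lemma symI_mult_left:
  assumes "x \<in> symI V n" "keys z \<subseteq> sym_words V m"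
  shows "z * x \<in> symI V (m + n)"
  using assms(2)
  by (induction rule: poly_mapping_keys_induct)
    (simp_all add: distrib_right symI.intros symI_word_left[OF assms(1)])

lemma symI_mult_right:
  assumes "x \<in> symI V n" "keys z \<subseteq> sym_words V m"
  shows "x * z \<in> symI V (n + m)"
  using assms(2)
  by (induction rule: poly_mapping_keys_induct)
    (simp_all add: distrib_left symI.intros symI_word_right[OF assms(1)])

lemma sym_relsE:
  assumes "r \<in> sym_rels V"
  obtains
      n u v where "r = single [(n, u \<oplus>\<^bsub>Comp V n\<^esub> v)] 1 - single [(n, u)] 1 - single [(n, v)] 1"
        "u \<in> carrier (Comp V n)" "v \<in> carrier (Comp V n)"
    | n c u where "r = single [(n, c \<odot>\<^bsub>Comp V n\<^esub> u)] 1 - single [(n, u)] c" "u \<in> carrier (Comp V n)"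
    | m n u v where "r = single [(m, u), (n, v)] 1 - single [(n, v), (m, u)] (sgn_pow (m * n))"
        "u \<in> carrier (Comp V m)" "v \<in> carrier (Comp V n)"
  using assms unfolding sym_rels_def by blast

lemma sym_rels_homogeneous:
  assumes "\<And>n. module scalars (Comp V n)" "r \<in> sym_rels V"
  obtains k where "keys r \<subseteq> sym_words V k"
proof -
  have cl: "u \<oplus>\<^bsub>Comp V n\<^esub> v \<in> carrier (Comp V n)" "c \<odot>\<^bsub>Comp V n\<^esub> u \<in> carrier (Comp V n)"
    if "u \<in> carrier (Comp V n)" "v \<in> carrier (Comp V n)" for n u v c
  proof -
    interpret module scalars "Comp V n" by (rule assms)
    show "u \<oplus>\<^bsub>Comp V n\<^esub> v \<in> carrier (Comp V n)" "c \<odot>\<^bsub>Comp V n\<^esub> u \<in> carrier (Comp V n)"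
      using that by auto
  qed
  from assms(2) show thesis
  proof (cases rule: sym_relsE)
    case (1 n u v)
    then show ?thesis by (intro that[of n]) (simp, intro keys_closed; simp add: cl)
  next
    case (2 n c u)
    then show ?thesis by (intro that[of n]) (simp, intro keys_closed; simp add: cl)
  next
    case (3 m n u v)
    then show ?thesis by (intro that[of "m + n"]) (simp, intro keys_closed; simp)
  qed
qed

lemma free_alg_simps [simp]:
  "carrier (free_alg S) = {x. keys x \<subseteq> lists S}" "mult (free_alg S) = (*)"
  "one (free_alg S) = 1" "zero (free_alg S) = 0" "add (free_alg S) = (+)"
  by (simp_all add: free_alg_def)

lemma keys_mult_lists:
  "keys x \<subseteq> lists S \<Longrightarrow> keys y \<subseteq> lists S \<Longrightarrow> keys (x * y) \<subseteq> lists S"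
  by (rule keys_mult_words) auto

lemma ring_free_alg: "Ring.ring (free_alg S :: ('a list \<Rightarrow>\<^sub>0 'k::field) ring)"
proof (rule ringI)
  show "abelian_group (free_alg S :: ('a list \<Rightarrow>\<^sub>0 'k) ring)"
  proof (rule abelian_groupI)
    fix x :: "'a list \<Rightarrow>\<^sub>0 'k" assume "x \<in> carrier (free_alg S)"
    then show "\<exists>y\<in>carrier (free_alg S). y \<oplus>\<^bsub>free_alg S\<^esub> x = \<zero>\<^bsub>free_alg S\<^esub>"
      using keys_closed(2)[of 0 "lists S" x] by (intro bexI[of _ "- x"]) auto
  qed (auto simp: keys_closed algebra_simps)
  show "Group.monoid (free_alg S :: ('a list \<Rightarrow>\<^sub>0 'k) ring)"
    by (rule monoidI) (simp_all add: keys_mult_lists mult.assoc zero_list_def)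
qed (simp_all add: algebra_simps)

lemma homogeneous_part_id:
  assumes "keys x \<subseteq> {w. wdeg w = m}"
  shows "free_ext (\<lambda>w. if wdeg w = n then single w 1 else 0) x = (if m = n then x else 0)"
  using assms
  by (induction rule: poly_mapping_keys_induct) (simp_all add: free_ext_add)

text \<open>Here \<open>h n\<close> is the projection onto the words of degree \<open>n\<close>.
  Multiplication with a word shifts degrees, so the projection passes through with a shifted
  index.\<close>

lemma homogeneous_part_word:
  fixes n :: int
  defines "h \<equiv> \<lambda>n. free_ext (\<lambda>w. if wdeg w = n then single w (1::'k::field) else 0)"
  shows "h n (single a c * x) = single a c * h (n - wdeg a) x"
    and "h n (x * single a c) = h (n - wdeg a) x * single a c"
proof -
  show "h n (single a c * x) = single a c * h (n - wdeg a) x"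
    unfolding h_def
    by (rule poly_mapping_keys_induct[of x UNIV]) (auto simp: distrib_left free_ext_add)
  show "h n (x * single a c) = h (n - wdeg a) x * single a c"
    unfolding h_def
    by (rule poly_mapping_keys_induct[of x UNIV]) (auto simp: distrib_right free_ext_add)
qed

text \<open>One inclusion is closure of the ideal under the rules of \<open>symI\<close>. For the
  other, let \<open>J\<close> be the set of elements whose component in every degree lies in the
  corresponding \<open>symI\<close>. It is a two-sided ideal and contains the relations, because
  each relation is homogeneous; hence it contains the generated ideal. An element of
  \<open>sym_ideal V n\<close> is its own component of degree \<open>n\<close>.\<close>

lemma sym_ideal_eq_symI:
  fixes V :: "('k::field,'v,'z) cochain_scheme"
  assumes V: "\<And>n. module scalars (Comp V n)"
  shows "sym_ideal V n = symI V n"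
proof
  let ?L = "letters V" and ?R = "free_alg (letters V) :: ('v word \<Rightarrow>\<^sub>0 'k) ring"
  interpret R: Ring.ring ?R by (rule ring_free_alg)
  have sub: "sym_words V k \<subseteq> lists ?L" for k by (auto simp: sym_words_def)
  have rels: "sym_rels V \<subseteq> carrier ?R"
    using sym_rels_homogeneous[OF V] sub by (simp add: subset_iff) metis
  interpret I: ideal "Idl\<^bsub>?R\<^esub> sym_rels V" ?R
    by (rule R.genideal_ideal[OF rels])
  have "x \<in> Idl\<^bsub>?R\<^esub> sym_rels V" if "x \<in> symI V n" for x
    using that
  proof (induction rule: symI.induct)
    case (gen r k a b c)
    then show ?case
      using R.genideal_self[OF rels] I.I_l_closed[of r "single a c"]
        I.I_r_closed[of "single a c * r" "single b 1"]
      by (simp add: subset_iff in_lists_conv_set)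
  qed (use I.zero_closed I.a_closed in auto)
  then show "symI V n \<subseteq> sym_ideal V n"
    using subsetD[OF symI_keys] by (auto simp: sym_ideal_def sym_free_def)
  define h :: "int \<Rightarrow> ('v word \<Rightarrow>\<^sub>0 'k) \<Rightarrow> ('v word \<Rightarrow>\<^sub>0 'k)" where
    "h = (\<lambda>n. free_ext (\<lambda>w. if wdeg w = n then single w 1 else 0))"
  define J where "J = {x \<in> carrier ?R. \<forall>n. h n x \<in> symI V n}"
  have h_add: "h n (x + y) = h n x + h n y" for n x y
    by (simp add: h_def free_ext_add)
  have J_add: "x + y \<in> J" if "x \<in> J" "y \<in> J" for x y
    using that by (auto simp: J_def h_add keys_closed symI.add)
  have J_scale: "pscale c x \<in> J" if "x \<in> J" for c x
    using that by (auto simp: J_def h_def free_ext_pscale keys_closed symI_pscale)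
  have J0: "0 \<in> J"
    by (simp add: J_def h_def symI.zero)
  have J_left: "y * x \<in> J" if "x \<in> J" "y \<in> carrier ?R" for x y
  proof -
    from that(2) have "keys y \<subseteq> lists ?L" by simp
    then show ?thesis
    proof (induction rule: poly_mapping_keys_induct)
      case (single_add w c y)
      have "h n (single w c * x) \<in> symI V n" for n
        using symI_word_left[of "h (n - wdeg w) x" V "n - wdeg w" w "wdeg w"] that(1) single_add(1)
        by (simp add: h_def homogeneous_part_word J_def sym_words_def)
      then have "single w c * x \<in> J"
        using that(1) single_add(1) by (simp add: J_def keys_mult_lists keys_closed)
      then show ?case using single_add(3) by (simp add: distrib_right J_add)
    qed (simp add: J0)
  qed
  have J_right: "x * y \<in> J" if "x \<in> J" "y \<in> carrier ?R" for x y
  proof -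
    from that(2) have "keys y \<subseteq> lists ?L" by simp
    then show ?thesis
    proof (induction rule: poly_mapping_keys_induct)
      case (single_add w c y)
      have "h n (x * single w c) \<in> symI V n" for n
        using symI_word_right[of "h (n - wdeg w) x" V "n - wdeg w" w "wdeg w"] that(1) single_add(1)
        by (simp add: h_def homogeneous_part_word J_def sym_words_def)
      then have "x * single w c \<in> J"
        using that(1) single_add(1) by (simp add: J_def keys_mult_lists keys_closed)
      then show ?case using single_add(3) by (simp add: distrib_left J_add)
    qed (simp add: J0)
  qed
  have "ideal J ?R"
  proof (rule idealI[OF ring_free_alg])
    show "subgroup J (add_monoid ?R)"
    proof (rule R.add.subgroupI)
      fix x assume x: "x \<in> J"
      have "- x \<in> J"
        using J_scale[OF x, of "-1"] by (simp add: pscale_distribs)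
      moreover have "\<ominus>\<^bsub>?R\<^esub> x = - x"
        by (rule R.minus_equality) (use x calculation in \<open>auto simp: J_def\<close>)
      ultimately show "\<ominus>\<^bsub>?R\<^esub> x \<in> J"
        by simp
    next
      show "J \<noteq> {}" using J0 by blast
    qed (use J_add in \<open>auto simp: J_def\<close>)
  qed (use J_left J_right in auto)
  moreover have "sym_rels V \<subseteq> J"
  proof
    fix r assume r: "r \<in> sym_rels V"
    obtain k where k: "keys r \<subseteq> sym_words V k"
      using sym_rels_homogeneous[OF V r] by blast
    then have "h n r = (if k = n then r else 0)" for n
      unfolding h_def by (intro homogeneous_part_id) (auto simp: sym_words_def)
    moreover have "r \<in> symI V k"
      using symI.gen[OF r k, of "[]" "[]" k 1] by (simp flip: one_word)
    moreover have "keys r \<subseteq> lists ?L"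
      using k sub by blast
    ultimately show "r \<in> J"
      by (simp add: J_def symI.zero)
  qed
  ultimately have *: "Idl\<^bsub>?R\<^esub> sym_rels V \<subseteq> J"
    by (rule R.genideal_minimal)
  show "sym_ideal V n \<subseteq> symI V n"
  proof
    fix x assume x: "x \<in> sym_ideal V n"
    then have "h n x \<in> symI V n" and k: "keys x \<subseteq> sym_words V n"
      using * by (auto simp: sym_ideal_def J_def sym_free_def)
    moreover have "h n x = x"
      using k homogeneous_part_id[of x n n] by (auto simp: h_def sym_words_def)
    ultimately show "x \<in> symI V n" by simp
  qed
qed


section \<open>The symmetric algebra of a complex as a differential graded commutative
  algebra\<close>

definition sym_cls :: "('k::field,'v,'z) cochain_scheme \<Rightarrow> int \<Rightarrow> ('v word \<Rightarrow>\<^sub>0 'k) \<Rightarrow> ('v word \<Rightarrow>\<^sub>0 'k) set" where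
  "sym_cls V n x = sym_ideal V n +>\<^bsub>sym_free V n\<^esub> x"

locale complex_space =
  fixes V :: "('k::field,'v,'z) cochain_scheme"
  assumes complex: "cochain_complex V"
begin

lemma Comp_module: "module scalars (Comp V n)"
  using complex by (rule cochain_complexD)

lemmas ideal_eq = sym_ideal_eq_symI[OF Comp_module]

lemma sym_ideal_keys: "x \<in> sym_ideal V n \<Longrightarrow> keys x \<subseteq> sym_words V n"
  by (simp add: ideal_eq symI_keys)

lemma sym_ideal_zero: "0 \<in> sym_ideal V n"
  by (simp add: ideal_eq symI.zero)

lemma sym_ideal_add: "x \<in> sym_ideal V n \<Longrightarrow> y \<in> sym_ideal V n \<Longrightarrow> x + y \<in> sym_ideal V n"
  by (simp add: ideal_eq symI.add)

lemma sym_ideal_minus: "x \<in> sym_ideal V n \<Longrightarrow> y \<in> sym_ideal V n \<Longrightarrow> x - y \<in> sym_ideal V n"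
  by (simp add: ideal_eq symI_minus)

lemma sym_ideal_pscale: "x \<in> sym_ideal V n \<Longrightarrow> pscale c x \<in> sym_ideal V n"
  by (simp add: ideal_eq symI_pscale)

lemma sym_ideal_mult_left:
  "x \<in> sym_ideal V n \<Longrightarrow> keys z \<subseteq> sym_words V m \<Longrightarrow> z * x \<in> sym_ideal V (m + n)"
  by (simp add: ideal_eq symI_mult_left)

lemma sym_ideal_mult_right:
  "x \<in> sym_ideal V n \<Longrightarrow> keys z \<subseteq> sym_words V m \<Longrightarrow> x * z \<in> sym_ideal V (n + m)"
  by (simp add: ideal_eq symI_mult_right)

lemma sym_rel: "r \<in> sym_rels V \<Longrightarrow> keys r \<subseteq> sym_words V k \<Longrightarrow> r \<in> sym_ideal V k"
  using symI.gen[of r V k "[]" "[]" k 1] by (simp add: ideal_eq flip: one_word)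

lemma sym_rel_add:
  assumes "u \<in> carrier (Comp V n)" "v \<in> carrier (Comp V n)"
  shows "single [(n, u \<oplus>\<^bsub>Comp V n\<^esub> v)] 1
    - single [(n, u)] 1 - single [(n, v)] 1 \<in> sym_ideal V n"
proof -
  interpret module scalars "Comp V n" by (rule Comp_module)
  show ?thesis
    by (rule sym_rel, use assms in \<open>unfold sym_rels_def, blast\<close>, intro keys_closed) (simp_all add: assms)
qed

lemma sym_rel_smult:
  assumes "u \<in> carrier (Comp V n)"
  shows "single [(n, c \<odot>\<^bsub>Comp V n\<^esub> u)] 1 - single [(n, u)] c \<in> sym_ideal V n"
proof -
  interpret module scalars "Comp V n" by (rule Comp_module)
  show ?thesis
    by (rule sym_rel, use assms in \<open>unfold sym_rels_def, blast\<close>, intro keys_closed) (simp_all add: assms)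
qed

lemma sym_rel_comm:
  assumes "u \<in> carrier (Comp V m)" "v \<in> carrier (Comp V n)"
  shows "single [(m, u), (n, v)] 1
    - single [(n, v), (m, u)] (sgn_pow (m * n)) \<in> sym_ideal V (m + n)"
  by (rule sym_rel, use assms in \<open>unfold sym_rels_def, blast\<close>, intro keys_closed) (simp_all add: assms)

text \<open>A letter with entry zero is a basis word and not the zero of the free module; only the
  relation for the scalar \<open>0\<close> identifies the two. Vanishing of an element of
  \<open>V\<close> can be used inside words through this fact.\<close>

lemma sym_rel_zero: "single [(n, \<zero>\<^bsub>Comp V n\<^esub>)] c \<in> sym_ideal V n"
proof -
  interpret module scalars "Comp V n" by (rule Comp_module)
  have "single [(n, \<zero>\<^bsub>Comp V n\<^esub>)] 1 \<in> sym_ideal V n"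
    using sym_rel_smult[of "\<zero>\<^bsub>Comp V n\<^esub>" n 0] smult_r_null[of 0] by simp
  then show ?thesis
    using sym_ideal_pscale[of "single [(n, \<zero>\<^bsub>Comp V n\<^esub>)] 1" n c] by simp
qed

text \<open>Linearity of \<open>\<delta>\<close> turns each linear relation into a linear relation
  between the images. A commutation relation becomes a combination of two commutation relations, one
  for each letter hit by the derivation.\<close>

lemma der_sym_rel:
  assumes \<delta>: "\<And>n. linear_map (Comp V n) (Comp V (n + k)) (\<delta> n)"
    and r: "r \<in> sym_rels V" "keys r \<subseteq> sym_words V l"
  shows "der k \<delta> r \<in> sym_ideal V (l + k)"
proof -
  note D = linear_mapD[OF \<delta>]
  have "\<exists>m. keys r \<subseteq> sym_words V m \<and> der k \<delta> r \<in> sym_ideal V (m + k)"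
  proof -
    from r(1) show ?thesis
    proof (cases rule: sym_relsE)
      case (1 m u v)
      then show ?thesis
        using sym_rel_add[OF D(1)[OF 1(2)] D(1)[OF 1(3)]] sym_ideal_keys[OF sym_rel_add[OF 1(2,3)]]
        by (auto simp: free_ext_minus D)
    next
      case (2 m c u)
      then show ?thesis
        using sym_rel_smult[OF D(1)[OF 2(2)], of c] sym_ideal_keys[OF sym_rel_smult[OF 2(2), of c]]
        by (auto simp: free_ext_minus D)
    next
      case (3 m p u v)
      \<comment> \<open>The four terms of the Leibniz rule are regrouped by the letter that was
        differentiated; the shifted degree \<open>m + k\<close> or \<open>p + k\<close> accounts for
        the sign.\<close>
      have "der k \<delta> r = (single [(m + k, \<delta> m u), (p, v)] 1
            - single [(p, v), (m + k, \<delta> m u)] (sgn_pow ((m + k) * p)))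
          + pscale (sgn_pow (k * m)) (single [(m, u), (p + k, \<delta> p v)] 1
            - single [(p + k, \<delta> p v), (m, u)] (sgn_pow (m * (p + k))))"
        unfolding 3(1)
        by (simp add: free_ext_minus pscale_distribs, simp add: sgn_pow_if algebra_simps)
      moreover have "\<dots> \<in> sym_ideal V (m + p + k)"
        using sym_rel_comm[OF D(1)[OF 3(2)] 3(3)] sym_rel_comm[OF 3(2) D(1)[OF 3(3)]]
        by (intro sym_ideal_add sym_ideal_pscale) (simp_all add: add.assoc add.commute add.left_commute)
      ultimately show ?thesis
        using sym_ideal_keys[OF sym_rel_comm[OF 3(2,3)]] 3(1) by auto
    qed
  qed
  then obtain m where m: "keys r \<subseteq> sym_words V m" "der k \<delta> r \<in> sym_ideal V (m + k)"
    by blast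
  \<comment> \<open>The degree \<open>m\<close> was read off from the shape of the relation. A
    nonzero element has only one degree, so \<open>m = l\<close>; the zero element lies in the ideal
    in every degree.\<close>
  show ?thesis
  proof (cases "r = 0")
    case True
    then show ?thesis by (simp add: sym_ideal_zero)
  next
    case False
    then obtain w where "w \<in> keys r" by fastforce
    then have "m = l"
      using m(1) r(2) sym_words_wdeg by blast
    then show ?thesis using m by simp
  qed
qed

text \<open>On \<open>a * r * b\<close> the outer terms contain \<open>r\<close> itself and the
  middle term contains the derivative of \<open>r\<close>, which is in the ideal as well. The degree
  \<open>k\<close> is a parameter so that the differential and the contracting homotopy are covered
  at once.\<close>

lemma der_sym_ideal:
  assumes \<delta>: "\<And>n. linear_map (Comp V n) (Comp V (n + k)) (\<delta> n)" and x: "x \<in> sym_ideal V n"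
  shows "der k \<delta> x \<in> sym_ideal V (n + k)"
  using x unfolding ideal_eq
proof (induction rule: symI.induct)
  case (gen r l a b c)
  note cl = linear_mapD(1)[OF \<delta>]
  have r: "r \<in> sym_ideal V l"
    using gen sym_rel by blast
  have a: "keys (single a c) \<subseteq> sym_words V (wdeg a)"
    and b: "keys (single b (1::'k)) \<subseteq> sym_words V (wdeg b)"
    using gen(3,4) by (auto simp: sym_words_def)
  have rk: "keys r \<subseteq> {w. wdeg w = l}"
    using gen(2) sym_words_wdeg by blast
  have ar: "keys (single a c * r) \<subseteq> {w. wdeg w = wdeg a + l}"
    using keys_mult_sym[OF a gen(2)] sym_words_wdeg by blast
  have dr: "der k \<delta> r \<in> sym_ideal V (l + k)"
    by (rule der_sym_rel[OF \<delta> gen(1,2)])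
  have "der k \<delta> (single a c * r * single b 1) =
      der k \<delta> (single a c) * r * single b 1
      + pscale (sgn_pow (k * wdeg a)) (single a c * der k \<delta> r * single b 1)
      + pscale (sgn_pow (k * (wdeg a + l))) (single a c * r * der k \<delta> (single b 1))"
    unfolding der_mult[OF ar] by (subst der_mult[of _ "wdeg a"]) (auto simp: distrib_right pscale_mult_left)
  moreover have "der k \<delta> (single a c) * r * single b 1 \<in> sym_ideal V ((wdeg a + k) + l + wdeg b)"
    by (intro sym_ideal_mult_right sym_ideal_mult_left r b der_keys[OF cl a])
  moreover have "single a c * der k \<delta> r * single b 1 \<in> sym_ideal V (wdeg a + (l + k) + wdeg b)"
    by (intro sym_ideal_mult_right sym_ideal_mult_left dr a b)
  moreover have "single a c * r * der k \<delta> (single b 1) \<in> sym_ideal V (wdeg a + l + (wdeg b + k))"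
    by (intro sym_ideal_mult_right sym_ideal_mult_left r a der_keys[OF cl b])
  ultimately show ?case
    unfolding gen(5) ideal_eq[symmetric]
    by (simp only:, intro sym_ideal_add sym_ideal_pscale) (simp_all only: ac_simps)
qed (auto simp: free_ext_add intro: symI.intros)

end


lemma sym_free_simps [simp]:
  "carrier (sym_free V n) = {x. keys x \<subseteq> sym_words V n}" "add (sym_free V n) = (+)"
  "zero (sym_free V n) = 0" "smult (sym_free V n) = pscale"
  by (simp_all add: sym_free_def)

lemma dgcaD:
  assumes "dgca A"
  shows "cochain_complex A" "Unit A \<in> carrier (Comp A 0)"
    and "a \<in> carrier (Comp A m) \<Longrightarrow> linear_map (Comp A n) (Comp A (m + n)) (Mult A m n a)"
    and "b \<in> carrier (Comp A n) \<Longrightarrow> linear_map (Comp A m) (Comp A (m + n)) (\<lambda>a. Mult A m n a b)"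
    and "a \<in> carrier (Comp A l) \<Longrightarrow> b \<in> carrier (Comp A m) \<Longrightarrow> c \<in> carrier (Comp A n) \<Longrightarrow>
      Mult A (l + m) n (Mult A l m a b) c = Mult A l (m + n) a (Mult A m n b c)"
    and "a \<in> carrier (Comp A n) \<Longrightarrow> Mult A 0 n (Unit A) a = a"
    and "a \<in> carrier (Comp A n) \<Longrightarrow> Mult A n 0 a (Unit A) = a"
    and "a \<in> carrier (Comp A m) \<Longrightarrow> b \<in> carrier (Comp A n) \<Longrightarrow>
      Mult A m n a b = sgn_pow (m * n) \<odot>\<^bsub>Comp A (m + n)\<^esub> Mult A n m b a"
    and "a \<in> carrier (Comp A m) \<Longrightarrow> b \<in> carrier (Comp A n) \<Longrightarrow>
      Diff A (m + n) (Mult A m n a b) =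
        Mult A (m + 1) n (Diff A m a) b \<oplus>\<^bsub>Comp A (m + n + 1)\<^esub>
        sgn_pow m \<odot>\<^bsub>Comp A (m + n + 1)\<^esub> Mult A m (n + 1) a (Diff A n b)"
proof -
  note D1 = assms[unfolded dgca_def]
  note D2 = D1[THEN conjunct2] note D3 = D2[THEN conjunct2] note D4 = D3[THEN conjunct2]
  note D5 = D4[THEN conjunct2] note D6 = D5[THEN conjunct2] note D7 = D6[THEN conjunct2]
  show "cochain_complex A" "Unit A \<in> carrier (Comp A 0)"
    using D1[THEN conjunct1] D5[THEN conjunct1] .
  show "a \<in> carrier (Comp A m) \<Longrightarrow> linear_map (Comp A n) (Comp A (m + n)) (Mult A m n a)"
    using D2[THEN conjunct1] by blast
  show "b \<in> carrier (Comp A n) \<Longrightarrow> linear_map (Comp A m) (Comp A (m + n)) (\<lambda>a. Mult A m n a b)"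
    using D3[THEN conjunct1] by blast
  show "a \<in> carrier (Comp A l) \<Longrightarrow> b \<in> carrier (Comp A m) \<Longrightarrow> c \<in> carrier (Comp A n) \<Longrightarrow>
      Mult A (l + m) n (Mult A l m a b) c = Mult A l (m + n) a (Mult A m n b c)"
    using D4[THEN conjunct1] by blast
  show "a \<in> carrier (Comp A n) \<Longrightarrow> Mult A 0 n (Unit A) a = a"
    using D6[THEN conjunct1] by blast
  show "a \<in> carrier (Comp A n) \<Longrightarrow> Mult A n 0 a (Unit A) = a"
    using D6[THEN conjunct1] by blast
  show "a \<in> carrier (Comp A m) \<Longrightarrow> b \<in> carrier (Comp A n) \<Longrightarrow>
      Mult A m n a b = sgn_pow (m * n) \<odot>\<^bsub>Comp A (m + n)\<^esub> Mult A n m b a"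
    using D7[THEN conjunct1] by blast
  show "a \<in> carrier (Comp A m) \<Longrightarrow> b \<in> carrier (Comp A n) \<Longrightarrow>
      Diff A (m + n) (Mult A m n a b) =
        Mult A (m + 1) n (Diff A m a) b \<oplus>\<^bsub>Comp A (m + n + 1)\<^esub>
        sgn_pow m \<odot>\<^bsub>Comp A (m + n + 1)\<^esub> Mult A m (n + 1) a (Diff A n b)"
    using D7[THEN conjunct2] by blast
qed

text \<open>Two derivations applied to a word, sorted by which of them hits the first letter. With
  \<open>k = l = 1\<close> the mixed terms cancel, which gives the square of the differential; for
  degrees 1 and -1 they cancel in the sum of both orders, which gives the anticommutator.\<close>

lemma der_wder_Cons:
  "der k \<delta> (wder l \<epsilon> ((n, v) # w) :: 'v word \<Rightarrow>\<^sub>0 'k::field) =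
     single ((n + l + k, \<delta> (n + l) (\<epsilon> n v)) # w) 1
     + pscale (sgn_pow (k * (n + l))) (single [(n + l, \<epsilon> n v)] 1 * wder k \<delta> w)
     + pscale (sgn_pow (l * n)) (single [(n + k, \<delta> n v)] 1 * wder l \<epsilon> w)
     + pscale (sgn_pow (l * n) * sgn_pow (k * n)) (single [(n, v)] 1 * der k \<delta> (wder l \<epsilon> w))"
proof -
  have "der k \<delta> (single [(n, v)] (1 :: 'k) * wder l \<epsilon> w) =
      single [(n + k, \<delta> n v)] 1 * wder l \<epsilon> w
      + pscale (sgn_pow (k * n)) (single [(n, v)] 1 * der k \<delta> (wder l \<epsilon> w))"
    by (subst der_mult[of _ n]) simp_all
  then show ?thesis
    by (simp add: free_ext_add free_ext_pscale pscale_distribs add.assoc)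
qed

lemma mult_left_linear:
  "keys x \<subseteq> sym_words V m \<Longrightarrow> linear_map (sym_free V n) (sym_free V (m + n)) (\<lambda>y. x * y)"
  by (rule linear_mapI) (simp_all add: keys_mult_sym distrib_left pscale_mult_right)

lemma mult_right_linear:
  "keys y \<subseteq> sym_words V n \<Longrightarrow> linear_map (sym_free V m) (sym_free V (m + n)) (\<lambda>x. x * y)"
  by (rule linear_mapI) (simp_all add: keys_mult_sym distrib_right pscale_mult_left)

context complex_space
begin

lemma sym_quotient: "quotient_space (sym_free V n) (sym_ideal V n)"
proof (rule quotient_space.intro)
  show "module scalars (sym_free V n)"
    unfolding sym_free_def by (rule module_free_mod)
  then show "submodule (sym_ideal V n) scalars (sym_free V n)"
    by (rule submodule_vsI) (auto dest: subsetD[OF sym_ideal_keys] intro: sym_ideal_zero sym_ideal_add sym_ideal_pscale)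
qed

lemma sym_cls_eq_iff:
  assumes "keys x \<subseteq> sym_words V n" "keys y \<subseteq> sym_words V n"
  shows "sym_cls V n x = sym_cls V n y \<longleftrightarrow> x - y \<in> sym_ideal V n"
  using quotient_space.coset_eq_iff[OF sym_quotient, of x n y] minus_free_mod[OF assms] assms
  by (simp add: sym_cls_def) (simp add: sym_free_def)

lemma Sym_carrier: "carrier (Comp (Sym V) n) = sym_cls V n ` {x. keys x \<subseteq> sym_words V n}"
  using quotient_space.carrier_quot[OF sym_quotient] by (simp add: Sym_def sym_cls_def[abs_def])

lemma sym_cls_closed: "keys x \<subseteq> sym_words V n \<Longrightarrow> sym_cls V n x \<in> carrier (Comp (Sym V) n)"
  by (simp add: Sym_carrier)

lemma sym_cls_linear: "linear_map (sym_free V n) (Comp (Sym V) n) (sym_cls V n)"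
  using quotient_space.coset_linear[OF sym_quotient] by (simp add: Sym_def sym_cls_def[abs_def])

lemma Sym_add:
  "keys x \<subseteq> sym_words V n \<Longrightarrow> keys y \<subseteq> sym_words V n \<Longrightarrow>
    sym_cls V n x \<oplus>\<^bsub>Comp (Sym V) n\<^esub> sym_cls V n y = sym_cls V n (x + y)"
  using linear_mapD(2)[OF sym_cls_linear, of x n y] by simp

lemma Sym_smult:
  "keys x \<subseteq> sym_words V n \<Longrightarrow> c \<odot>\<^bsub>Comp (Sym V) n\<^esub> sym_cls V n x = sym_cls V n (pscale c x)"
  using linear_mapD(3)[OF sym_cls_linear, of x n c] by simp

lemma Sym_zero: "\<zero>\<^bsub>Comp (Sym V) n\<^esub> = sym_cls V n 0"
  using quotient_space.quot_zero[OF sym_quotient] by (simp add: Sym_def sym_cls_def)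

lemma Sym_module: "module scalars (Comp (Sym V) n)"
  using quotient_space.quot_module[OF sym_quotient] by (simp add: Sym_def)

lemma Diff_closed: "v \<in> carrier (Comp V n) \<Longrightarrow> Diff V n v \<in> carrier (Comp V (n + 1))"
  by (rule cochain_complexD(3)[OF complex])

lemma der_linear:
  assumes "\<And>n v. v \<in> carrier (Comp V n) \<Longrightarrow> \<delta> n v \<in> carrier (Comp V (n + k))"
  shows "linear_map (sym_free V n) (sym_free V (n + k)) (der k \<delta>)"
  unfolding sym_free_def by (rule linear_map_free_ext, rule wder_keys) (use assms in auto)

lemma word_diff_wder: "free_ext (word_diff (\<lambda>_. d)) = der 1 d"
  by (simp add: word_diff_eq_wder[abs_def])

lemma Sym_Diff:
  assumes "keys x \<subseteq> sym_words V n"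
  shows "Diff (Sym V) n (sym_cls V n x) = sym_cls V (n + 1) (der 1 (Diff V) x)"
  unfolding Sym_def sym_cls_def word_diff_wder dga.simps cochain.simps
  by (rule quot_map_coset[OF sym_quotient sym_quotient der_linear])
    (use der_sym_ideal[OF cochain_complexD(2)[OF complex]] assms Diff_closed in auto)

lemma Sym_Diff_linear: "linear_map (Comp (Sym V) n) (Comp (Sym V) (n + 1)) (Diff (Sym V) n)"
  unfolding Sym_def word_diff_wder dga.simps cochain.simps
  by (rule quot_map_linear[OF sym_quotient sym_quotient der_linear])
    (use der_sym_ideal[OF cochain_complexD(2)[OF complex]] Diff_closed in auto)

lemma sym_cls_mult_cong:
  assumes "keys x \<subseteq> sym_words V m" "keys x' \<subseteq> sym_words V m"
    "keys y \<subseteq> sym_words V n" "keys y' \<subseteq> sym_words V n"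
    and "sym_cls V m x = sym_cls V m x'" "sym_cls V n y = sym_cls V n y'"
  shows "sym_cls V (m + n) (x * y) = sym_cls V (m + n) (x' * y')"
proof -
  have "x * y - x' * y' = (x - x') * y + x' * (y - y')"
    by (simp add: algebra_simps)
  moreover have "(x - x') * y \<in> sym_ideal V (m + n)" "x' * (y - y') \<in> sym_ideal V (m + n)"
    using assms sym_cls_eq_iff by (auto intro: sym_ideal_mult_left sym_ideal_mult_right)
  ultimately show ?thesis
    using assms by (simp add: sym_cls_eq_iff keys_mult_sym sym_ideal_add)
qed

lemma Sym_Mult:
  assumes x: "keys x \<subseteq> sym_words V m" and y: "keys y \<subseteq> sym_words V n"
  shows "Mult (Sym V) m n (sym_cls V m x) (sym_cls V n y) = sym_cls V (m + n) (x * y)"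
proof -
  have "(\<Union>y\<in>sym_cls V n y. sym_cls V (m + n) (x * y)) = sym_cls V (m + n) (x * y)"
    if "keys x \<subseteq> sym_words V m" for x
    unfolding sym_cls_def[of V n y]
  proof (rule quotient_space.UN_coset[OF sym_quotient])
    fix z assume "z \<in> carrier (sym_free V n)"
      "sym_ideal V n +>\<^bsub>sym_free V n\<^esub> z = sym_ideal V n +>\<^bsub>sym_free V n\<^esub> y"
    then show "sym_cls V (m + n) (x * z) = sym_cls V (m + n) (x * y)"
      by (intro sym_cls_mult_cong) (simp_all add: that y sym_cls_def)
  qed (simp add: y)
  moreover have "(\<Union>x\<in>sym_cls V m x. sym_cls V (m + n) (x * y)) = sym_cls V (m + n) (x * y)"
    unfolding sym_cls_def[of V m x]
  proof (rule quotient_space.UN_coset[OF sym_quotient])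
    fix z assume "z \<in> carrier (sym_free V m)"
      "sym_ideal V m +>\<^bsub>sym_free V m\<^esub> z = sym_ideal V m +>\<^bsub>sym_free V m\<^esub> x"
    then show "sym_cls V (m + n) (z * y) = sym_cls V (m + n) (x * y)"
      by (intro sym_cls_mult_cong) (simp_all add: x y sym_cls_def)
  qed (simp add: x)
  moreover have "keys z \<subseteq> sym_words V m" if "z \<in> sym_cls V m x" for z
    using that quotient_space.mem_coset[OF sym_quotient, of x m z] x by (simp add: sym_cls_def)
  ultimately show ?thesis
    by (simp add: Sym_def flip: sym_cls_def)
qed

lemma Sym_Unit: "Unit (Sym V) = sym_cls V 0 1"
  by (simp add: Sym_def sym_cls_def)

text \<open>On words the square of the differential is zero only modulo the ideal: differentiating
  the same letter twice leaves a letter with entry zero.\<close>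

lemma der_der_word: "w \<in> sym_words V n \<Longrightarrow> der 1 (Diff V) (wder 1 (Diff V) w) \<in> sym_ideal V (n + 2)"
proof (induction w arbitrary: n)
  case (Cons a w)
  obtain m v where a: "a = (m, v)" by (cases a)
  have v: "v \<in> carrier (Comp V m)" and w: "w \<in> sym_words V (n - m)"
    using Cons.prems a by simp_all
  have "Diff V (m + 1) (Diff V m v) = \<zero>\<^bsub>Comp V (m + 2)\<^esub>"
    by (rule cochain_complexD(4)[OF complex v])
  then have "der 1 (Diff V) (wder 1 (Diff V) (a # w)) =
      single [(m + 2, \<zero>\<^bsub>Comp V (m + 2)\<^esub>)] (1 :: 'k) * single w 1
      + single [(m, v)] 1 * der 1 (Diff V) (wder 1 (Diff V) w)"
    unfolding a der_wder_Cons by (simp add: sgn_pow_add pscale_distribs add.assoc)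
  moreover have "single [(m + 2, \<zero>\<^bsub>Comp V (m + 2)\<^esub>)] 1 * single w 1
      \<in> sym_ideal V (m + 2 + (n - m))"
    by (rule sym_ideal_mult_right[OF sym_rel_zero]) (simp add: keys_closed w)
  moreover have "single [(m, v)] 1 * der 1 (Diff V) (wder 1 (Diff V) w) \<in> sym_ideal V (m + (n - m + 2))"
    by (rule sym_ideal_mult_left[OF Cons.IH[OF w]]) (simp add: v)
  ultimately show ?case
    by (simp add: sym_ideal_add add.commute)
qed (simp add: sym_ideal_zero)

text \<open>The inner induction carries one letter past \<open>v\<close>, the outer one does so for
  all letters of \<open>u\<close>, starting from the last. The exponents of the signs add up to the
  product of the total degrees.\<close>

lemma word_commute:
  "u \<in> sym_words V m \<Longrightarrow> v \<in> sym_words V n \<Longrightarrow>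
    single (u @ v) 1 - single (v @ u) (sgn_pow (m * n)) \<in> sym_ideal V (m + n)"
proof (induction u arbitrary: m)
  case Nil
  then show ?case by (simp add: sym_ideal_zero)
next
  case (Cons a u)
  obtain k x where a: "a = (k, x)" by (cases a)
  have x: "x \<in> carrier (Comp V k)" and u: "u \<in> sym_words V (m - k)"
    using Cons.prems a by simp_all
  have letter: "single ((k, x) # v) 1 - single (v @ [(k, x)]) (sgn_pow (k * n))
      \<in> sym_ideal V (k + n)"
    using \<open>v \<in> sym_words V n\<close>
  proof (induction v arbitrary: n)
    case Nil
    then show ?case by (simp add: sym_ideal_zero)
  next
    case (Cons b v)
    obtain l y where b: "b = (l, y)" by (cases b)
    have y: "y \<in> carrier (Comp V l)" and v: "v \<in> sym_words V (n - l)"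
      using Cons.prems b by simp_all
    have "single ((k, x) # b # v) (1 :: 'k) - single ((b # v) @ [(k, x)]) (sgn_pow (k * n)) =
        (single [(k, x), (l, y)] 1 - single [(l, y), (k, x)] (sgn_pow (k * l)))
          * single v 1
        + single [(l, y)] (sgn_pow (k * l)) *
          (single ((k, x) # v) 1 - single (v @ [(k, x)]) (sgn_pow (k * (n - l))))"
      by (simp add: b algebra_simps flip: sgn_pow_add)
    moreover have "(single [(k, x), (l, y)] 1 - single [(l, y), (k, x)] (sgn_pow (k * l)))
          * single v 1 \<in> sym_ideal V (k + l + (n - l))"
      by (rule sym_ideal_mult_right[OF sym_rel_comm[OF x y]]) (simp add: v)
    moreover have "single [(l, y)] (sgn_pow (k * l)) *
          (single ((k, x) # v) 1 - single (v @ [(k, x)]) (sgn_pow (k * (n - l))))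
        \<in> sym_ideal V (l + (k + (n - l)))"
      by (rule sym_ideal_mult_left[OF Cons.IH[OF v]]) (simp add: y)
    ultimately show ?case
      by (simp add: sym_ideal_add add.commute)
  qed
  have "single ((a # u) @ v) (1 :: 'k) - single (v @ a # u) (sgn_pow (m * n)) =
      single [(k, x)] 1 *
        (single (u @ v) 1 - single (v @ u) (sgn_pow ((m - k) * n)))
      + pscale (sgn_pow ((m - k) * n))
        ((single ((k, x) # v) 1 - single (v @ [(k, x)]) (sgn_pow (k * n)))
        * single u 1)"
    by (simp add: a algebra_simps pscale_distribs flip: sgn_pow_add)
  moreover have "single [(k, x)] 1 *
        (single (u @ v) 1 - single (v @ u) (sgn_pow ((m - k) * n)))
      \<in> sym_ideal V (k + (m - k + n))"
    by (rule sym_ideal_mult_left[OF Cons.IH[OF u \<open>v \<in> sym_words V n\<close>]]) (simp add: x)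
  moreover have "(single ((k, x) # v) 1 - single (v @ [(k, x)]) (sgn_pow (k * n)))
        * single u 1 \<in> sym_ideal V (k + n + (m - k))"
    by (rule sym_ideal_mult_right[OF letter]) (simp add: u)
  ultimately show ?case
    by (simp add: sym_ideal_add sym_ideal_pscale add.commute)
qed

lemma mult_commute:
  assumes "keys x \<subseteq> sym_words V m" "keys y \<subseteq> sym_words V n"
  shows "x * y - pscale (sgn_pow (m * n)) (y * x) \<in> sym_ideal V (m + n)"
  using assms(1)
proof (induction rule: poly_mapping_keys_induct)
  case (single_add u c x)
  have "single u c * y - pscale (sgn_pow (m * n)) (y * single u c) \<in> sym_ideal V (m + n)"
    using assms(2)
  proof (induction rule: poly_mapping_keys_induct)
    case (single_add v d y)
    have "pscale (c * d) (single (u @ v) 1 - single (v @ u) (sgn_pow (m * n)))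
        \<in> sym_ideal V (m + n)"
      by (intro sym_ideal_pscale word_commute single_add \<open>u \<in> sym_words V m\<close>)
    from sym_ideal_add[OF this single_add(3)] show ?case
      by (simp add: algebra_simps pscale_distribs)
  qed (simp add: sym_ideal_zero)
  from sym_ideal_add[OF this single_add(3)] show ?case
    by (simp add: algebra_simps pscale_distribs)
qed (simp add: sym_ideal_zero)

lemma cochain_complex_Sym: "cochain_complex (Sym V)"
  unfolding cochain_complex_def
proof (intro conjI allI ballI Sym_module Sym_Diff_linear)
  fix n X assume "X \<in> carrier (Comp (Sym V) n)"
  then obtain x where x: "keys x \<subseteq> sym_words V n" "X = sym_cls V n x"
    unfolding Sym_carrier by blast
  note k1 = der_keys[of V "Diff V" 1, OF Diff_closed x(1)]
  note k2 = der_keys[of V "Diff V" 1, OF Diff_closed k1]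
  have "der 1 (Diff V) (der 1 (Diff V) x) \<in> sym_ideal V (n + 2)"
    using x(1)
    by (induction rule: poly_mapping_keys_induct)
      (simp_all add: free_ext_add free_ext_pscale sym_ideal_zero sym_ideal_add sym_ideal_pscale der_der_word)
  then show "Diff (Sym V) (n + 1) (Diff (Sym V) n X) = \<zero>\<^bsub>Comp (Sym V) (n + 2)\<^esub>"
    using k2 Sym_Diff[OF k1] by (simp add: x Sym_Diff Sym_zero sym_cls_eq_iff add.assoc)
qed

lemma Sym_Mult_closed:
  "a \<in> carrier (Comp (Sym V) m) \<Longrightarrow> b \<in> carrier (Comp (Sym V) n) \<Longrightarrow> Mult (Sym V) m n a b \<in> carrier (Comp (Sym V) (m + n))"
  unfolding Sym_carrier by (elim imageE) (simp add: Sym_Mult keys_mult_sym)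

lemma dgca_Sym: "dgca (Sym V)"
  unfolding dgca_def
proof (intro conjI allI ballI)
  show "cochain_complex (Sym V)" by (rule cochain_complex_Sym)
  show "linear_map (Comp (Sym V) n) (Comp (Sym V) (m + n)) (Mult (Sym V) m n a)"
    if "a \<in> carrier (Comp (Sym V) m)" for m n a
    using that by (intro linear_mapI Sym_Mult_closed)
      (auto simp: Sym_carrier Sym_Mult Sym_add Sym_smult keys_closed keys_mult_sym distrib_left pscale_mult_right)
  show "linear_map (Comp (Sym V) m) (Comp (Sym V) (m + n)) (\<lambda>a. Mult (Sym V) m n a b)"
    if "b \<in> carrier (Comp (Sym V) n)" for m n b
    using that by (intro linear_mapI Sym_Mult_closed)
      (auto simp: Sym_carrier Sym_Mult Sym_add Sym_smult keys_closed keys_mult_sym distrib_right pscale_mult_left)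
  show "Mult (Sym V) (l + m) n (Mult (Sym V) l m a b) c = Mult (Sym V) l (m + n) a (Mult (Sym V) m n b c)"
    if "a \<in> carrier (Comp (Sym V) l)" "b \<in> carrier (Comp (Sym V) m)" "c \<in> carrier (Comp (Sym V) n)" for l m n a b c
    using that by (auto simp: Sym_carrier Sym_Mult keys_mult_sym mult.assoc add.assoc)
  have one: "keys 1 \<subseteq> sym_words V 0"
    by (simp add: zero_list_def)
  then show "Unit (Sym V) \<in> carrier (Comp (Sym V) 0)"
    unfolding Sym_Unit by (rule sym_cls_closed)
  show "Mult (Sym V) 0 n (Unit (Sym V)) a = a" "Mult (Sym V) n 0 a (Unit (Sym V)) = a"
    if a: "a \<in> carrier (Comp (Sym V) n)" for n a
    using that Sym_Mult[OF one, of _ n] Sym_Mult[OF _ one, of _ n] by (auto simp: Sym_carrier Sym_Unit)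
  show "Mult (Sym V) m n a b = sgn_pow (m * n) \<odot>\<^bsub>Comp (Sym V) (m + n)\<^esub> Mult (Sym V) n m b a"
    if "a \<in> carrier (Comp (Sym V) m)" "b \<in> carrier (Comp (Sym V) n)" for m n a b
  proof -
    obtain x y where x: "keys x \<subseteq> sym_words V m" "a = sym_cls V m x"
      and y: "keys y \<subseteq> sym_words V n" "b = sym_cls V n y"
      using \<open>a \<in> _\<close> \<open>b \<in> _\<close> unfolding Sym_carrier by blast
    have k: "keys (x * y) \<subseteq> sym_words V (m + n)" "keys (y * x) \<subseteq> sym_words V (m + n)"
      using keys_mult_sym[OF x(1) y(1)] keys_mult_sym[OF y(1) x(1)] by (simp_all add: add.commute)
    have "Mult (Sym V) n m b a = sym_cls V (m + n) (y * x)"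
      by (simp add: x y Sym_Mult add.commute)
    then show ?thesis
      using mult_commute[OF x(1) y(1)] k by (simp add: x y Sym_Mult Sym_smult sym_cls_eq_iff keys_closed)
  qed
  show "Diff (Sym V) (m + n) (Mult (Sym V) m n a b) =
      Mult (Sym V) (m + 1) n (Diff (Sym V) m a) b \<oplus>\<^bsub>Comp (Sym V) (m + n + 1)\<^esub>
      sgn_pow m \<odot>\<^bsub>Comp (Sym V) (m + n + 1)\<^esub> Mult (Sym V) m (n + 1) a (Diff (Sym V) n b)"
    if "a \<in> carrier (Comp (Sym V) m)" "b \<in> carrier (Comp (Sym V) n)" for m n a b
  proof -
    obtain x y where x: "keys x \<subseteq> sym_words V m" "a = sym_cls V m x"
      and y: "keys y \<subseteq> sym_words V n" "b = sym_cls V n y"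
      using \<open>a \<in> _\<close> \<open>b \<in> _\<close> unfolding Sym_carrier by blast
    note dx = der_keys[of V "Diff V" 1, OF Diff_closed x(1)]
    note dy = der_keys[of V "Diff V" 1, OF Diff_closed y(1)]
    have "Mult (Sym V) (m + 1) n (Diff (Sym V) m a) b = sym_cls V (m + n + 1) (der 1 (Diff V) x * y)"
      using Sym_Mult[OF dx y(1)] by (simp add: x y Sym_Diff algebra_simps)
    moreover have "Mult (Sym V) m (n + 1) a (Diff (Sym V) n b) = sym_cls V (m + n + 1) (x * der 1 (Diff V) y)"
      using Sym_Mult[OF x(1) dy] by (simp add: x y Sym_Diff algebra_simps)
    moreover have "keys (der 1 (Diff V) x * y) \<subseteq> sym_words V (m + n + 1)"
      "keys (x * der 1 (Diff V) y) \<subseteq> sym_words V (m + n + 1)"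
      using keys_mult_sym[OF dx y(1)] keys_mult_sym[OF x(1) dy] by (simp_all add: algebra_simps)
    moreover have "der 1 (Diff V) (x * y) = der 1 (Diff V) x * y + pscale (sgn_pow m) (x * der 1 (Diff V) y)"
      using der_mult[of x m 1 "Diff V" y] x(1) sym_words_wdeg by fastforce
    ultimately show ?thesis
      using keys_mult_sym[OF x(1) y(1)]
      by (simp add: x y Sym_Mult Sym_Diff Sym_smult Sym_add keys_closed)
  qed
qed

end


section \<open>Maps out of symmetric algebras\<close>

locale dgca_space =
  fixes A :: "('k::field,'v) dga"
  assumes dgca: "dgca A"
begin

lemmas A_complex = dgcaD(1)[OF dgca] and Unit_closed = dgcaD(2)[OF dgca]
  and Mult_linear_right = dgcaD(3)[OF dgca] and Mult_linear_left = dgcaD(4)[OF dgca]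
  and Mult_assoc = dgcaD(5)[OF dgca] and Unit_Mult = dgcaD(6)[OF dgca] and Mult_Unit = dgcaD(7)[OF dgca]
  and Mult_comm = dgcaD(8)[OF dgca] and Leibniz = dgcaD(9)[OF dgca]

lemmas A_module = cochain_complexD(1)[OF A_complex] and A_Diff_linear = cochain_complexD(2)[OF A_complex]
  and A_Diff_closed = cochain_complexD(3)[OF A_complex]

lemma Mult_closed:
  "a \<in> carrier (Comp A m) \<Longrightarrow> b \<in> carrier (Comp A n) \<Longrightarrow> Mult A m n a b \<in> carrier (Comp A (m + n))"
  by (rule linear_mapD(1)[OF Mult_linear_right])

lemmas Mult_smult_right = linear_mapD(3)[OF Mult_linear_right]
  and Mult_smult_left = linear_mapD(3)[OF Mult_linear_left]
  and Mult_zero_right = linear_map_zero[OF Mult_linear_right A_module A_module]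
  and Mult_zero_left = linear_map_zero[OF Mult_linear_left A_module A_module]

text \<open>The Leibniz rule for \<open>1 * 1\<close> reads \<open>d 1 = d 1 + d 1\<close>.\<close>

lemma Diff_Unit: "Diff A 0 (Unit A) = \<zero>\<^bsub>Comp A 1\<^esub>"
proof -
  interpret M: module scalars "Comp A 1" by (rule A_module)
  have c: "Diff A 0 (Unit A) \<in> carrier (Comp A 1)"
    using A_Diff_closed[OF Unit_closed] by simp
  have "Diff A 0 (Unit A) = Diff A 0 (Unit A) \<oplus>\<^bsub>Comp A 1\<^esub> Diff A 0 (Unit A)"
    using Leibniz[OF Unit_closed Unit_closed] c
    by (simp add: Unit_Mult Mult_Unit Unit_closed M.smult_one[simplified])
  then show ?thesis
    using c by (metis M.add.r_cancel_one')
qed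

lemma word_prod_closed: "w \<in> sym_words A n \<Longrightarrow> word_prod A w \<in> carrier (Comp A n)"
proof (induction w arbitrary: n)
  case (Cons a w)
  obtain m v where a: "a = (m, v)" by (cases a)
  show ?case
    using Cons.prems Cons.IH[of "n - m"] Mult_closed[of v m "word_prod A w" "n - m"] sym_words_wdeg[of w A "n - m"]
    by (simp add: a)
qed (simp add: Unit_closed)

lemma word_prod_append:
  "u \<in> sym_words A m \<Longrightarrow> v \<in> sym_words A n \<Longrightarrow>
    word_prod A (u @ v) = Mult A m n (word_prod A u) (word_prod A v)"
proof (induction u arbitrary: m)
  case (Cons a u)
  obtain k x where a: "a = (k, x)" by (cases a)
  have x: "x \<in> carrier (Comp A k)" and u: "u \<in> sym_words A (m - k)"
    using Cons.prems a by simp_all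
  have "word_prod A ((a # u) @ v) = Mult A k (m - k + n) x (Mult A (m - k) n (word_prod A u) (word_prod A v))"
    using Cons.IH[OF u Cons.prems(2)] sym_words_wdeg[OF u] sym_words_wdeg[OF Cons.prems(2)] by (simp add: a)
  also have "\<dots> = Mult A m n (word_prod A (a # u)) (word_prod A v)"
    using Mult_assoc[OF x word_prod_closed[OF u] word_prod_closed[OF Cons.prems(2)]] sym_words_wdeg[OF u]
    by (simp add: a)
  finally show ?case .
qed (simp add: Unit_Mult word_prod_closed)

text \<open>A transposition at the head of a word. It settles the commutation relation of
  \<open>Sym\<close> and, repeated in an insertion sort, arbitrary permutations of factors.\<close>

lemma word_prod_swap:
  assumes "a \<in> carrier (Comp A m)" "b \<in> carrier (Comp A n)" "w \<in> sym_words A l"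
  shows "word_prod A ((m, a) # (n, b) # w) =
    sgn_pow (m * n) \<odot>\<^bsub>Comp A (m + n + l)\<^esub> word_prod A ((n, b) # (m, a) # w)"
proof -
  have l: "wdeg w = l" by (rule sym_words_wdeg[OF assms(3)])
  note w = word_prod_closed[OF assms(3)]
  have "word_prod A ((m, a) # (n, b) # w) = Mult A (m + n) l (Mult A m n a b) (word_prod A w)"
    using Mult_assoc[OF assms(1,2) w] by (simp add: l)
  also have "Mult A m n a b = sgn_pow (m * n) \<odot>\<^bsub>Comp A (m + n)\<^esub> Mult A n m b a"
    by (rule Mult_comm[OF assms(1,2)])
  also have "Mult A (m + n) l \<dots> (word_prod A w) =
      sgn_pow (m * n) \<odot>\<^bsub>Comp A (m + n + l)\<^esub> Mult A (m + n) l (Mult A n m b a) (word_prod A w)"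
    using Mult_smult_left[OF w, of "Mult A n m b a" "m + n"] Mult_closed[OF assms(2,1)] by (simp add: add.commute)
  also have "Mult A (m + n) l (Mult A n m b a) (word_prod A w) = word_prod A ((n, b) # (m, a) # w)"
    using Mult_assoc[OF assms(2,1) w] by (simp add: l add.commute)
  finally show ?thesis .
qed

end

text \<open>The setting of the universal property of \<open>Sym\<close>: a chain map
  \<open>g\<close> from \<open>V\<close> to the complex underlying \<open>A\<close> extends to a map
  of algebras. It is used for \<open>Phi\<close>, with target the polynomials, and for the
  inclusions of intervals, with target another symmetric algebra.\<close>

locale sym_hom = complex_space V + dgca_space A
  for V :: "('k::field,'v,'z) cochain_scheme" and A :: "('k,'w) dga" +
  fixes g :: "int \<Rightarrow> 'v \<Rightarrow> 'w"
  assumes g: "chain_map V A g"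
begin

lemmas g_linear = chain_mapD(1)[OF g] and g_closed = chain_mapD(2)[OF g] and g_Diff = chain_mapD(3)[OF g]

definition word_map :: "'v word \<Rightarrow> 'w word" where "word_map w = map (\<lambda>(m, v). (m, g m v)) w"

lemma word_map_simps [simp]: "word_map [] = []" "word_map ((n, v) # w) = (n, g n v) # word_map w" "word_map (w @ w') = word_map w @ word_map w'"
  by (simp_all add: word_map_def)

lemma word_map_closed: "w \<in> sym_words V n \<Longrightarrow> word_map w \<in> sym_words A n"
  by (induction w arbitrary: n) (auto simp: g_closed)

lemmas word_map_prod_closed = word_prod_closed[OF word_map_closed]

definition word_eval :: "int \<Rightarrow> ('v word \<Rightarrow>\<^sub>0 'k) \<Rightarrow> 'w" where
  "word_eval n = lin_ext (Comp A n) (\<lambda>w. word_prod A (word_map w))"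

lemma word_eval_linear: "linear_map (sym_free V n) (Comp A n) (word_eval n)"
  unfolding word_eval_def sym_free_def by (rule linear_map_lin_ext[OF A_module word_map_prod_closed])

lemma word_eval_single: "w \<in> sym_words V n \<Longrightarrow> word_eval n (single w c) = c \<odot>\<^bsub>Comp A n\<^esub> word_prod A (word_map w)"
  unfolding word_eval_def by (rule lin_ext_single[OF A_module], rule word_map_prod_closed)

lemma word_eval_single_one: "w \<in> sym_words V n \<Longrightarrow> word_eval n (single w 1) = word_prod A (word_map w)"
  using word_eval_single[of w n 1] module.smult_one[OF A_module word_map_prod_closed] by simp

lemmas word_eval_closed = linear_mapD(1)[OF word_eval_linear, simplified] and word_eval_add = linear_mapD(2)[OF word_eval_linear, simplified]
  and word_eval_pscale = linear_mapD(3)[OF word_eval_linear, simplified]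

lemma word_eval_zero: "word_eval n 0 = \<zero>\<^bsub>Comp A n\<^esub>"
  using linear_map_zero[OF word_eval_linear quotient_space.vs[OF sym_quotient] A_module] by simp

lemma word_eval_mult:
  assumes x: "keys x \<subseteq> sym_words V m" and y: "keys y \<subseteq> sym_words V n"
  shows "word_eval (m + n) (x * y) = Mult A m n (word_eval m x) (word_eval n y)"
proof (rule free_linear_map_eqI[OF _ _ A_module _ x])
  show "linear_map (free_mod (sym_words V m)) (Comp A (m + n)) (\<lambda>x. word_eval (m + n) (x * y))"
    using linear_map_comp[OF mult_right_linear[OF y] word_eval_linear] by (simp add: sym_free_def)
  show "linear_map (free_mod (sym_words V m)) (Comp A (m + n)) (\<lambda>x. Mult A m n (word_eval m x) (word_eval n y))"
    using linear_map_comp[OF word_eval_linear Mult_linear_left[OF word_eval_closed[OF y]]] by (simp add: sym_free_def)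
  fix u assume u: "u \<in> sym_words V m"
  then have u': "keys (single u (1::'k)) \<subseteq> sym_words V m" by simp
  show "word_eval (m + n) (single u 1 * y) = Mult A m n (word_eval m (single u 1)) (word_eval n y)"
  proof (rule free_linear_map_eqI[OF _ _ A_module _ y])
    show "linear_map (free_mod (sym_words V n)) (Comp A (m + n)) (\<lambda>y. word_eval (m + n) (single u 1 * y))"
      using linear_map_comp[OF mult_left_linear[OF u'] word_eval_linear] by (simp add: sym_free_def)
    show "linear_map (free_mod (sym_words V n)) (Comp A (m + n)) (\<lambda>y. Mult A m n (word_eval m (single u 1)) (word_eval n y))"
      using linear_map_comp[OF word_eval_linear Mult_linear_right[OF word_eval_closed[OF u']]] by (simp add: sym_free_def)
    show "word_eval (m + n) (single u 1 * single v 1) =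
        Mult A m n (word_eval m (single u 1)) (word_eval n (single v 1))"
      if v: "v \<in> sym_words V n" for v
      using u v by (simp add: word_eval_single_one sym_words_append word_prod_append[OF word_map_closed word_map_closed])
  qed
qed

text \<open>Linearity of \<open>g\<close> disposes of the two linear kinds of relations, graded
  commutativity of \<open>A\<close> of the third.\<close>

lemma word_eval_sym_rel:
  assumes r: "r \<in> sym_rels V" "keys r \<subseteq> sym_words V l"
  shows "word_eval l r = \<zero>\<^bsub>Comp A l\<^esub>"
proof (cases "r = 0")
  case False
  have D: "word_eval n (x - y) = \<zero>\<^bsub>Comp A n\<^esub>"
    if "keys x \<subseteq> sym_words V n" "keys y \<subseteq> sym_words V n" "word_eval n x = word_eval n y" for n x y
    using linear_map_diff[OF word_eval_linear quotient_space.vs[OF sym_quotient] A_module, of x n y] that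
      diff_eq_zero_iff[OF A_module word_eval_closed word_eval_closed, of x n y]
    by (simp add: sym_free_def minus_free_mod)
  have "\<exists>m. keys r \<subseteq> sym_words V m \<and> word_eval m r = \<zero>\<^bsub>Comp A m\<^esub>"
  proof -
    from r(1) show ?thesis
    proof (cases rule: sym_relsE)
      case (1 m u v)
      have s: "u \<oplus>\<^bsub>Comp V m\<^esub> v \<in> carrier (Comp V m)"
        using 1 Comp_module[of m] by (simp add: abelian_monoid.a_closed abelian_group.axioms module.axioms)
      have e1: "r = single [(m, u \<oplus>\<^bsub>Comp V m\<^esub> v)] 1
          - (single [(m, u)] 1 + single [(m, v)] 1)"
        by (simp add: 1)
      have e2: "word_eval m (single [(m, u \<oplus>\<^bsub>Comp V m\<^esub> v)] 1)
          = word_eval m (single [(m, u)] 1 + single [(m, v)] 1)"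
        using s 1(2,3) linear_mapD(2)[OF g_linear 1(2,3)] g_closed[OF s] g_closed
        by (simp add: word_eval_add word_eval_single_one Mult_Unit)
      have "word_eval m r = \<zero>\<^bsub>Comp A m\<^esub>"
        unfolding e1 by (rule D[OF _ _ e2]) (simp_all add: s 1(2,3) keys_closed)
      then show ?thesis
        using sym_ideal_keys[OF sym_rel_add[OF 1(2,3)]] 1(1) by blast
    next
      case (2 m c u)
      have s: "c \<odot>\<^bsub>Comp V m\<^esub> u \<in> carrier (Comp V m)"
        using module.smult_closed[OF Comp_module, of c u m] 2(2) by simp
      have "word_eval m (single [(m, c \<odot>\<^bsub>Comp V m\<^esub> u)] 1) = word_eval m (single [(m, u)] c)"
        using s 2(2) linear_mapD(3)[OF g_linear 2(2)] g_closed[OF s] g_closed[OF 2(2)]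
        by (simp add: word_eval_single Mult_Unit module.smult_one[OF A_module, simplified])
      then show ?thesis
        using D s 2(2) sym_ideal_keys[OF sym_rel_smult[OF 2(2), of c]]
        by (intro exI[of _ m]) (simp add: 2(1) keys_closed)
    next
      case (3 m p u v)
      have "word_eval (m + p) (single [(m, u), (p, v)] 1) =
          word_eval (m + p) (single [(p, v), (m, u)] (sgn_pow (m * p)))"
        using word_prod_swap[OF g_closed[OF 3(2)] g_closed[OF 3(3)], of "[]" 0, symmetric]
          word_prod_closed[of "[(m, g m u), (p, g p v)]" "m + p"] g_closed[OF 3(2)] g_closed[OF 3(3)] 3(2,3)
        by (simp add: word_eval_single module.smult_one[OF A_module, simplified] del: word_prod.simps)
      then show ?thesis
        using D 3(2,3) sym_ideal_keys[OF sym_rel_comm[OF 3(2,3)]]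
        by (intro exI[of _ "m + p"]) (simp add: 3(1) keys_closed)
    qed
  qed
  then obtain m where m: "keys r \<subseteq> sym_words V m" "word_eval m r = \<zero>\<^bsub>Comp A m\<^esub>"
    by blast
  from False obtain w where "w \<in> keys r" by fastforce
  then have "m = l"
    using m(1) r(2) sym_words_wdeg by blast
  then show ?thesis using m by simp
qed (simp add: word_eval_zero)

lemma word_eval_sym_ideal: "x \<in> sym_ideal V n \<Longrightarrow> word_eval n x = \<zero>\<^bsub>Comp A n\<^esub>"
  unfolding ideal_eq
proof (induction rule: symI.induct)
  case zero
  show ?case by (rule word_eval_zero)
next
  case (add x y)
  interpret M: module scalars "Comp A n" by (rule A_module)
  show ?case
    using add symI_keys[of x V n] symI_keys[of y V n] by (simp add: word_eval_add)
next
  case (gen r k a b c)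
  have a: "keys (single a c) \<subseteq> sym_words V (wdeg a)"
    and b: "keys (single b (1::'k)) \<subseteq> sym_words V (wdeg b)"
    using gen(3,4) by (auto simp: sym_words_def)
  have "word_eval (wdeg a + k) (single a c * r) = \<zero>\<^bsub>Comp A (wdeg a + k)\<^esub>"
    by (simp add: word_eval_mult[OF a gen(2)] word_eval_sym_rel[OF gen(1,2)] Mult_zero_right word_eval_closed[OF a])
  then show ?case
    by (simp add: gen(5) word_eval_mult[OF keys_mult_sym[OF a gen(2)] b] Mult_zero_left word_eval_closed[OF b])
qed

lemma word_eval_wder: "w \<in> sym_words V n \<Longrightarrow> word_eval (n + 1) (wder 1 (Diff V) w) = Diff A n (word_prod A (word_map w))"
proof (induction w arbitrary: n)
  case Nil
  then show ?case by (simp add: word_eval_zero Diff_Unit)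
next
  case (Cons a w)
  obtain m v where a: "a = (m, v)" by (cases a)
  have v: "v \<in> carrier (Comp V m)" and w: "w \<in> sym_words V (n - m)"
    using Cons.prems a by simp_all
  note gv = g_closed[OF v] and dv = Diff_closed[OF v] and gw = word_map_prod_closed[OF w]
  have kv: "keys (single [(m, v)] (1::'k)) \<subseteq> sym_words V m"
    using v by simp
  have kdw: "keys (wder 1 (Diff V) w :: 'v word \<Rightarrow>\<^sub>0 'k) \<subseteq> sym_words V (n - m + 1)"
    by (rule wder_keys[OF Diff_closed w])
  have k: "keys (single [(m, v)] 1 * wder 1 (Diff V) w :: 'v word \<Rightarrow>\<^sub>0 'k) \<subseteq> sym_words V (n + 1)"
    using keys_mult_sym[OF kv kdw] by simp
  have dvw: "(m + 1, Diff V m v) # w \<in> sym_words V (n + 1)"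
    using dv w by simp
  have "word_eval (n + 1) (wder 1 (Diff V) (a # w)) =
      word_prod A (word_map ((m + 1, Diff V m v) # w)) \<oplus>\<^bsub>Comp A (n + 1)\<^esub>
      sgn_pow m \<odot>\<^bsub>Comp A (n + 1)\<^esub> word_eval (n + 1) (single [(m, v)] 1 * wder 1 (Diff V) w)"
    using k dvw by (simp add: a word_eval_add word_eval_pscale word_eval_single_one keys_closed del: word_map_simps sym_words_simps)
  also have "word_eval (n + 1) (single [(m, v)] 1 * wder 1 (Diff V) w) =
      Mult A m (n - m + 1) (g m v) (Diff A (n - m) (word_prod A (word_map w)))"
    using word_eval_mult[OF kv kdw] Cons.IH[OF w] by (simp add: word_eval_single_one v Mult_Unit gv)
  also have "word_prod A (word_map ((m + 1, Diff V m v) # w)) = Mult A (m + 1) (n - m) (Diff A m (g m v)) (word_prod A (word_map w))"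
    using sym_words_wdeg[OF word_map_closed[OF w]] by (simp add: g_Diff v)
  finally show ?case
    using Leibniz[OF gv gw] sym_words_wdeg[OF word_map_closed[OF w]] by (simp add: a)
qed

lemma word_eval_der:
  assumes "keys x \<subseteq> sym_words V n"
  shows "word_eval (n + 1) (der 1 (Diff V) x) = Diff A n (word_eval n x)"
proof (rule free_linear_map_eqI[OF _ _ A_module _ assms])
  show "linear_map (free_mod (sym_words V n)) (Comp A (n + 1)) (\<lambda>x. word_eval (n + 1) (der 1 (Diff V) x))"
    using linear_map_comp[OF der_linear[OF Diff_closed] word_eval_linear] by (simp add: sym_free_def)
  show "linear_map (free_mod (sym_words V n)) (Comp A (n + 1)) (\<lambda>x. Diff A n (word_eval n x))"
    using linear_map_comp[OF word_eval_linear A_Diff_linear] by (simp add: sym_free_def)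
qed (simp add: word_eval_wder word_eval_single_one)

lemma sym_ext_cls:
  "keys x \<subseteq> sym_words V n \<Longrightarrow> sym_ext A g n (sym_cls V n x) = word_eval n x"
  using quotient_space.the_elem_coset[OF sym_quotient word_eval_linear A_module word_eval_sym_ideal, of n x]
  by (simp add: sym_ext_def sym_cls_def word_eval_def word_map_def[abs_def])

lemma sym_ext_hom: "dga_hom (Sym V) A (sym_ext A g)"
  unfolding dga_hom_def chain_map_def
proof (intro conjI allI ballI)
  show "linear_map (Comp (Sym V) n) (Comp A n) (sym_ext A g n)" for n
    using quotient_space.linear_map_quotI[OF sym_quotient _ word_eval_linear, of n "sym_ext A g n"] sym_ext_cls
    by (simp add: Sym_def sym_cls_def)
  show "sym_ext A g (n + 1) (Diff (Sym V) n a) = Diff A n (sym_ext A g n a)"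
    if "a \<in> carrier (Comp (Sym V) n)" for n a
    using that unfolding Sym_carrier
    by (elim imageE) (simp add: Sym_Diff sym_ext_cls word_eval_der der_keys Diff_closed)
  have "word_eval 0 1 = Unit A"
    using word_eval_single_one[of "[]" 0] by (simp add: one_word)
  then show "sym_ext A g 0 (Unit (Sym V)) = Unit A"
    using sym_ext_cls[of 1 0] by (simp add: Sym_Unit zero_list_def)
  show "sym_ext A g (m + n) (Mult (Sym V) m n a b) = Mult A m n (sym_ext A g m a) (sym_ext A g n b)"
    if "a \<in> carrier (Comp (Sym V) m)" "b \<in> carrier (Comp (Sym V) n)" for m n a b
    using that unfolding Sym_carrier
    by (elim imageE) (simp add: Sym_Mult sym_ext_cls word_eval_mult keys_mult_sym)
qed

end

lemma sym_gen_sym_cls: "sym_gen V n v = sym_cls V n (single [(n, v)] 1)"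
  by (simp add: sym_gen_def sym_cls_def)

text \<open>Makes evaluation explicit when the target is itself a symmetric algebra: multiplying
  generators there just spells out the word.\<close>

lemma sym_word_prod:
  assumes "complex_space W" "w \<in> sym_words W n"
  shows "word_prod (Sym W) (map (\<lambda>(m, v). (m, sym_gen W m v)) w) = sym_cls W n (single w 1)"
  using assms(2)
proof (induction w arbitrary: n)
  case Nil
  then show ?case
    using complex_space.Sym_Unit[OF assms(1)] by (simp add: one_word)
next
  case (Cons a w)
  obtain m v where a: "a = (m, v)" by (cases a)
  have d: "wdeg (map (\<lambda>(m, v). (m, sym_gen W m v)) w) = wdeg w"
    by (induction w) auto
  show ?case
    using Cons.prems Cons.IH[of "n - m"] sym_words_wdeg[of w W "n - m"]
      complex_space.Sym_Mult[OF assms(1), of "single [(m, v)] 1" m "single w 1" "n - m"]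
    by (simp add: a d flip: sym_gen_sym_cls)
qed

text \<open>Different vectors are unrelated letters in the free algebra; the linear relations in
  \<open>sym_rels\<close> are what makes the inclusion of generators linear.\<close>

lemma chain_map_sym_gen:
  assumes "complex_space W"
  shows "chain_map W (Sym W) (sym_gen W)"
proof -
  interpret complex_space W by fact
  show ?thesis
    unfolding chain_map_def
  proof (intro conjI allI ballI linear_mapI)
    fix n u v c assume u: "u \<in> carrier (Comp W n)"
    show "sym_gen W n u \<in> carrier (Comp (Sym W) n)"
      using sym_cls_closed[of "single [(n, u)] 1" n] u by (simp add: sym_gen_def sym_cls_def)
    have "c \<odot>\<^bsub>Comp W n\<^esub> u \<in> carrier (Comp W n)"
      using module.smult_closed[OF Comp_module, of c u n] u by simp
    then show "sym_gen W n (c \<odot>\<^bsub>Comp W n\<^esub> u) = c \<odot>\<^bsub>Comp (Sym W) n\<^esub> sym_gen W n u"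
      using u sym_rel_smult[OF u, of c] by (simp add: sym_gen_def Sym_smult sym_cls_eq_iff flip: sym_cls_def)
    show "sym_gen W (n + 1) (Diff W n u) = Diff (Sym W) n (sym_gen W n u)"
      using u by (simp add: sym_gen_def Sym_Diff flip: sym_cls_def)
    assume v: "v \<in> carrier (Comp W n)"
    have "u \<oplus>\<^bsub>Comp W n\<^esub> v \<in> carrier (Comp W n)"
      using u v Comp_module[of n] by (simp add: abelian_monoid.a_closed abelian_group.axioms module.axioms)
    then show "sym_gen W n (u \<oplus>\<^bsub>Comp W n\<^esub> v) = sym_gen W n u \<oplus>\<^bsub>Comp (Sym W) n\<^esub> sym_gen W n v"
      using u v sym_rel_add[OF u v] by (simp add: sym_gen_def Sym_add sym_cls_eq_iff keys_closed diff_diff_eq flip: sym_cls_def)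
  qed
qed


section \<open>Maps out of tensor products\<close>

lemma span_of_subset: "submodule H scalars M \<Longrightarrow> S \<subseteq> H \<Longrightarrow> span_of M S \<subseteq> H"
  by (auto simp: span_of_def)

lemma submodule_span_of:
  assumes M: "module scalars M" and "S \<subseteq> carrier M"
  shows "submodule (span_of M S) scalars M"
proof (rule submodule_vsI[OF M])
  show "span_of M S \<subseteq> carrier M"
    by (rule span_of_subset[OF module.carrier_is_submodule[OF M] assms(2)])
qed (use submodule_vsD[OF M] in \<open>auto simp: span_of_def\<close>)

lemma wdeg_update: "i < length w \<Longrightarrow> m = fst (w ! i) \<Longrightarrow> wdeg (w[i := (m, u)]) = wdeg w"
  by (induction w arbitrary: i) (auto simp: nth_Cons split: nat.splits)

lemma tensor_words_simps [simp]:
  "[] \<in> tensor_words [] n \<longleftrightarrow> n = 0"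
  "(m, a) # w \<in> tensor_words (A # As) n \<longleftrightarrow> a \<in> carrier (Comp A m) \<and> w \<in> tensor_words As (n - m)"
  by (auto simp: tensor_words_def)

lemma tensor_words_Nil: "w \<in> tensor_words [] n \<Longrightarrow> w = [] \<and> n = 0"
  by (auto simp: tensor_words_def)

lemma tensor_words_ConsE:
  assumes "w \<in> tensor_words (A # As) n"
  obtains m a w' where "w = (m, a) # w'" "a \<in> carrier (Comp A m)" "w' \<in> tensor_words As (n - m)"
  using assms by (cases w) (auto simp: tensor_words_def)

lemma tensor_words_length: "w \<in> tensor_words As n \<Longrightarrow> length w = length As"
  by (auto simp: tensor_words_def list_all2_lengthD)

lemma tensor_words_wdeg: "w \<in> tensor_words As n \<Longrightarrow> wdeg w = n"
  by (simp add: tensor_words_def)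

lemma tensor_words_nth: "w \<in> tensor_words As n \<Longrightarrow> i < length As \<Longrightarrow> snd (w ! i) \<in> carrier (Comp (As ! i) (fst (w ! i)))"
  by (auto simp: tensor_words_def list_all2_conv_all_nth split_beta)

lemma tensor_words_update:
  assumes "w \<in> tensor_words As n" "i < length As" "m = fst (w ! i)" "u \<in> carrier (Comp (As ! i) m)"
  shows "w[i := (m, u)] \<in> tensor_words As n"
  using assms tensor_words_length[OF assms(1)]
  by (auto simp: tensor_words_def wdeg_update list_all2_conv_all_nth nth_list_update)

lemma tensor_free_simps [simp]:
  "carrier (tensor_free V n) = {x. keys x \<subseteq> tensor_words V n}" "add (tensor_free V n) = (+)"
  "zero (tensor_free V n) = 0" "smult (tensor_free V n) = pscale"
  by (simp_all add: tensor_free_def)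

lemma tensor_relsE:
  assumes "r \<in> tensor_rels As n"
  obtains
      w i m u v where "r = single (w[i := (m, u \<oplus>\<^bsub>Comp (As ! i) m\<^esub> v)]) 1
        - single (w[i := (m, u)]) 1 - single (w[i := (m, v)]) 1"
        "w \<in> tensor_words As n" "i < length As" "m = fst (w ! i)"
        "u \<in> carrier (Comp (As ! i) m)" "v \<in> carrier (Comp (As ! i) m)"
    | w i m c u where "r = single (w[i := (m, c \<odot>\<^bsub>Comp (As ! i) m\<^esub> u)]) 1 - single (w[i := (m, u)]) c"
        "w \<in> tensor_words As n" "i < length As" "m = fst (w ! i)" "u \<in> carrier (Comp (As ! i) m)"
  using assms unfolding tensor_rels_def by blast

lemma tensor_quotient:
  assumes "\<forall>A\<in>set As. \<forall>n. module scalars (Comp A n)"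
  shows "quotient_space (tensor_free As n) (tensor_null As n)"
proof (rule quotient_space.intro)
  show M: "module scalars (tensor_free As n)"
    unfolding tensor_free_def by (rule module_free_mod)
  have cl: "u \<oplus>\<^bsub>Comp (As ! i) m\<^esub> v \<in> carrier (Comp (As ! i) m)"
    if "i < length As" "u \<in> carrier (Comp (As ! i) m)" "v \<in> carrier (Comp (As ! i) m)" for i m u v
  proof -
    interpret module scalars "Comp (As ! i) m" using assms that by simp
    show ?thesis using that by auto
  qed
  have cs: "c \<odot>\<^bsub>Comp (As ! i) m\<^esub> u \<in> carrier (Comp (As ! i) m)"
    if "i < length As" "u \<in> carrier (Comp (As ! i) m)" for i m u c
    using module.smult_closed[of scalars "Comp (As ! i) m" c u] assms that by simp
  have "tensor_rels As n \<subseteq> carrier (tensor_free As n)"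
  proof
    fix r assume "r \<in> tensor_rels As n"
    then show "r \<in> carrier (tensor_free As n)"
    proof (cases rule: tensor_relsE)
      case (1 w i m u v)
      show ?thesis
        unfolding 1(1) tensor_free_simps mem_Collect_eq
        by (intro keys_closed tensor_words_update[OF 1(2-4)] cl 1)
    next
      case (2 w i m c u)
      show ?thesis
        unfolding 2(1) tensor_free_simps mem_Collect_eq
        by (intro keys_closed tensor_words_update[OF 2(2-4)] cs 2)
    qed
  qed
  then show "submodule (tensor_null As n) scalars (tensor_free As n)"
    unfolding tensor_null_def by (rule submodule_span_of[OF M])
qed

lemma prod_sgn_pow_wdeg: "(\<Prod>i<length w. sgn_pow (fst (w ! i) * n)) = sgn_pow (wdeg w * n)"
  by (induction w) (simp_all add: prod.lessThan_Suc_shift sgn_pow_add algebra_simps del: prod.lessThan_Suc)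

text \<open>In the sign, the factors with \<open>j = 0\<close> say that the first letter
  \<open>b\<close> of the second word passes all letters of \<open>w\<close>; they combine to the
  exponent \<open>wdeg w * n\<close>. The rest is the sign for the remaining tensor factors.\<close>

lemma word_mult_Cons:
  assumes "length w = length As"
  shows "word_mult (A # As) ((m, a) # w) ((n, b) # w') =
    single [(m + n, Mult A m n a b)] (sgn_pow (wdeg w * n)) * word_mult As w w'"
  unfolding word_mult_def
  by (simp add: prod.lessThan_Suc_shift upt_conv_Cons prod.distrib map_Suc_upt[symmetric] o_def
      prod_sgn_pow_wdeg flip: assms del: prod.lessThan_Suc upt_Suc)

lemma the_elem_constant: "Z \<noteq> {} \<Longrightarrow> (\<And>z. z \<in> Z \<Longrightarrow> h z = c) \<Longrightarrow> the_elem (h ` Z) = c"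
  by (metis image_cong image_constant_conv the_elem_eq)

section \<open>Evaluation of tensor products in a commutative algebra\<close>

text \<open>One map per tensor factor; in the application these are the structure maps from the
  inputs of an operation to its output.\<close>

definition tens :: "(int \<Rightarrow> 'u \<Rightarrow> 'v) list \<Rightarrow> 'u word \<Rightarrow> 'v word" where
  "tens fs w = map2 (\<lambda>f (m, a). (m, f m a)) fs w"

lemma tens_simps [simp]: "tens [] w = []" "tens (f # fs) ((m, a) # w) = (m, f m a) # tens fs w"
  by (simp_all add: tens_def)

context dgca_space
begin

text \<open>Multilinearity of the product, the reason why evaluation respects
  \<open>tensor_rels\<close>.\<close>

lemma word_prod_update_linear:
  "w \<in> sym_words A n \<Longrightarrow> i < length w \<Longrightarrow> m = fst (w ! i) \<Longrightarrow>
    linear_map (Comp A m) (Comp A n) (\<lambda>u. word_prod A (w[i := (m, u)]))"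
proof (induction w arbitrary: n i)
  case (Cons a w)
  obtain k x where a: "a = (k, x)" by (cases a)
  have x: "x \<in> carrier (Comp A k)" and w: "w \<in> sym_words A (n - k)"
    using Cons.prems a by simp_all
  show ?case
  proof (cases i)
    case 0
    then show ?thesis
      using Mult_linear_left[OF word_prod_closed[OF w], of k] Cons.prems sym_words_wdeg[OF w] by (simp add: a)
  next
    case (Suc j)
    then have j: "j < length w" "m = fst (w ! j)"
      using Cons.prems by simp_all
    show ?thesis
      using linear_map_comp[OF Cons.IH[OF w j] Mult_linear_right[OF x]] wdeg_update[OF j]
      by (simp add: a Suc sym_words_wdeg[OF w])
  qed
qed simp

definition homs :: "('k,'u) dga list \<Rightarrow> (int \<Rightarrow> 'u \<Rightarrow> 'v) list \<Rightarrow> bool" where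
  "homs As fs \<longleftrightarrow> list_all2 (\<lambda>B f. dgca B \<and> dga_hom B A f) As fs"

lemma homs_simps [simp]:
  "homs [] fs \<longleftrightarrow> fs = []" "homs (B # As) (f # fs) \<longleftrightarrow> dgca B \<and> dga_hom B A f \<and> homs As fs"
  by (simp_all add: homs_def)

lemma homs_Cons: "homs (B # As) fs \<longleftrightarrow> (\<exists>f fs'. fs = f # fs' \<and> dgca B \<and> dga_hom B A f \<and> homs As fs')"
  by (simp add: homs_def list_all2_Cons1)

lemma dga_homD:
  assumes "dga_hom B A f"
  shows "chain_map B A f" "f 0 (Unit B) = Unit A"
    and "a \<in> carrier (Comp B m) \<Longrightarrow> b \<in> carrier (Comp B n) \<Longrightarrow> f (m + n) (Mult B m n a b) = Mult A m n (f m a) (f n b)"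
    and "a \<in> carrier (Comp B m) \<Longrightarrow> f m a \<in> carrier (Comp A m)"
  using assms unfolding dga_hom_def by (blast intro: chain_mapD(2))+

lemma tens_closed: "homs As fs \<Longrightarrow> w \<in> tensor_words As n \<Longrightarrow> tens fs w \<in> sym_words A n"
proof (induction As arbitrary: fs w n)
  case Nil
  then show ?case using tensor_words_Nil by auto
next
  case (Cons B As)
  then show ?case
    by (auto simp: homs_Cons elim!: tensor_words_ConsE intro: dga_homD)
qed

lemmas tens_prod_closed = word_prod_closed[OF tens_closed]

text \<open>On representatives, the map that sends an elementary tensor of the \<open>ai\<close> to
  the product of the \<open>fi ai\<close> in \<open>A\<close>. Multiplicativity of this map is where
  commutativity of \<open>A\<close> matters.\<close>

definition tensor_eval :: "(int \<Rightarrow> 'u \<Rightarrow> 'v) list \<Rightarrow> int \<Rightarrow> ('u word \<Rightarrow>\<^sub>0 'k) \<Rightarrow> 'v" where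
  "tensor_eval fs n = lin_ext (Comp A n) (\<lambda>w. word_prod A (tens fs w))"

lemma tensor_eval_linear: "homs As fs \<Longrightarrow> linear_map (tensor_free As n) (Comp A n) (tensor_eval fs n)"
  unfolding tensor_eval_def tensor_free_def by (rule linear_map_lin_ext[OF A_module tens_prod_closed])

lemma tensor_eval_single:
  "homs As fs \<Longrightarrow> w \<in> tensor_words As n \<Longrightarrow> tensor_eval fs n (single w c) = c \<odot>\<^bsub>Comp A n\<^esub> word_prod A (tens fs w)"
  unfolding tensor_eval_def by (rule lin_ext_single[OF A_module], rule tens_prod_closed)

lemma tensor_eval_single_one:
  "homs As fs \<Longrightarrow> w \<in> tensor_words As n \<Longrightarrow> tensor_eval fs n (single w 1) = word_prod A (tens fs w)"
  using tensor_eval_single[of As fs w n 1] module.smult_one[OF A_module tens_prod_closed] by simp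

lemma tensor_eval_zero: "homs As fs \<Longrightarrow> tensor_eval fs n 0 = \<zero>\<^bsub>Comp A n\<^esub>"
  using linear_map_zero[OF tensor_eval_linear _ A_module, of As fs n] module_free_mod[of "tensor_words As n"]
  by (simp add: tensor_free_def)

lemma keys_mult_tensor:
  assumes "a \<in> carrier (Comp B m)" "keys x \<subseteq> tensor_words As n"
  shows "keys (single [(m, a)] c * x) \<subseteq> tensor_words (B # As) (m + n)"
  by (rule keys_mult_words[OF _ assms(2), of _ "{[(m, a)]}"]) (use assms(1) in auto)

text \<open>The coefficient \<open>c\<close> stays with the first letter because the recursions for
  the differential and for the product both put a Koszul sign there.\<close>

lemma tensor_eval_Cons:
  assumes h: "homs (B # As) (f # fs)" and a: "a \<in> carrier (Comp B m)"
    and x: "keys x \<subseteq> tensor_words As n"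
  shows "tensor_eval (f # fs) (m + n) (single [(m, a)] c * x) = c \<odot>\<^bsub>Comp A (m + n)\<^esub> Mult A m n (f m a) (tensor_eval fs n x)"
proof (rule free_linear_map_eqI[OF _ _ A_module _ x])
  interpret M: module scalars "Comp A (m + n)" by (rule A_module)
  have f: "dga_hom B A f" and fs: "homs As fs" using h by simp_all
  have "linear_map (tensor_free As n) (tensor_free (B # As) (m + n)) (\<lambda>x. single [(m, a)] c * x)"
    using keys_mult_tensor[OF a] by (intro linear_mapI) (simp_all add: distrib_left pscale_mult_right)
  from linear_map_comp[OF this tensor_eval_linear[OF h]]
  show "linear_map (free_mod (tensor_words As n)) (Comp A (m + n)) (\<lambda>x. tensor_eval (f # fs) (m + n) (single [(m, a)] c * x))"
    by (simp add: tensor_free_def)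
  have "linear_map (Comp A (m + n)) (Comp A (m + n)) (\<lambda>x. c \<odot>\<^bsub>Comp A (m + n)\<^esub> x)"
    using M.smult_r_distr[of c] M.smult_assoc1[symmetric, of c, simplified] M.smult_assoc1[symmetric, of _ c, simplified]
    by (intro linear_mapI) (auto simp: mult.commute)
  from linear_map_comp[OF linear_map_comp[OF tensor_eval_linear[OF fs] Mult_linear_right[OF dga_homD(4)[OF f a]]] this]
  show "linear_map (free_mod (tensor_words As n)) (Comp A (m + n)) (\<lambda>x. c \<odot>\<^bsub>Comp A (m + n)\<^esub> Mult A m n (f m a) (tensor_eval fs n x))"
    by (simp add: tensor_free_def)
  fix w assume w: "w \<in> tensor_words As n"
  have "tensor_eval (f # fs) (m + n) (single ((m, a) # w) c) = c \<odot>\<^bsub>Comp A (m + n)\<^esub> word_prod A (tens (f # fs) ((m, a) # w))"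
    by (rule tensor_eval_single[OF h]) (simp add: a w)
  then show "tensor_eval (f # fs) (m + n) (single [(m, a)] c * single w 1) =
      c \<odot>\<^bsub>Comp A (m + n)\<^esub> Mult A m n (f m a) (tensor_eval fs n (single w 1))"
    using sym_words_wdeg[OF tens_closed[OF fs w]] by (simp add: tensor_eval_single_one[OF fs w])
qed

text \<open>The bound on the keys is proved in the same induction, since evaluating the step with
  \<open>tensor_eval_Cons\<close> requires that the differential of the tail consists of words of
  the right degree. The value then follows from the Leibniz rule in \<open>A\<close>.\<close>

lemma tensor_eval_word_diff:
  "homs As fs \<Longrightarrow> w \<in> tensor_words As n \<Longrightarrow>
    keys (word_diff (\<lambda>i. Diff (As ! i)) w :: 'u word \<Rightarrow>\<^sub>0 'k) \<subseteq> tensor_words As (n + 1) \<and>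
    tensor_eval fs (n + 1) (word_diff (\<lambda>i. Diff (As ! i)) w) = Diff A n (word_prod A (tens fs w))"
proof (induction As arbitrary: fs w n)
  case Nil
  then have [simp]: "fs = []" "w = []" "n = 0" using tensor_words_Nil by auto
  show ?case using tensor_eval_zero[of "[]" "[]" 1] by (simp add: Diff_Unit)
next
  case (Cons B As)
  obtain f fs' where fs: "fs = f # fs'" "dgca B" "dga_hom B A f" "homs As fs'"
    using Cons.prems(1) unfolding homs_Cons by blast
  obtain m a w' where w: "w = (m, a) # w'" and a: "a \<in> carrier (Comp B m)" and w': "w' \<in> tensor_words As (n - m)"
    using Cons.prems(2) by (rule tensor_words_ConsE)
  note h = Cons.prems(1)[unfolded fs(1)]
  let ?d = "word_diff (\<lambda>i. Diff (As ! i)) w' :: 'u word \<Rightarrow>\<^sub>0 'k"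
  note IH = Cons.IH[OF fs(4) w', THEN conjunct1] Cons.IH[OF fs(4) w', THEN conjunct2]
  have da: "Diff B m a \<in> carrier (Comp B (m + 1))"
    by (rule dgca_space.A_Diff_closed[OF dgca_space.intro[OF fs(2)] a])
  have e: "word_diff (\<lambda>i. Diff ((B # As) ! i)) w =
      single [(m + 1, Diff B m a)] 1 * single w' 1
      + single [(m, a)] (sgn_pow m) * ?d"
    by (simp add: w word_diff_Cons flip: pscale_mult_left)
  have sw': "keys (single w' (1::'k)) \<subseteq> tensor_words As (n - m)"
    using w' by simp
  have k1: "keys (single [(m + 1, Diff B m a)] (1::'k) * single w' 1) \<subseteq> tensor_words (B # As) (n + 1)"
    using keys_mult_tensor[OF da sw', of 1] by (simp add: algebra_simps)
  have k2: "keys (single [(m, a)] (sgn_pow m) * ?d) \<subseteq> tensor_words (B # As) (n + 1)"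
    using keys_mult_tensor[OF a IH(1), of "sgn_pow m"] by simp
  have "tensor_eval fs (n + 1) (single [(m + 1, Diff B m a)] 1 * single w' 1 + single [(m, a)] (sgn_pow m) * ?d) =
      tensor_eval fs (n + 1) (single [(m + 1, Diff B m a)] 1 * single w' 1) \<oplus>\<^bsub>Comp A (n + 1)\<^esub>
      tensor_eval fs (n + 1) (single [(m, a)] (sgn_pow m) * ?d)"
    using linear_mapD(2)[OF tensor_eval_linear[OF Cons.prems(1)], of _ "n + 1"] k1 k2 by (simp del: mult_single_word)
  also have "tensor_eval fs (n + 1) (single [(m + 1, Diff B m a)] 1 * single w' 1) =
      Mult A (m + 1) (n - m) (Diff A m (f m a)) (word_prod A (tens fs' w'))"
  proof -
    have "(m + 1, Diff B m a) # w' \<in> tensor_words (B # As) (n + 1)"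
      using da w' by simp
    then show ?thesis
      using tensor_eval_single_one[OF h] chain_mapD(3)[OF dga_homD(1)[OF fs(3)] a] sym_words_wdeg[OF tens_closed[OF fs(4) w']]
      by (simp add: fs(1))
  qed
  also have "tensor_eval fs (n + 1) (single [(m, a)] (sgn_pow m) * ?d) =
      sgn_pow m \<odot>\<^bsub>Comp A (n + 1)\<^esub> Mult A m (n - m + 1) (f m a) (Diff A (n - m) (word_prod A (tens fs' w')))"
    using tensor_eval_Cons[OF h a IH(1), of "sgn_pow m"] IH(2) by (simp add: fs(1))
  finally show ?case
    using Leibniz[OF dga_homD(4)[OF fs(3) a] tens_prod_closed[OF fs(4) w']] keys_closed(1)[OF k1 k2]
      sym_words_wdeg[OF tens_closed[OF fs(4) w']]
    unfolding e by (simp add: fs(1) w)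
qed

text \<open>The interchange law \<open>(a u) (b v) = (a b) (u v)\<close> up to the sign of moving
  \<open>b\<close> past \<open>u\<close>. Its exponent matches the one split off in
  \<open>word_mult_Cons\<close>.\<close>

lemma Mult_Mult_swap:
  assumes a: "a \<in> carrier (Comp A m)" and u: "u \<in> carrier (Comp A p)"
    and b: "b \<in> carrier (Comp A n)" and v: "v \<in> carrier (Comp A q)"
  shows "Mult A (m + p) (n + q) (Mult A m p a u) (Mult A n q b v) =
    sgn_pow (p * n) \<odot>\<^bsub>Comp A (m + p + (n + q))\<^esub> Mult A (m + n) (p + q) (Mult A m n a b) (Mult A p q u v)"
proof -
  have "Mult A (m + p) (n + q) (Mult A m p a u) (Mult A n q b v) =
      Mult A m (p + n + q) a (Mult A (p + n) q (Mult A p n u b) v)"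
    using Mult_assoc[OF a u Mult_closed[OF b v]] Mult_assoc[OF u b v] by (simp add: add.assoc)
  also have "Mult A p n u b = sgn_pow (p * n) \<odot>\<^bsub>Comp A (p + n)\<^esub> Mult A n p b u"
    by (rule Mult_comm[OF u b])
  also have "Mult A (p + n) q \<dots> v = sgn_pow (p * n) \<odot>\<^bsub>Comp A (p + n + q)\<^esub> Mult A (p + n) q (Mult A n p b u) v"
    using Mult_smult_left[OF v, of "Mult A n p b u" "p + n"] Mult_closed[OF b u] by (simp add: add.commute)
  also have "Mult A m (p + n + q) a \<dots> =
      sgn_pow (p * n) \<odot>\<^bsub>Comp A (m + (p + n + q))\<^esub> Mult A m (p + n + q) a (Mult A (p + n) q (Mult A n p b u) v)"
    by (rule Mult_smult_right[OF a]) (use Mult_closed[OF Mult_closed[OF b u] v] in \<open>simp add: add.commute\<close>)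
  also have "Mult A (p + n) q (Mult A n p b u) v = Mult A n (p + q) b (Mult A p q u v)"
    using Mult_assoc[OF b u v] by (simp add: add.commute)
  also have "Mult A m (p + n + q) a \<dots> = Mult A (m + n) (p + q) (Mult A m n a b) (Mult A p q u v)"
    using Mult_assoc[OF a b Mult_closed[OF u v]] by (simp add: algebra_simps)
  finally show ?thesis
    by (simp add: algebra_simps)
qed

text \<open>Induction over the tensor factors. The first factors are brought together by
  \<open>Mult_Mult_swap\<close>, where \<open>u\<close> is the product of all remaining letters of
  the first word; this produces exactly the sign in the product of elementary tensors.\<close>

lemma tensor_eval_word_mult:
  "homs As fs \<Longrightarrow> w \<in> tensor_words As m \<Longrightarrow> w' \<in> tensor_words As n \<Longrightarrow>
    keys (word_mult As w w' :: 'u word \<Rightarrow>\<^sub>0 'k) \<subseteq> tensor_words As (m + n) \<and>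
    tensor_eval fs (m + n) (word_mult As w w') = Mult A m n (word_prod A (tens fs w)) (word_prod A (tens fs w'))"
proof (induction As arbitrary: fs w m w' n)
  case Nil
  have "tensor_eval [] 0 (single ([] :: 'u word) (1::'k)) = Unit A"
    using tensor_eval_single_one[of "[]" "[]" "[]" 0] by simp
  moreover have [simp]: "fs = []" "w = []" "m = 0" "w' = []" "n = 0" using Nil tensor_words_Nil by auto
  ultimately show ?case
    by (simp add: word_mult_def Unit_Mult Unit_closed)
next
  case (Cons B As)
  obtain f fs' where fs: "fs = f # fs'" "dgca B" "dga_hom B A f" "homs As fs'"
    using Cons.prems(1) unfolding homs_Cons by blast
  obtain k a u where w: "w = (k, a) # u" and a: "a \<in> carrier (Comp B k)" and u: "u \<in> tensor_words As (m - k)"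
    using Cons.prems(2) by (rule tensor_words_ConsE)
  obtain l b v where w': "w' = (l, b) # v" and b: "b \<in> carrier (Comp B l)" and v: "v \<in> tensor_words As (n - l)"
    using Cons.prems(3) by (rule tensor_words_ConsE)
  note h = Cons.prems(1)[unfolded fs(1)]
  note IH = Cons.IH[OF fs(4) u v, THEN conjunct1] Cons.IH[OF fs(4) u v, THEN conjunct2]
  have ab: "Mult B k l a b \<in> carrier (Comp B (k + l))"
    by (rule dgca_space.Mult_closed[OF dgca_space.intro[OF fs(2)] a b])
  have e: "word_mult (B # As) w w' =
      single [(k + l, Mult B k l a b)] (sgn_pow ((m - k) * l)) * word_mult As u v"
    using word_mult_Cons[OF tensor_words_length[OF u]] tensor_words_wdeg[OF u] by (simp add: w w')
  have mn: "k + l + (m - k + (n - l)) = m + n" by simp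
  have "tensor_eval fs (m + n) (word_mult (B # As) w w') = sgn_pow ((m - k) * l) \<odot>\<^bsub>Comp A (m + n)\<^esub>
      Mult A (k + l) (m - k + (n - l)) (Mult A k l (f k a) (f l b))
        (Mult A (m - k) (n - l) (word_prod A (tens fs' u)) (word_prod A (tens fs' v)))"
    using tensor_eval_Cons[OF h ab IH(1), unfolded mn, of "sgn_pow ((m - k) * l)"] IH(2)
    by (simp add: e fs(1) dga_homD(3)[OF fs(3) a b])
  also have "\<dots> = Mult A m n (word_prod A (tens fs w)) (word_prod A (tens fs w'))"
    using Mult_Mult_swap[OF dga_homD(4)[OF fs(3) a] tens_prod_closed[OF fs(4) u] dga_homD(4)[OF fs(3) b] tens_prod_closed[OF fs(4) v]]
      sym_words_wdeg[OF tens_closed[OF fs(4) u]] sym_words_wdeg[OF tens_closed[OF fs(4) v]]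
    by (simp add: fs(1) w w')
  finally show ?case
    using keys_mult_tensor[OF ab IH(1), unfolded mn, of "sgn_pow ((m - k) * l)"] by (simp add: e)
qed

end


definition tensor_cls :: "('k::field,'u) dga list \<Rightarrow> int \<Rightarrow> ('u word \<Rightarrow>\<^sub>0 'k) \<Rightarrow> ('u word \<Rightarrow>\<^sub>0 'k) set" where
  "tensor_cls As n x = tensor_null As n +>\<^bsub>tensor_free As n\<^esub> x"

lemma tens_update:
  "i < length fs \<Longrightarrow> i < length w \<Longrightarrow> tens fs (w[i := (m, u)]) = (tens fs w)[i := (m, (fs ! i) m u)]"
  by (induction fs arbitrary: w i) (auto simp: tens_def nth_Cons zip_Cons1 split: list.splits nat.splits)

lemma length_tens [simp]: "length (tens fs w) = min (length fs) (length w)"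
  by (simp add: tens_def)

lemma nth_tens: "i < length fs \<Longrightarrow> i < length w \<Longrightarrow> tens fs w ! i = (fst (w ! i), (fs ! i) (fst (w ! i)) (snd (w ! i)))"
  by (simp add: tens_def split_beta)

lemma tens_append: "length fs = length u \<Longrightarrow> tens (fs @ gs) (u @ v) = tens fs u @ tens gs v"
  by (simp add: tens_def)

context dgca_space
begin

lemma homs_length: "homs As fs \<Longrightarrow> length fs = length As"
  by (simp add: homs_def list_all2_lengthD)

lemma homs_nth: "homs As fs \<Longrightarrow> i < length As \<Longrightarrow> dgca (As ! i) \<and> dga_hom (As ! i) A (fs ! i)"
  by (simp add: homs_def list_all2_conv_all_nth)

lemma homs_modules: "homs As fs \<Longrightarrow> \<forall>B\<in>set As. \<forall>n. module scalars (Comp B n)"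
  using homs_nth cochain_complexD(1)[OF dgcaD(1)] by (metis in_set_conv_nth)

text \<open>The kernel of the evaluation is a submodule and contains the relations by
  multilinearity, hence it contains their span.\<close>

lemma tensor_eval_tensor_null:
  assumes h: "homs As fs" and x: "x \<in> tensor_null As n"
  shows "tensor_eval fs n x = \<zero>\<^bsub>Comp A n\<^esub>"
proof -
  note Q = tensor_quotient[OF homs_modules[OF h], of n]
  note L = linear_mapD[OF tensor_eval_linear[OF h, of n]]
  interpret M: module scalars "Comp A n" by (rule A_module)
  let ?K = "{x \<in> carrier (tensor_free As n). tensor_eval fs n x = \<zero>\<^bsub>Comp A n\<^esub>}"
  have K: "submodule ?K scalars (tensor_free As n)"
    by (rule submodule_vsI[OF quotient_space.vs[OF Q]])
      (use L M.smult_r_null in \<open>auto simp: tensor_eval_zero[OF h] keys_closed\<close>)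
  have "tensor_rels As n \<subseteq> ?K"
  proof
    fix r assume r: "r \<in> tensor_rels As n"
    have rc: "r \<in> carrier (tensor_free As n)"
    proof -
      have "tensor_rels As n \<subseteq> tensor_null As n"
        by (auto simp: tensor_null_def span_of_def)
      then show ?thesis
        using r quotient_space.N_closed(1)[OF Q] by blast
    qed
    from r show "r \<in> ?K"
    proof (cases rule: tensor_relsE)
      case (1 w i m u v)
      let ?f = "fs ! i"
      interpret N: module scalars "Comp (As ! i) m" using homs_modules[OF h] 1(3) by simp
      note f = homs_nth[OF h 1(3), THEN conjunct2]
      note up = tensor_words_update[OF 1(2-4)]
      have len: "i < length fs" "i < length w" "i < length (tens fs w)" "m = fst (tens fs w ! i)"
        using 1 homs_length[OF h] tensor_words_length[OF 1(2)] by (simp_all add: nth_tens)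
      have s: "tensor_eval fs n (single (w[i := (m, z)]) 1) = word_prod A ((tens fs w)[i := (m, ?f m z)])"
        if "z \<in> carrier (Comp (As ! i) m)" for z
        using tensor_eval_single_one[OF h up[OF that]] len by (simp add: tens_update)
      note W = linear_mapD[OF word_prod_update_linear[OF tens_closed[OF h 1(2)] len(3,4)]]
      let ?x = "single (w[i := (m, u \<oplus>\<^bsub>Comp (As ! i) m\<^esub> v)]) (1::'k)"
      let ?y = "single (w[i := (m, u)]) (1::'k) + single (w[i := (m, v)]) 1"
      have xc: "?x \<in> carrier (tensor_free As n)" and yc: "?y \<in> carrier (tensor_free As n)"
        using up 1(5,6) by (simp_all add: keys_closed)
      have "tensor_eval fs n ?x = tensor_eval fs n ?y"
        using L(2)[of "single (w[i := (m, u)]) 1" "single (w[i := (m, v)]) 1"] up 1(5,6)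
          linear_mapD(2)[OF chain_mapD(1)[OF dga_homD(1)[OF f]] 1(5,6)]
          W(2)[OF dga_homD(4)[OF f 1(5)] dga_homD(4)[OF f 1(6)]]
        by (simp add: s)
      moreover have "?x - ?y = r"
        by (simp add: 1(1))
      moreover have "tensor_eval fs n (?x - ?y) = tensor_eval fs n ?x \<ominus>\<^bsub>Comp A n\<^esub> tensor_eval fs n ?y"
        using linear_map_diff[OF tensor_eval_linear[OF h] quotient_space.vs[OF Q] A_module xc yc] xc yc
        by (simp add: tensor_free_def minus_free_mod)
      ultimately show ?thesis
        using rc diff_eq_zero_iff[OF A_module L(1)[OF xc] L(1)[OF yc]] by simp
    next
      case (2 w i m c u)
      let ?f = "fs ! i"
      interpret N: module scalars "Comp (As ! i) m" using homs_modules[OF h] 2(3) by simp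
      note f = homs_nth[OF h 2(3), THEN conjunct2]
      note up = tensor_words_update[OF 2(2-4)]
      have len: "i < length fs" "i < length w" "i < length (tens fs w)" "m = fst (tens fs w ! i)"
        using 2 homs_length[OF h] tensor_words_length[OF 2(2)] by (simp_all add: nth_tens)
      have s: "tensor_eval fs n (single (w[i := (m, z)]) 1) = word_prod A ((tens fs w)[i := (m, ?f m z)])"
        if "z \<in> carrier (Comp (As ! i) m)" for z
        using tensor_eval_single_one[OF h up[OF that]] len by (simp add: tens_update)
      note W = linear_mapD[OF word_prod_update_linear[OF tens_closed[OF h 2(2)] len(3,4)]]
      let ?x = "single (w[i := (m, c \<odot>\<^bsub>Comp (As ! i) m\<^esub> u)]) (1::'k)"
      let ?y = "single (w[i := (m, u)]) c"
      have cu: "c \<odot>\<^bsub>Comp (As ! i) m\<^esub> u \<in> carrier (Comp (As ! i) m)"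
        using 2(5) N.smult_closed by simp
      have xc: "?x \<in> carrier (tensor_free As n)" and yc: "?y \<in> carrier (tensor_free As n)"
        using up cu 2(5) by (simp_all add: keys_closed)
      have "tensor_eval fs n ?x = tensor_eval fs n ?y"
        using tensor_eval_single[OF h up[OF 2(5)], of c] s[OF cu] len
          linear_mapD(3)[OF chain_mapD(1)[OF dga_homD(1)[OF f]] 2(5)]
          W(3)[OF dga_homD(4)[OF f 2(5)]]
        by (simp add: tens_update)
      moreover have "tensor_eval fs n (?x - ?y) = tensor_eval fs n ?x \<ominus>\<^bsub>Comp A n\<^esub> tensor_eval fs n ?y"
        using linear_map_diff[OF tensor_eval_linear[OF h] quotient_space.vs[OF Q] A_module xc yc] xc yc
        by (simp add: tensor_free_def minus_free_mod)
      ultimately show ?thesis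
        using rc diff_eq_zero_iff[OF A_module L(1)[OF xc] L(1)[OF yc]] 2(1) by simp
    qed
  qed
  then have "tensor_null As n \<subseteq> ?K"
    unfolding tensor_null_def by (rule span_of_subset[OF K])
  then show ?thesis using x by blast
qed

context
  fixes As :: "('k,'u) dga list" and fs :: "(int \<Rightarrow> 'u \<Rightarrow> 'v) list" and h :: "'u word \<Rightarrow> 'v"
  assumes homs: "homs As fs" and h: "\<And>n w. w \<in> tensor_words As n \<Longrightarrow> h w = word_prod A (tens fs w)"
begin

text \<open>An operation comes with its own formula \<open>h\<close>, which is required to equal the
  product of the images on words of the tensor product only. Representatives are combinations of
  such words, so the linear extensions agree there.\<close>

lemma lin_ext_tensor_eval:
  assumes "keys x \<subseteq> tensor_words As n"
  shows "lin_ext (Comp A n) h x = tensor_eval fs n x"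
proof (rule free_linear_map_eqI[OF _ _ A_module _ assms])
  have c: "h w \<in> carrier (Comp A n)" if "w \<in> tensor_words As n" for w
    using that by (simp add: h tens_prod_closed[OF homs])
  show "linear_map (free_mod (tensor_words As n)) (Comp A n) (lin_ext (Comp A n) h)"
    by (rule linear_map_lin_ext[OF A_module c])
  show "linear_map (free_mod (tensor_words As n)) (Comp A n) (tensor_eval fs n)"
    using tensor_eval_linear[OF homs] by (simp add: tensor_free_def)
  show "lin_ext (Comp A n) h (single w 1) = tensor_eval fs n (single w 1)"
    if "w \<in> tensor_words As n" for w
    using lin_ext_single[OF A_module, of h w n 1] c[OF that] module.smult_one[OF A_module c[OF that]]
    by (simp add: tensor_eval_single_one[OF homs that] h[OF that])
qed

interpretation Q: quotient_space "tensor_free As n" "tensor_null As n" for n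
  by (rule tensor_quotient[OF homs_modules[OF homs]])

lemma mem_tensor_cls:
  assumes "keys x \<subseteq> tensor_words As n" "z \<in> tensor_cls As n x"
  shows "keys z \<subseteq> tensor_words As n" "tensor_eval fs n z = tensor_eval fs n x"
proof -
  have z: "z \<in> carrier (tensor_free As n)" "z \<ominus>\<^bsub>tensor_free As n\<^esub> x \<in> tensor_null As n"
    using assms Q.mem_coset[of x n z] Q.coset_eq_iff[of z n x] by (auto simp: tensor_cls_def)
  then show "keys z \<subseteq> tensor_words As n" by simp
  have x: "x \<in> carrier (tensor_free As n)" using assms by simp
  show "tensor_eval fs n z = tensor_eval fs n x"
    using linear_map_diff[OF tensor_eval_linear[OF homs] Q.vs A_module z(1) x] tensor_eval_tensor_null[OF homs z(2)]
      diff_eq_zero_iff[OF A_module linear_mapD(1)[OF tensor_eval_linear[OF homs] z(1)] linear_mapD(1)[OF tensor_eval_linear[OF homs] x]]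
    by simp
qed

text \<open>\<^const>\<open>Diff\<close> and \<^const>\<open>Mult\<close> of a tensor product are unions of cosets over all
  representatives. The evaluation is constant on these unions, so that it commutes with the
  operations without any appeal to their well-definedness.\<close>

lemma tensor_ext_constant:
  assumes "Z \<noteq> {}" "\<And>z. z \<in> Z \<Longrightarrow> keys z \<subseteq> tensor_words As n" "\<And>z. z \<in> Z \<Longrightarrow> tensor_eval fs n z = c"
  shows "tensor_ext A h n Z = c"
  unfolding tensor_ext_def by (rule the_elem_constant[OF assms(1)]) (simp add: lin_ext_tensor_eval assms)

lemma tensor_cls_self: "keys x \<subseteq> tensor_words As n \<Longrightarrow> x \<in> tensor_cls As n x"
  unfolding tensor_cls_def by (rule Q.self_coset) simp

lemma tensor_ext_cls:
  assumes "keys x \<subseteq> tensor_words As n"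
  shows "tensor_ext A h n (tensor_cls As n x) = tensor_eval fs n x"
  using tensor_cls_self[OF assms] by (intro tensor_ext_constant mem_tensor_cls[OF assms]) blast+

lemma tensor_ext_elem:
  assumes "w \<in> tensor_words As n"
  shows "tensor_ext A h n (elem_tensor As w) = word_prod A (tens fs w)"
  using tensor_ext_cls[of "single w 1" n] assms
  by (simp add: elem_tensor_def tensor_words_wdeg[OF assms] tensor_cls_def tensor_eval_single_one[OF homs])

lemma tensor_carrier: "carrier (Comp (tensor As) n) = tensor_cls As n ` {x. keys x \<subseteq> tensor_words As n}"
  using Q.carrier_quot by (simp add: tensor_def tensor_cls_def[abs_def])

lemma tensor_eval_free_word_diff:
  assumes "keys x \<subseteq> tensor_words As n"
  shows "keys (free_ext (word_diff (\<lambda>i. Diff (As ! i))) x) \<subseteq> tensor_words As (n + 1)"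
    and "tensor_eval fs (n + 1) (free_ext (word_diff (\<lambda>i. Diff (As ! i))) x) = Diff A n (tensor_eval fs n x)"
proof -
  note k = tensor_eval_word_diff[OF homs, THEN conjunct1]
  show "keys (free_ext (word_diff (\<lambda>i. Diff (As ! i))) x) \<subseteq> tensor_words As (n + 1)"
    by (rule keys_free_ext[OF k assms])
  show "tensor_eval fs (n + 1) (free_ext (word_diff (\<lambda>i. Diff (As ! i))) x) = Diff A n (tensor_eval fs n x)"
  proof (rule free_linear_map_eqI[OF _ _ A_module _ assms])
    show "linear_map (free_mod (tensor_words As n)) (Comp A (n + 1)) (\<lambda>x. tensor_eval fs (n + 1) (free_ext (word_diff (\<lambda>i. Diff (As ! i))) x))"
      by (rule linear_map_comp[OF linear_map_free_ext tensor_eval_linear[OF homs, unfolded tensor_free_def]], rule k)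
    show "linear_map (free_mod (tensor_words As n)) (Comp A (n + 1)) (\<lambda>x. Diff A n (tensor_eval fs n x))"
      using linear_map_comp[OF tensor_eval_linear[OF homs, unfolded tensor_free_def] A_Diff_linear] .
  qed (simp add: tensor_eval_word_diff[OF homs] tensor_eval_single_one[OF homs])
qed

lemma tensor_eval_free_word_mult:
  assumes x: "keys x \<subseteq> tensor_words As m" and y: "keys y \<subseteq> tensor_words As n"
  shows "keys (free_ext (\<lambda>w. free_ext (word_mult As w) y) x) \<subseteq> tensor_words As (m + n)"
    and "tensor_eval fs (m + n) (free_ext (\<lambda>w. free_ext (word_mult As w) y) x) = Mult A m n (tensor_eval fs m x) (tensor_eval fs n y)"
proof -
  note k = tensor_eval_word_mult[OF homs, THEN conjunct1]
  note TTl = tensor_eval_linear[OF homs, unfolded tensor_free_def]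
  have ky: "keys (free_ext (word_mult As w) y) \<subseteq> tensor_words As (m + n)"
    if "w \<in> tensor_words As m" for w
    by (rule keys_free_ext[OF k[OF that] y])
  show "keys (free_ext (\<lambda>w. free_ext (word_mult As w) y) x) \<subseteq> tensor_words As (m + n)"
    by (rule keys_free_ext[OF ky x])
  have Ty: "tensor_eval fs n y \<in> carrier (Comp A n)"
    using linear_mapD(1)[OF TTl] y by simp
  show "tensor_eval fs (m + n) (free_ext (\<lambda>w. free_ext (word_mult As w) y) x) = Mult A m n (tensor_eval fs m x) (tensor_eval fs n y)"
  proof (rule free_linear_map_eqI[OF _ _ A_module _ x])
    show "linear_map (free_mod (tensor_words As m)) (Comp A (m + n)) (\<lambda>x. tensor_eval fs (m + n) (free_ext (\<lambda>w. free_ext (word_mult As w) y) x))"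
      by (rule linear_map_comp[OF linear_map_free_ext[OF ky] TTl])
    show "linear_map (free_mod (tensor_words As m)) (Comp A (m + n)) (\<lambda>x. Mult A m n (tensor_eval fs m x) (tensor_eval fs n y))"
      by (rule linear_map_comp[OF TTl Mult_linear_left[OF Ty]])
    fix u assume u: "u \<in> tensor_words As m"
    have "tensor_eval fs (m + n) (free_ext (word_mult As u) y) = Mult A m n (word_prod A (tens fs u)) (tensor_eval fs n y)"
    proof (rule free_linear_map_eqI[OF _ _ A_module _ y])
      show "linear_map (free_mod (tensor_words As n)) (Comp A (m + n)) (\<lambda>y. tensor_eval fs (m + n) (free_ext (word_mult As u) y))"
        by (rule linear_map_comp[OF linear_map_free_ext[OF k[OF u]] TTl])
      show "linear_map (free_mod (tensor_words As n)) (Comp A (m + n)) (\<lambda>y. Mult A m n (word_prod A (tens fs u)) (tensor_eval fs n y))"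
        by (rule linear_map_comp[OF TTl Mult_linear_right[OF tens_prod_closed[OF homs u]]])
    qed (simp add: tensor_eval_word_mult[OF homs u] tensor_eval_single_one[OF homs])
    then show "tensor_eval fs (m + n) (free_ext (\<lambda>w. free_ext (word_mult As w) y) (single u 1)) =
        Mult A m n (tensor_eval fs m (single u 1)) (tensor_eval fs n y)"
      by (simp add: tensor_eval_single_one[OF homs u])
  qed
qed

lemma word_prod_units: "word_prod A (tens fs (map (\<lambda>A. (0, Unit A)) As)) = Unit A \<and> map (\<lambda>A. (0, Unit A)) As \<in> tensor_words As 0"
  using homs
proof (induction As arbitrary: fs)
  case (Cons B As)
  then obtain f fs' where fs: "fs = f # fs'" "dgca B" "dga_hom B A f" "homs As fs'"
    unfolding homs_Cons by blast
  then show ?case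
    using Cons.IH[OF fs(4)] dgcaD(2)[OF fs(2)] sym_words_wdeg[OF tens_closed[OF fs(4)], of _ 0]
    by (simp add: dga_homD(2) Unit_Mult Unit_closed)
qed simp

lemma tensor_ext_hom: "dga_hom (tensor As) A (tensor_ext A h)"
  unfolding dga_hom_def chain_map_def
proof (intro conjI allI ballI)
  show "linear_map (Comp (tensor As) n) (Comp A n) (tensor_ext A h n)" for n
    using Q.linear_map_quotI[OF _ tensor_eval_linear[OF homs], of n "tensor_ext A h n"] tensor_ext_cls
    by (simp add: tensor_def tensor_cls_def)
  show "tensor_ext A h (n + 1) (Diff (tensor As) n a) = Diff A n (tensor_ext A h n a)"
    if a: "a \<in> carrier (Comp (tensor As) n)" for n a
  proof -
    obtain x where x: "keys x \<subseteq> tensor_words As n" "a = tensor_cls As n x"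
      using a unfolding tensor_carrier by blast
    let ?d = "free_ext (word_diff (\<lambda>i. Diff (As ! i))) :: ('u word \<Rightarrow>\<^sub>0 'k) \<Rightarrow> _"
    have D: "Diff (tensor As) n a = (\<Union>z\<in>tensor_cls As n x. tensor_cls As (n + 1) (?d z))"
      by (simp add: tensor_def quot_map_def tensor_cls_def x(2))
    show ?thesis
      unfolding D
    proof (rule tensor_ext_constant)
      show "(\<Union>z\<in>tensor_cls As n x. tensor_cls As (n + 1) (?d z)) \<noteq> {}"
        using tensor_cls_self[OF x(1)] tensor_cls_self[OF tensor_eval_free_word_diff(1)[OF x(1)]] by blast
      fix y assume "y \<in> (\<Union>z\<in>tensor_cls As n x. tensor_cls As (n + 1) (?d z))"
      then obtain z where z: "z \<in> tensor_cls As n x" "y \<in> tensor_cls As (n + 1) (?d z)" by blast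
      note zk = mem_tensor_cls[OF x(1) z(1)]
      note yk = mem_tensor_cls[OF tensor_eval_free_word_diff(1)[OF zk(1)] z(2)]
      show "keys y \<subseteq> tensor_words As (n + 1)" by (rule yk)
      show "tensor_eval fs (n + 1) y = Diff A n (tensor_ext A h n a)"
        using yk zk tensor_eval_free_word_diff(2)[OF zk(1)] tensor_ext_cls[OF x(1)] x(2) by simp
    qed
  qed
  show "tensor_ext A h 0 (Unit (tensor As)) = Unit A"
    using tensor_ext_cls[of "single (map (\<lambda>A. (0, Unit A)) As) 1" 0] word_prod_units
      tensor_eval_single_one[OF homs, of "map (\<lambda>A. (0, Unit A)) As" 0]
    by (simp add: tensor_def tensor_cls_def)
  show "tensor_ext A h (m + n) (Mult (tensor As) m n a b) = Mult A m n (tensor_ext A h m a) (tensor_ext A h n b)"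
    if a: "a \<in> carrier (Comp (tensor As) m)" and b: "b \<in> carrier (Comp (tensor As) n)" for m n a b
  proof -
    obtain x where x: "keys x \<subseteq> tensor_words As m" "a = tensor_cls As m x"
      using a unfolding tensor_carrier by blast
    obtain y where y: "keys y \<subseteq> tensor_words As n" "b = tensor_cls As n y"
      using b unfolding tensor_carrier by blast
    let ?p = "\<lambda>x y. free_ext (\<lambda>w. free_ext (word_mult As w) y) x :: 'u word \<Rightarrow>\<^sub>0 'k"
    have D: "Mult (tensor As) m n a b = (\<Union>x'\<in>tensor_cls As m x. \<Union>y'\<in>tensor_cls As n y. tensor_cls As (m + n) (?p x' y'))"
      by (simp add: tensor_def tensor_cls_def x(2) y(2))
    show ?thesis
      unfolding D
    proof (rule tensor_ext_constant)
      show "(\<Union>x'\<in>tensor_cls As m x. \<Union>y'\<in>tensor_cls As n y. tensor_cls As (m + n) (?p x' y')) \<noteq> {}"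
        using tensor_cls_self[OF x(1)] tensor_cls_self[OF y(1)] tensor_cls_self[OF tensor_eval_free_word_mult(1)[OF x(1) y(1)]] by blast
      fix z assume "z \<in> (\<Union>x'\<in>tensor_cls As m x. \<Union>y'\<in>tensor_cls As n y. tensor_cls As (m + n) (?p x' y'))"
      then obtain x' y' where z: "x' \<in> tensor_cls As m x" "y' \<in> tensor_cls As n y" "z \<in> tensor_cls As (m + n) (?p x' y')"
        by blast
      note xk = mem_tensor_cls[OF x(1) z(1)] and yk = mem_tensor_cls[OF y(1) z(2)]
      note zk = mem_tensor_cls[OF tensor_eval_free_word_mult(1)[OF xk(1) yk(1)] z(3)]
      show "keys z \<subseteq> tensor_words As (m + n)" by (rule zk)
      show "tensor_eval fs (m + n) z = Mult A m n (tensor_ext A h m a) (tensor_ext A h n b)"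
        using zk xk yk tensor_eval_free_word_mult(2)[OF xk(1) yk(1)] tensor_ext_cls[OF x(1)] tensor_ext_cls[OF y(1)] x(2) y(2)
        by simp
    qed
  qed
qed

end

end


section \<open>Koszul signs\<close>

text \<open>The sign of sorting a list of positions, where \<open>d k\<close> is the degree at position \<open>k\<close>;
  sorting by insertion makes it recursive.\<close>

fun sort_sign :: "(nat \<Rightarrow> int) \<Rightarrow> nat list \<Rightarrow> 'k::field" where
  "sort_sign d [] = 1"
| "sort_sign d (k # ks) = (\<Prod>j\<leftarrow>ks. if j < k then sgn_pow (d k * d j) else 1) * sort_sign d ks"

text \<open>The inversions of \<open>k # ks\<close> are those that involve position 0, collected in
  the factor for \<open>k\<close>, and the inversions of \<open>ks\<close> shifted by one in both
  positions.\<close>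

lemma sort_sign_eq_prod:
  "sort_sign d ks = (\<Prod>(i, j)\<in>{(i, j). i < j \<and> j < length ks \<and> ks ! j < ks ! i}. sgn_pow (d (ks ! i) * d (ks ! j)))"
proof (induction ks)
  case Nil
  then show ?case by simp
next
  case (Cons k ks)
  let ?P = "\<lambda>ks. {(i, j). i < j \<and> j < length ks \<and> ks ! j < ks ! i}"
  let ?s = "\<lambda>ks (i, j). sgn_pow (d (ks ! i) * d (ks ! j)) :: 'a"
  let ?A = "(\<lambda>j. (0, Suc j)) ` {j. j < length ks \<and> ks ! j < k}"
  let ?B = "(\<lambda>(i, j). (Suc i, Suc j)) ` ?P ks"
  have fin: "finite (?P ks)"
    by (rule finite_subset[of _ "{..<length ks} \<times> {..<length ks}"]) auto
  have split: "?P (k # ks) = ?A \<union> ?B"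
  proof (intro equalityI subsetI)
    fix p assume "p \<in> ?P (k # ks)"
    then show "p \<in> ?A \<union> ?B"
      by (cases p; cases "fst p"; cases "snd p") (auto simp: image_iff)
  qed auto
  have "(\<Prod>p\<in>?P (k # ks). ?s (k # ks) p) = (\<Prod>p\<in>?A. ?s (k # ks) p) * (\<Prod>p\<in>?B. ?s (k # ks) p)"
    unfolding split by (rule prod.union_disjoint) (use fin in auto)
  also have "(\<Prod>p\<in>?A. ?s (k # ks) p) = (\<Prod>j | j < length ks \<and> ks ! j < k. sgn_pow (d k * d (ks ! j)))"
    by (subst prod.reindex) (auto simp: inj_on_def)
  also have "\<dots> = (\<Prod>j<length ks. if ks ! j < k then sgn_pow (d k * d (ks ! j)) else 1)"
    by (rule prod.mono_neutral_cong_left) auto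
  also have "\<dots> = (\<Prod>j\<leftarrow>ks. if j < k then sgn_pow (d k * d j) else 1)"
    by (simp add: prod.list_conv_set_nth atLeast0LessThan)
  also have "(\<Prod>p\<in>?B. ?s (k # ks) p) = (\<Prod>p\<in>?P ks. ?s ks p)"
    by (subst prod.reindex) (auto simp: inj_on_def split_beta)
  finally show ?case
    by (simp only: sort_sign.simps Cons.IH)
qed

lemma sum_list_insort: "(\<Sum>j\<leftarrow>insort k ks. h j) = h k + (\<Sum>j\<leftarrow>ks. h j :: int)"
  by (induction ks) simp_all

context dgca_space
begin

lemma sym_words_map: "(\<And>j. snd (L j) \<in> carrier (Comp A (fst (L j)))) \<Longrightarrow> map L ks \<in> sym_words A (\<Sum>j\<leftarrow>ks. fst (L j))"
  by (induction ks) (auto simp: sym_words_def letters_def split_beta)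

lemma smult_assoc: "x \<in> carrier (Comp A n) \<Longrightarrow> a \<odot>\<^bsub>Comp A n\<^esub> (b \<odot>\<^bsub>Comp A n\<^esub> x) = (a * b) \<odot>\<^bsub>Comp A n\<^esub> x"
  using module.smult_assoc1[OF A_module, of a b x n] by simp

lemma smult_one: "x \<in> carrier (Comp A n) \<Longrightarrow> 1 \<odot>\<^bsub>Comp A n\<^esub> x = x"
  using module.smult_one[OF A_module, of x n] by simp

text \<open>Letters are indexed by \<open>L\<close>, so a word is a list of indices and sorting acts
  on the indices. Insertion moves \<open>k\<close> past the smaller entries at the front of a sorted
  list, one transposition at a time.\<close>

lemma word_prod_insort:
  assumes L: "\<And>j. snd (L j) \<in> carrier (Comp A (fst (L j)))" and "sorted ks"
  shows "word_prod A (map L (k # ks)) =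
    (\<Prod>j\<leftarrow>ks. if j < k then sgn_pow (fst (L k) * fst (L j)) else 1) \<odot>\<^bsub>Comp A (\<Sum>j\<leftarrow>k # ks. fst (L j))\<^esub>
      word_prod A (map L (insort k ks))"
  using assms(2)
proof (induction ks)
  case Nil
  then show ?case
    using word_prod_closed[OF sym_words_map[where L = L, OF L, where ks = "[k]"]] by (simp add: smult_one)
next
  case (Cons l ks)
  let ?s = "\<lambda>j. if j < k then sgn_pow (fst (L k) * fst (L j)) else 1 :: 'k"
  let ?n = "\<Sum>j\<leftarrow>k # l # ks. fst (L j)"
  obtain a m where k: "L k = (m, a)" and a: "a \<in> carrier (Comp A m)" using L[of k] by (cases "L k") auto
  obtain b n where l: "L l = (n, b)" and b: "b \<in> carrier (Comp A n)" using L[of l] by (cases "L l") auto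
  let ?p = "\<Sum>j\<leftarrow>ks. fst (L j)"
  have ins: "map L (insort k ks) \<in> sym_words A (m + ?p)"
    using sym_words_map[where L = L, OF L, where ks = "insort k ks"] by (simp add: sum_list_insort k)
  show ?case
  proof (cases "k \<le> l")
    case True
    then have "(\<Prod>j\<leftarrow>l # ks. ?s j) = 1"
      using Cons.prems by (induction ks) auto
    moreover have "insort k (l # ks) = k # l # ks"
      using True by simp
    ultimately show ?thesis
      using word_prod_closed[OF sym_words_map[where L = L, OF L, where ks = "k # l # ks"]] smult_one by metis
  next
    case False
    then have lt: "l < k" by simp
    have IH: "word_prod A ((m, a) # map L ks) =
        (\<Prod>j\<leftarrow>ks. ?s j) \<odot>\<^bsub>Comp A (m + ?p)\<^esub> word_prod A (map L (insort k ks))"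
      using Cons.IH Cons.prems by (simp add: k del: word_prod.simps)
    have "word_prod A (map L (k # l # ks)) =
        sgn_pow (m * n) \<odot>\<^bsub>Comp A (m + n + ?p)\<^esub> word_prod A ((n, b) # (m, a) # map L ks)"
      using word_prod_swap[OF a b sym_words_map[where L = L, OF L]] by (simp add: k l del: word_prod.simps)
    also have "word_prod A ((n, b) # (m, a) # map L ks) = Mult A n (m + ?p) b (word_prod A ((m, a) # map L ks))"
      using sym_words_wdeg[OF sym_words_map[where L = L, OF L, where ks = ks]] by simp
    also have "\<dots> = (\<Prod>j\<leftarrow>ks. ?s j) \<odot>\<^bsub>Comp A (n + (m + ?p))\<^esub> Mult A n (m + ?p) b (word_prod A (map L (insort k ks)))"
      unfolding IH by (rule Mult_smult_right[OF b word_prod_closed[OF ins]])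
    also have "Mult A n (m + ?p) b (word_prod A (map L (insort k ks))) = word_prod A (map L (insort k (l # ks)))"
      using False sym_words_wdeg[OF ins] by (simp add: l)
    finally show ?thesis
      using False word_prod_closed[OF sym_words_map[where L = L, OF L, where ks = "insort k (l # ks)"]]
      by (simp add: smult_assoc k l sum_list_insort algebra_simps lt del: word_prod.simps)
  qed
qed

text \<open>Insertion sort: the tail is sorted by the induction hypothesis, then the head is
  inserted.\<close>

lemma word_prod_sort:
  assumes L: "\<And>j. snd (L j) \<in> carrier (Comp A (fst (L j)))"
  shows "word_prod A (map L ks) =
    sort_sign (\<lambda>j. fst (L j)) ks \<odot>\<^bsub>Comp A (\<Sum>j\<leftarrow>ks. fst (L j))\<^esub> word_prod A (map L (sort ks))"
proof (induction ks)
  case Nil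
  then show ?case by (simp add: smult_one Unit_closed)
next
  case (Cons k ks)
  let ?p = "\<Sum>j\<leftarrow>ks. fst (L j)"
  obtain a m where k: "L k = (m, a)" and a: "a \<in> carrier (Comp A m)" using L[of k] by (cases "L k") auto
  have p: "(\<Sum>j\<leftarrow>sort ks. fst (L j)) = ?p"
    by (simp flip: sum_mset_sum_list)
  have srt: "map L (sort ks) \<in> sym_words A ?p"
    using sym_words_map[where L = L, OF L, where ks = "sort ks"] p by simp
  have ins: "word_prod A (map L (insort k (sort ks))) \<in> carrier (Comp A (m + ?p))"
    using word_prod_closed[OF sym_words_map[where L = L, OF L, where ks = "insort k (sort ks)"]] p by (simp add: sum_list_insort k)
  \<comment> \<open>The factor of the head depends only on the multiset of the tail, so it may be
    computed before the tail is sorted.\<close>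
  have pr: "(\<Prod>j\<leftarrow>sort ks. if j < k then sgn_pow (fst (L k) * fst (L j)) else 1) = (\<Prod>j\<leftarrow>ks. if j < k then sgn_pow (fst (L k) * fst (L j)) else 1 :: 'k)"
    by (simp flip: prod_mset_prod_list)
  have "word_prod A (map L (k # ks)) = Mult A m ?p a (word_prod A (map L ks))"
    using sym_words_wdeg[OF sym_words_map[where L = L, OF L, where ks = ks]] by (simp add: k)
  also have "\<dots> = sort_sign (\<lambda>j. fst (L j)) ks \<odot>\<^bsub>Comp A (m + ?p)\<^esub> Mult A m ?p a (word_prod A (map L (sort ks)))"
    unfolding Cons.IH by (rule Mult_smult_right[OF a word_prod_closed[OF srt]])
  also have "Mult A m ?p a (word_prod A (map L (sort ks))) = word_prod A (map L (k # sort ks))"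
    using sym_words_wdeg[OF srt] by (simp add: k)
  also have "\<dots> = (\<Prod>j\<leftarrow>ks. if j < k then sgn_pow (fst (L k) * fst (L j)) else 1) \<odot>\<^bsub>Comp A (m + ?p)\<^esub> word_prod A (map L (insort k (sort ks)))"
    using word_prod_insort[where L = L, OF L, where ks = "sort ks" and k = k] by (simp add: k p pr del: word_prod.simps)
  finally show ?case
    using ins by (simp add: smult_assoc k mult.commute)
qed

text \<open>The permuted word lists the letters of \<open>w\<close> at the positions
  \<open>\<sigma> 0\<close>, \<open>\<sigma> 1\<close> and so on. Sorting these positions restores
  \<open>w\<close>, and their inversions are the pairs over which \<open>koszul\<close>
  multiplies.\<close>

lemma word_prod_permute:
  assumes w: "w \<in> sym_words A n" and \<sigma>: "\<sigma> permutes {..<length w}"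
  shows "word_prod A (permute_list \<sigma> w) = koszul \<sigma> w \<odot>\<^bsub>Comp A n\<^esub> word_prod A w"
proof -
  \<comment> \<open>The sorting lemmas ask for every value of \<open>L\<close> to lie in the
    algebra, also beyond the length of \<open>w\<close>; the unit serves as default.\<close>
  define L where "L j = (if j < length w then w ! j else (0, Unit A))" for j
  have wn: "snd (w ! j) \<in> carrier (Comp A (fst (w ! j)))" if "j < length w" for j
    using w nth_mem[OF that] by (force simp: sym_words_def letters_def)
  have L: "snd (L j) \<in> carrier (Comp A (fst (L j)))" for j
    using wn by (simp add: L_def Unit_closed)
  let ?ks = "map \<sigma> [0..<length w]"
  have \<sigma>_less: "\<sigma> i < length w" if "i < length w" for i
    using permutes_in_image[OF \<sigma>, of i] that by simp
  have e1: "sort ?ks = [0..<length w]"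
  proof (rule sorted_distinct_set_unique)
    show "distinct (sort ?ks)"
      using permutes_inj_on[OF \<sigma>] by (simp add: distinct_map)
    show "set (sort ?ks) = set [0..<length w]"
      using permutes_image[OF \<sigma>] by (simp add: atLeast0LessThan)
  qed simp_all
  have e2: "map L [0..<length w] = w"
    by (rule nth_equalityI) (simp_all add: L_def)
  have pl: "map L ?ks = permute_list \<sigma> w"
    by (rule nth_equalityI) (simp_all add: L_def \<sigma>_less permute_list_nth \<sigma>)
  have e3: "sort_sign (\<lambda>j. fst (L j)) ?ks = (koszul \<sigma> w :: 'k)"
    unfolding sort_sign_eq_prod koszul_def
    by (rule prod.cong) (auto simp: L_def \<sigma>_less)
  have e4: "(\<Sum>j\<leftarrow>?ks. fst (L j)) = n"
  proof -
    have "(\<Sum>j\<leftarrow>?ks. fst (L j)) = wdeg (permute_list \<sigma> w)"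
      unfolding wdeg_def by (simp flip: pl add: o_def)
    also have "\<dots> = wdeg w"
      by (simp add: wdeg_def mset_permute_list[OF \<sigma>] flip: sum_mset_sum_list)
    finally show ?thesis by (simp add: sym_words_wdeg[OF w])
  qed
  show ?thesis
    using word_prod_sort[where L = L, OF L, where ks = ?ks] unfolding e1 e2 pl e3 e4 .
qed

end


section \<open>Algebras over the colored operad from commutative algebras\<close>

lemma D11_single: "D11 [I] J \<longleftrightarrow> color I \<and> color J \<and> ivl I \<subseteq> ivl J"
  by (auto simp: D11_def)

lemma D11_member: "D11 Is J \<Longrightarrow> I \<in> set Is \<Longrightarrow> D11 [I] J"
  by (auto simp: D11_def)

lemma dga_hom_word_prod:
  assumes A: "dgca A" and B: "dgca B" and h: "dga_hom A B h" and w: "w \<in> sym_words A n"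
  shows "h n (word_prod A w) = word_prod B (map (\<lambda>(m, a). (m, h m a)) w)"
  using w
proof (induction w arbitrary: n)
  interpret A: dgca_space A by (rule dgca_space.intro[OF A])
  interpret B: dgca_space B by (rule dgca_space.intro[OF B])
  {
    case Nil
    then show ?case using B.dga_homD(2)[OF h] by simp
  next
    case (Cons a w)
    obtain m x where a: "a = (m, x)" by (cases a)
    have x: "x \<in> carrier (Comp A m)" and w: "w \<in> sym_words A (n - m)"
      using Cons.prems a by simp_all
    have "wdeg (map (\<lambda>(m, a). (m, h m a)) w) = wdeg w"
      by (simp add: wdeg_def o_def split_beta)
    then show ?case
      using B.dga_homD(3)[OF h x A.word_prod_closed[OF w]] Cons.IH[OF w] sym_words_wdeg[OF w] by (simp add: a)
  }
qed

lemma permute_list_tensor_words: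
  assumes w: "w \<in> tensor_words (map F Is) n" and \<sigma>: "\<sigma> permutes {..<length Is}"
  shows "permute_list \<sigma> w \<in> tensor_words (map F (permute_list \<sigma> Is)) n"
proof -
  have len: "length w = length Is"
    using tensor_words_length[OF w] by simp
  have "wdeg (permute_list \<sigma> w) = wdeg w"
    using \<sigma> by (simp add: wdeg_def mset_permute_list len flip: sum_mset_sum_list)
  moreover have "snd (permute_list \<sigma> w ! i) \<in> carrier (Comp (F (permute_list \<sigma> Is ! i)) (fst (permute_list \<sigma> w ! i)))"
    if "i < length Is" for i
    using permutes_in_image[OF \<sigma>, of i] tensor_words_nth[OF w, of "\<sigma> i"] that
    by (simp add: permute_list_nth \<sigma> len)
  ultimately show ?thesis
    using w by (simp add: tensor_words_def list_all2_conv_all_nth split_beta)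
qed

text \<open>A functor from intervals, ordered by inclusion, to differential graded commutative
  algebras. Multiplication makes it an algebra over the operad: the operation pushes each input
  forward by \<open>f\<close> and multiplies. The function \<open>g\<close> is this operation on
  words, in whatever form the operation at hand was defined.\<close>

locale D11_functor =
  fixes F :: "ival \<Rightarrow> ('k::field,'v) dga" and f :: "ival \<Rightarrow> ival \<Rightarrow> int \<Rightarrow> 'v \<Rightarrow> 'v"
    and g :: "ival list \<Rightarrow> ival \<Rightarrow> 'v word \<Rightarrow> 'v"
    and \<mu> :: "ival list \<Rightarrow> ival \<Rightarrow> int \<Rightarrow> ('v word \<Rightarrow>\<^sub>0 'k) set \<Rightarrow> 'v"
  assumes F: "\<And>I. color I \<Longrightarrow> dgca (F I)"
    and f: "\<And>I J. D11 [I] J \<Longrightarrow> dga_hom (F I) (F J) (f I J)"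
    and f_id: "\<And>I n a. color I \<Longrightarrow> a \<in> carrier (Comp (F I) n) \<Longrightarrow> f I I n a = a"
    and f_comp: "\<And>I J K n a. D11 [I] J \<Longrightarrow> D11 [J] K \<Longrightarrow> a \<in> carrier (Comp (F I) n) \<Longrightarrow>
      f J K n (f I J n a) = f I K n a"
    and g: "\<And>Is J n w. w \<in> tensor_words (map F Is) n \<Longrightarrow> g Is J w = word_prod (F J) (tens (map (\<lambda>I. f I J) Is) w)"
    and \<mu>: "\<And>Is J. \<mu> Is J = tensor_ext (F J) (g Is J)"
begin

lemma homs_restrict:
  assumes "color J" "\<And>I. I \<in> set Is \<Longrightarrow> D11 [I] J"
  shows "dgca_space.homs (F J) (map F Is) (map (\<lambda>I. f I J) Is)"
  using assms F f by (auto simp: dgca_space.homs_def[OF dgca_space.intro[OF F[OF assms(1)]]] list_all2_conv_all_nth D11_single)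

text \<open>The conditions for units, compositions and permutations are stated on elementary
  tensors, so with this formula they become identities between products in one algebra
  \<open>F J\<close>.\<close>

lemma \<mu>_elem:
  assumes "color J" "\<And>I. I \<in> set Is \<Longrightarrow> D11 [I] J" "w \<in> tensor_words (map F Is) n"
  shows "\<mu> Is J n (elem_tensor (map F Is) w) = word_prod (F J) (tens (map (\<lambda>I. f I J) Is) w)"
  unfolding \<mu>
  by (rule dgca_space.tensor_ext_elem[OF dgca_space.intro[OF F[OF assms(1)]] homs_restrict g]) (use assms in auto)

text \<open>\<open>W\<close> is the word of results of the inner operations. Since
  \<open>f J K\<close> is multiplicative and \<open>f\<close> is functorial, pushing such a result
  to \<open>K\<close> gives the product of the original letters pushed to \<open>K\<close> directly;
  associativity then joins the blocks. Membership of both words rides along in the same induction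
  because each step needs their degrees.\<close>

lemma composite_word:
  assumes "color K" "list_all2 D11 Iss Js" "\<forall>J\<in>set Js. D11 [J] K"
    "list_all2 (\<lambda>Is w. w \<in> tensor_words (map F Is) (wdeg w)) Iss ws"
  defines "W \<equiv> \<lambda>Iss Js ws. map (\<lambda>i. (wdeg (ws ! i), word_prod (F (Js ! i)) (tens (map (\<lambda>I. f I (Js ! i)) (Iss ! i)) (ws ! i)))) [0..<length Js]"
  shows "W Iss Js ws \<in> tensor_words (map F Js) (wdeg (concat ws)) \<and>
    concat ws \<in> tensor_words (map F (concat Iss)) (wdeg (concat ws)) \<and>
    (\<forall>I\<in>set (concat Iss). D11 [I] K) \<and>
    word_prod (F K) (tens (map (\<lambda>J. f J K) Js) (W Iss Js ws)) =
    word_prod (F K) (tens (map (\<lambda>I. f I K) (concat Iss)) (concat ws))"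
  using assms(2-4)
proof (induction Iss Js arbitrary: ws rule: list_all2_induct)
  case Nil
  then show ?case by (simp add: W_def)
next
  case (Cons Is Iss J Js)
  interpret K: dgca_space "F K" by (rule dgca_space.intro[OF F[OF assms(1)]])
  obtain w ws' where ws: "ws = w # ws'" and w: "w \<in> tensor_words (map F Is) (wdeg w)"
    and ws': "list_all2 (\<lambda>Is w. w \<in> tensor_words (map F Is) (wdeg w)) Iss ws'"
    using Cons.prems(2) by (auto simp: list_all2_Cons1)
  have J: "D11 [J] K" "color J" using Cons.prems(1) by (simp_all add: D11_single)
  interpret J: dgca_space "F J" by (rule dgca_space.intro[OF F[OF J(2)]])
  have IsJ: "\<And>I. I \<in> set Is \<Longrightarrow> D11 [I] J" using D11_member[OF Cons.hyps(1)] .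
  then have IsK: "\<And>I. I \<in> set Is \<Longrightarrow> D11 [I] K" using J by (auto simp: D11_single)
  have "\<forall>J\<in>set Js. D11 [J] K" using Cons.prems(1) by simp
  note IH = Cons.IH[OF this ws']
  have Wc: "W (Is # Iss) (J # Js) ws = (wdeg w, word_prod (F J) (tens (map (\<lambda>I. f I J) Is) w)) # W Iss Js ws'"
    by (simp add: W_def ws upt_conv_Cons map_Suc_upt[symmetric] o_def del: upt_Suc)
  note hJ = homs_restrict[OF J(2) IsJ] and hK = homs_restrict[OF assms(1) IsK]
  note tJ = J.tens_closed[OF hJ w] and tK = K.tens_closed[OF hK w]
  have len: "length w = length Is" using tensor_words_length[OF w] by simp
  have eq: "f J K (wdeg w) (word_prod (F J) (tens (map (\<lambda>I. f I J) Is) w)) = word_prod (F K) (tens (map (\<lambda>I. f I K) Is) w)"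
  proof -
    have "map (\<lambda>(m, a). (m, f J K m a)) (tens (map (\<lambda>I. f I J) Is) w) = tens (map (\<lambda>I. f I K) Is) w"
    proof (rule nth_equalityI)
      fix i assume "i < length (map (\<lambda>(m, a). (m, f J K m a)) (tens (map (\<lambda>I. f I J) Is) w))"
      then show "map (\<lambda>(m, a). (m, f J K m a)) (tens (map (\<lambda>I. f I J) Is) w) ! i = tens (map (\<lambda>I. f I K) Is) w ! i"
        using tensor_words_nth[OF w, of i] len f_comp[OF IsJ J(1)] by (simp add: nth_tens)
    qed simp
    then show ?thesis
      using dga_hom_word_prod[OF F F f[OF J(1)] tJ] J(2) assms(1) by simp
  qed
  have cJ: "word_prod (F J) (tens (map (\<lambda>I. f I J) Is) w) \<in> carrier (Comp (F J) (wdeg w))"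
    by (rule J.word_prod_closed[OF tJ])
  have 1: "W (Is # Iss) (J # Js) ws \<in> tensor_words (map F (J # Js)) (wdeg (concat ws))"
    unfolding Wc using IH cJ by (simp add: ws)
  have 2: "concat ws \<in> tensor_words (map F (concat (Is # Iss))) (wdeg (concat ws))"
    using w IH by (simp add: ws tensor_words_def list_all2_appendI)
  have 3: "\<forall>I\<in>set (concat (Is # Iss)). D11 [I] K"
    using IH IsK by auto
  have hK': "dgca_space.homs (F K) (map F (concat Iss)) (map (\<lambda>I. f I K) (concat Iss))"
    by (rule homs_restrict[OF assms(1)]) (use IH in auto)
  have hKJ: "dgca_space.homs (F K) (map F Js) (map (\<lambda>J. f J K) Js)"
    by (rule homs_restrict[OF assms(1)]) (use Cons.prems(1) in auto)
  have "word_prod (F K) (tens (map (\<lambda>J. f J K) (J # Js)) (W (Is # Iss) (J # Js) ws)) =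
      Mult (F K) (wdeg w) (wdeg (concat ws')) (word_prod (F K) (tens (map (\<lambda>I. f I K) Is) w))
        (word_prod (F K) (tens (map (\<lambda>I. f I K) (concat Iss)) (concat ws')))"
    unfolding Wc using IH sym_words_wdeg[OF K.tens_closed[OF hKJ IH[THEN conjunct1]]] by (simp add: eq)
  also have "\<dots> = word_prod (F K) (tens (map (\<lambda>I. f I K) (concat (Is # Iss))) (concat ws))"
    using K.word_prod_append[OF tK K.tens_closed[OF hK' IH[THEN conjunct2, THEN conjunct1]]] len
    by (simp add: ws tens_append)
  finally show ?case using 1 2 3 by blast
qed

text \<open>Units come from \<open>f_id\<close>, compositions from \<open>composite_word\<close>,
  and permutations from graded commutativity in the form of
  \<open>word_prod_permute\<close>.\<close>

theorem D11_algebra: "D11_algebra_tensor F \<mu>"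
  unfolding D11_algebra_tensor_def
proof (intro conjI allI impI ballI)
  show "dgca (F I)" if "color I" for I by (rule F[OF that])
  show "dga_hom (tensor (map F Is)) (F J) (\<mu> Is J)" if D: "D11 Is J" for Is J
  proof -
    have J: "color J" using D by (simp add: D11_def)
    show ?thesis
      unfolding \<mu>
      by (rule dgca_space.tensor_ext_hom[OF dgca_space.intro[OF F[OF J]] homs_restrict[OF J D11_member[OF D]] g])
  qed
  show "\<mu> [I] I n (elem_tensor [F I] [(n, a)]) = a" if I: "color I" and a: "a \<in> carrier (Comp (F I) n)" for I n a
  proof -
    interpret dgca_space "F I" by (rule dgca_space.intro[OF F[OF I]])
    show ?thesis
      using \<mu>_elem[OF I, of "[I]" "[(n, a)]" n] I a by (simp add: D11_single f_id Mult_Unit)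
  qed
  show "\<mu> Js K (wdeg (concat ws)) (elem_tensor (map F Js)
          (map (\<lambda>i. (wdeg (ws ! i), \<mu> (Iss ! i) (Js ! i) (wdeg (ws ! i)) (elem_tensor (map F (Iss ! i)) (ws ! i)))) [0..<length Js])) =
        \<mu> (concat Iss) K (wdeg (concat ws)) (elem_tensor (map F (concat Iss)) (concat ws))"
    if "D11 Js K \<and> list_all2 D11 Iss Js \<and> list_all2 (\<lambda>Is w. w \<in> tensor_words (map F Is) (wdeg w)) Iss ws"
    for Iss Js K ws
  proof -
    have K: "color K" "\<forall>J\<in>set Js. D11 [J] K" and l: "list_all2 D11 Iss Js"
      and w: "list_all2 (\<lambda>Is w. w \<in> tensor_words (map F Is) (wdeg w)) Iss ws"
      using that D11_member by (auto simp: D11_def)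
    note C = composite_word[OF K(1) l K(2) w]
    have e: "map (\<lambda>i. (wdeg (ws ! i), \<mu> (Iss ! i) (Js ! i) (wdeg (ws ! i)) (elem_tensor (map F (Iss ! i)) (ws ! i)))) [0..<length Js] =
      map (\<lambda>i. (wdeg (ws ! i), word_prod (F (Js ! i)) (tens (map (\<lambda>I. f I (Js ! i)) (Iss ! i)) (ws ! i)))) [0..<length Js]"
    proof (rule map_cong[OF refl])
      fix i assume "i \<in> set [0..<length Js]"
      then have i: "i < length Js" by simp
      have D: "D11 (Iss ! i) (Js ! i)" using l i by (simp add: list_all2_conv_all_nth)
      then have "color (Js ! i)" by (simp add: D11_def)
      moreover have "ws ! i \<in> tensor_words (map F (Iss ! i)) (wdeg (ws ! i))"
        using w l i by (simp add: list_all2_conv_all_nth)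
      ultimately show "(wdeg (ws ! i), \<mu> (Iss ! i) (Js ! i) (wdeg (ws ! i)) (elem_tensor (map F (Iss ! i)) (ws ! i))) =
        (wdeg (ws ! i), word_prod (F (Js ! i)) (tens (map (\<lambda>I. f I (Js ! i)) (Iss ! i)) (ws ! i)))"
        using \<mu>_elem D11_member[OF D] by simp
    qed
    have K': "\<And>J. J \<in> set Js \<Longrightarrow> D11 [J] K" "\<And>I. I \<in> set (concat Iss) \<Longrightarrow> D11 [I] K"
      using C K(2) by blast+
    note E1 = \<mu>_elem[where Is = Js, OF K(1) K'(1) C[THEN conjunct1]]
    note E2 = \<mu>_elem[where Is = "concat Iss", OF K(1) K'(2) C[THEN conjunct2, THEN conjunct1]]
    show ?thesis
      unfolding e using E1 E2 C by (simp only:)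
  qed
  show "\<mu> (permute_list \<sigma> Is) J n (elem_tensor (map F (permute_list \<sigma> Is)) (permute_list \<sigma> w)) =
        koszul \<sigma> w \<odot>\<^bsub>Comp (F J) n\<^esub> \<mu> Is J n (elem_tensor (map F Is) w)"
    if "D11 Is J \<and> \<sigma> permutes {..<length Is} \<and> w \<in> tensor_words (map F Is) n" for Is J \<sigma> n w
  proof -
    have D: "D11 Is J" and \<sigma>: "\<sigma> permutes {..<length Is}" and w: "w \<in> tensor_words (map F Is) n"
      using that by auto
    have J: "color J" using D by (simp add: D11_def)
    interpret dgca_space "F J" by (rule dgca_space.intro[OF F[OF J]])
    have D': "D11 [I] J" if "I \<in> set (permute_list \<sigma> Is)" for I
      using that D11_member[OF D] \<sigma> by simp
    have len: "length w = length Is"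
      using tensor_words_length[OF w] by simp
    let ?t = "tens (map (\<lambda>I. f I J) Is) w"
    have t: "?t \<in> sym_words (F J) n"
      by (rule tens_closed[OF homs_restrict[OF J D11_member[OF D]] w])
    have \<sigma>i: "\<sigma> i < length Is" if "i < length Is" for i
      using permutes_in_image[OF \<sigma>, of i] that by simp
    have "tens (map (\<lambda>I. f I J) (permute_list \<sigma> Is)) (permute_list \<sigma> w) = permute_list \<sigma> ?t"
      by (rule nth_equalityI) (simp_all add: len \<sigma> \<sigma>i nth_tens permute_list_nth)
    \<comment> \<open>The structure maps preserve degrees, and the Koszul sign depends on the
      degrees only.\<close>
    moreover have "koszul \<sigma> ?t = (koszul \<sigma> w :: 'k)"
      unfolding koszul_def
      by (rule prod.cong) (auto simp: len nth_tens \<sigma>i)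
    ultimately show ?thesis
      using \<mu>_elem[OF J D' permute_list_tensor_words[OF w \<sigma>]] \<mu>_elem[OF J D11_member[OF D] w]
        word_prod_permute[OF t] \<sigma> len by simp
  qed
qed

end

text \<open>\<open>\<Phi>\<close> is multiplicative, so it passes inside the product in
  \<open>F J\<close>; naturality then exchanges it with the structure map on each letter.\<close>

lemma D11_functor_compatible:
  assumes "D11_functor F f g \<mu>" "D11_functor G f' g' \<nu>"
    and \<Phi>: "\<And>I. color I \<Longrightarrow> dga_hom (F I) (G I) (\<Phi> I)"
    and natural: "\<And>I J n a. D11 [I] J \<Longrightarrow> a \<in> carrier (Comp (F I) n) \<Longrightarrow> \<Phi> J n (f I J n a) = f' I J n (\<Phi> I n a)"
  shows "compatible_with_operations F \<mu> G \<nu> \<Phi>"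
  unfolding compatible_with_operations_def
proof (intro allI impI)
  fix Is J n w
  assume *: "D11 Is J \<and> w \<in> tensor_words (map F Is) n"
  interpret F: D11_functor F f g \<mu> by fact
  interpret G: D11_functor G f' g' \<nu> by fact
  have D: "D11 Is J" and w: "w \<in> tensor_words (map F Is) n" and J: "color J"
    using * by (auto simp: D11_def)
  interpret FJ: dgca_space "F J" by (rule dgca_space.intro[OF F.F[OF J]])
  interpret GJ: dgca_space "G J" by (rule dgca_space.intro[OF G.F[OF J]])
  have len: "length w = length Is"
    using tensor_words_length[OF w] by simp
  let ?w = "map2 (\<lambda>I (m, a). (m, \<Phi> I m a)) Is w"
  have c: "color I" if "I \<in> set Is" for I
    using D that by (auto simp: D11_def)
  have a: "snd (w ! i) \<in> carrier (Comp (F (Is ! i)) (fst (w ! i)))" if "i < length Is" for i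
    using tensor_words_nth[OF w, of i] that by simp
  have "wdeg ?w = wdeg w"
    using len unfolding wdeg_def
    by (intro arg_cong[of _ _ sum_list] nth_equalityI) (simp_all add: split_beta)
  then have w': "?w \<in> tensor_words (map G Is) n"
    using w a len GJ.dga_homD(4)[of "F J"] dgca_space.dga_homD(4)[OF dgca_space.intro[OF G.F] \<Phi>] c
    by (simp add: tensor_words_def list_all2_conv_all_nth split_beta)
  have "map (\<lambda>(m, a). (m, \<Phi> J m a)) (tens (map (\<lambda>I. f I J) Is) w) = tens (map (\<lambda>I. f' I J) Is) ?w"
    using len a natural D11_member[OF D] by (intro nth_equalityI) (simp_all add: nth_tens split_beta)
  then have "\<Phi> J n (word_prod (F J) (tens (map (\<lambda>I. f I J) Is) w)) = word_prod (G J) (tens (map (\<lambda>I. f' I J) Is) ?w)"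
    using dga_hom_word_prod[OF F.F[OF J] G.F[OF J] \<Phi>[OF J] FJ.tens_closed[OF F.homs_restrict[OF J D11_member[OF D]] w]]
    by simp
  then show "\<Phi> J n (\<mu> Is J n (elem_tensor (map F Is) w)) = \<nu> Is J n (elem_tensor (map G Is) ?w)"
    using F.\<mu>_elem[OF J D11_member[OF D] w] G.\<mu>_elem[OF J D11_member[OF D] w'] by simp
qed


section \<open>The operator \<open>Q\<close>\<close>

context
  fixes \<alpha> :: "'k::field_char_0"
  assumes \<alpha>: "\<alpha> \<noteq> 0"
begin

lemma Bfun_minus: "Bfun \<alpha> (- x) = - Bfun \<alpha> x"
  by (simp add: Bfun_def sgn_minus)

lemma Bfun_nat: "Bfun \<alpha> (int n) = (\<Sum>k<n. \<alpha> powi (int n - 1 - 2 * int k))"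
  by (cases "n = 0") (simp_all add: Bfun_def)

lemma Bfun_0 [simp]: "Bfun \<alpha> 0 = 0"
  by (simp add: Bfun_def)

lemma Bfun_1 [simp]: "Bfun \<alpha> 1 = 1"
  using Bfun_nat[of 1] by simp

lemma Afun_0 [simp]: "Afun \<alpha> 0 = 1"
  by (simp add: Afun_def)

lemma powi_add_one: "\<alpha> powi (x + 1) = \<alpha> * \<alpha> powi x" "\<alpha> powi (x - 1) = inverse \<alpha> * \<alpha> powi x"
  using \<alpha> by (simp_all add: power_int_add power_int_diff field_simps)

text \<open>The sum of powers with its first, respectively last, term split off. Working with these
  recurrences rather than with a quotient covers the case \<open>\<alpha> = inverse \<alpha>\<close>
  as well.\<close>

lemma Bfun_nat_Suc:
  "Bfun \<alpha> (int n + 1) = \<alpha> powi int n + inverse \<alpha> * Bfun \<alpha> (int n)"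
  "Bfun \<alpha> (int n + 1) = \<alpha> * Bfun \<alpha> (int n) + \<alpha> powi (- int n)"
proof -
  have "Bfun \<alpha> (int n + 1) = (\<Sum>k<Suc n. \<alpha> powi (int n - 2 * int k))"
    using Bfun_nat[of "Suc n"] by (simp add: add.commute)
  also have "\<dots> = \<alpha> powi int n + (\<Sum>k<n. inverse \<alpha> * \<alpha> powi (int n - 1 - 2 * int k))"
    by (subst sum.lessThan_Suc_shift) (simp add: algebra_simps flip: powi_add_one)
  finally show "Bfun \<alpha> (int n + 1) = \<alpha> powi int n + inverse \<alpha> * Bfun \<alpha> (int n)"
    by (simp add: Bfun_nat sum_distrib_left)
  have "Bfun \<alpha> (int n + 1) = (\<Sum>k<Suc n. \<alpha> powi (int n - 2 * int k))"
    using Bfun_nat[of "Suc n"] by (simp add: add.commute)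
  also have "\<dots> = (\<Sum>k<n. \<alpha> * \<alpha> powi (int n - 1 - 2 * int k)) + \<alpha> powi (- int n)"
    by (simp add: algebra_simps flip: powi_add_one)
  finally show "Bfun \<alpha> (int n + 1) = \<alpha> * Bfun \<alpha> (int n) + \<alpha> powi (- int n)"
    by (simp add: Bfun_nat sum_distrib_left)
qed

text \<open>For negative \<open>x\<close> oddness of \<open>B\<close> exchanges the two recurrences:
  each follows at \<open>- (n + 1)\<close> from the other one at \<open>n\<close>.\<close>

lemma Bfun_add_one:
  "Bfun \<alpha> (x + 1) = \<alpha> powi x + inverse \<alpha> * Bfun \<alpha> x"
  "Bfun \<alpha> (x + 1) = \<alpha> * Bfun \<alpha> x + \<alpha> powi (- x)"
proof -
  have "Bfun \<alpha> (x + 1) = \<alpha> powi x + inverse \<alpha> * Bfun \<alpha> x \<and> Bfun \<alpha> (x + 1) = \<alpha> * Bfun \<alpha> x + \<alpha> powi (- x)"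
  proof (cases "x \<ge> 0")
    case True
    then show ?thesis using Bfun_nat_Suc[of "nat x"] by simp
  next
    case False
    define n where "n = nat (- x - 1)"
    have x: "x = - (int n + 1)" using False by (simp add: n_def)
    have p: "\<alpha> powi (- (int n + 1)) = inverse \<alpha> * \<alpha> powi (- int n)" "\<alpha> powi (int n + 1) = \<alpha> * \<alpha> powi (int n)"
      using powi_add_one(2)[of "- int n"] powi_add_one(1)[of "int n"] by simp_all
    have m: "Bfun \<alpha> x = - Bfun \<alpha> (int n + 1)" "Bfun \<alpha> (x + 1) = - Bfun \<alpha> (int n)"
      using Bfun_minus[of "int n + 1"] Bfun_minus[of "int n"] by (simp_all add: x)
    have "Bfun \<alpha> (x + 1) = \<alpha> powi x + inverse \<alpha> * Bfun \<alpha> x"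
      unfolding m unfolding x p Bfun_nat_Suc(2) using \<alpha> by (simp add: field_simps)
    moreover have "Bfun \<alpha> (x + 1) = \<alpha> * Bfun \<alpha> x + \<alpha> powi (- x)"
      unfolding m unfolding x minus_minus p Bfun_nat_Suc(1) using \<alpha> by (simp add: field_simps)
    ultimately show ?thesis by simp
  qed
  then show "Bfun \<alpha> (x + 1) = \<alpha> powi x + inverse \<alpha> * Bfun \<alpha> x"
    "Bfun \<alpha> (x + 1) = \<alpha> * Bfun \<alpha> x + \<alpha> powi (- x)" by blast+
qed

lemma Bfun_minus_one:
  "Bfun \<alpha> (x - 1) = \<alpha> * Bfun \<alpha> x - \<alpha> powi x"
  "Bfun \<alpha> (x - 1) = inverse \<alpha> * Bfun \<alpha> x - \<alpha> powi (- x)"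
  using Bfun_add_one(1)[of "x - 1"] Bfun_add_one(2)[of "x - 1"] powi_add_one(2)[of x] powi_add_one(1)[of "- x"] \<alpha>
  by (simp_all add: field_simps)

lemma Q_Afun: "Q \<alpha> (Afun \<alpha>) x = 0"
proof -
  have "\<alpha> powi (- (x - 1)) = \<alpha> * \<alpha> powi (- x)" "\<alpha> powi (- (x + 1)) = inverse \<alpha> * \<alpha> powi (- x)"
    using powi_add_one[of "- x"] by simp_all
  then show ?thesis
    unfolding Q_def Afun_def powi_add_one by (simp add: algebra_simps add_divide_distrib)
qed

text \<open>The forward and the backward recurrence contribute the power of \<open>\<alpha>\<close>
  with opposite signs, and the coefficients of \<open>B x\<close> add up to
  \<open>\<alpha> + inverse \<alpha>\<close>.\<close>

lemma Q_Bfun: "Q \<alpha> (Bfun \<alpha>) x = 0"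
  unfolding Q_def Bfun_add_one(1) Bfun_minus_one(1) by (simp add: algebra_simps)

text \<open>The outer coefficients of \<open>Q\<close> are 1, so the recurrence can be run in both
  directions from two adjacent zeros.\<close>

lemma recurrence_unique:
  fixes h :: "int \<Rightarrow> 'k"
  assumes Q: "\<And>x. Q \<alpha> h x = 0" and "h a = 0" "h (a + 1) = 0"
  shows "h x = 0"
proof -
  have up: "h (a + int n) = 0 \<and> h (a + int n + 1) = 0" for n
  proof (induction n)
    case (Suc n)
    then show ?case using Q[of "a + int n + 1"] by (simp add: Q_def algebra_simps)
  qed (simp add: assms)
  have down: "h (a - int n) = 0 \<and> h (a - int n + 1) = 0" for n
  proof (induction n)
    case (Suc n)
    then show ?case using Q[of "a - int n"] by (simp add: Q_def algebra_simps)
  qed (simp add: assms)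
  show ?thesis
    using up[of "nat (x - a)"] down[of "nat (a - x)"] by (cases "a \<le> x") simp_all
qed

text \<open>For fixed \<open>y\<close> both sides are in the kernel of \<open>Q\<close> as functions
  of \<open>x\<close>, so it suffices to compare them at 0 and 1. At 0 this is oddness of
  \<open>B\<close>; at 1 it is \<open>one\<close>, the mean of the two backward recurrences. The
  case \<open>x = y + 1\<close> says that the determinant of \<open>A\<close> and \<open>B\<close>
  at adjacent points is 1.\<close>

lemma Bfun_diff: "Bfun \<alpha> (x - y) = Bfun \<alpha> x * Afun \<alpha> y - Afun \<alpha> x * Bfun \<alpha> y"
proof -
  have one: "Bfun \<alpha> (y - 1) = Afun \<alpha> 1 * Bfun \<alpha> y - Afun \<alpha> y"
  proof -
    have "2 * Bfun \<alpha> (y - 1) = (\<alpha> * Bfun \<alpha> y - \<alpha> powi y) + (inverse \<alpha> * Bfun \<alpha> y - \<alpha> powi (- y))"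
      using Bfun_minus_one[of y] by simp
    also have "\<dots> = (2 * Afun \<alpha> 1) * Bfun \<alpha> y - 2 * Afun \<alpha> y"
      by (simp add: Afun_def power_int_minus algebra_simps)
    finally have "2 * Bfun \<alpha> (y - 1) = 2 * (Afun \<alpha> 1 * Bfun \<alpha> y - Afun \<alpha> y)"
      by (simp add: algebra_simps)
    then show ?thesis
      by (subst (asm) mult_left_cancel) simp_all
  qed
  let ?h = "\<lambda>x. Bfun \<alpha> (x - y) - Bfun \<alpha> x * Afun \<alpha> y + Afun \<alpha> x * Bfun \<alpha> y"
  have "?h x = 0"
  proof (rule recurrence_unique[of ?h 0])
    fix x
    have "Q \<alpha> ?h x = Q \<alpha> (Bfun \<alpha>) (x - y) - Q \<alpha> (Bfun \<alpha>) x * Afun \<alpha> y + Q \<alpha> (Afun \<alpha>) x * Bfun \<alpha> y"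
      by (simp add: Q_def algebra_simps)
    then show "Q \<alpha> ?h x = 0" by (simp add: Q_Afun Q_Bfun)
    show "?h 0 = 0" using Bfun_minus[of y] by simp
    show "?h (0 + 1) = 0" using Bfun_minus[of "y - 1"] one by simp
  qed
  then show ?thesis by (simp add: algebra_simps)
qed

text \<open>Summation by parts: \<open>Q\<close> is symmetric for the pairing of functions, and the
  margin of one point at either end keeps all shifted copies of \<open>g\<close> inside the range of
  summation.\<close>

lemma Q_adjoint:
  fixes g :: "int \<Rightarrow> 'k"
  assumes g: "\<And>x. x \<notin> {l + 1..r - 1} \<Longrightarrow> g x = 0" and u: "\<And>x. Q \<alpha> u x = 0"
  shows "(\<Sum>x\<in>{l..r}. Q \<alpha> g x * u x) = 0"
proof -
  have 1: "(\<Sum>x\<in>{l..r}. g (x - 1) * u x) = (\<Sum>y\<in>{l + 1..r - 1}. g y * u (y + 1))"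
  proof -
    have "(\<Sum>x\<in>{l..r}. g (x - 1) * u x) = (\<Sum>y\<in>{l - 1..r - 1}. g y * u (y + 1))"
      by (rule sum.reindex_bij_witness[of _ "\<lambda>y. y + 1" "\<lambda>x. x - 1"]) auto
    also have "\<dots> = (\<Sum>y\<in>{l + 1..r - 1}. g y * u (y + 1))"
      by (rule sum.mono_neutral_right) (use g in auto)
    finally show ?thesis .
  qed
  have 2: "(\<Sum>x\<in>{l..r}. g (x + 1) * u x) = (\<Sum>y\<in>{l + 1..r - 1}. g y * u (y - 1))"
  proof -
    have "(\<Sum>x\<in>{l..r}. g (x + 1) * u x) = (\<Sum>y\<in>{l + 1..r + 1}. g y * u (y - 1))"
      by (rule sum.reindex_bij_witness[of _ "\<lambda>y. y - 1" "\<lambda>x. x + 1"]) auto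
    also have "\<dots> = (\<Sum>y\<in>{l + 1..r - 1}. g y * u (y - 1))"
      by (rule sum.mono_neutral_right) (use g in auto)
    finally show ?thesis .
  qed
  have 3: "(\<Sum>x\<in>{l..r}. g x * u x) = (\<Sum>y\<in>{l + 1..r - 1}. g y * u y)"
    by (rule sum.mono_neutral_right) (use g in auto)
  have "(\<Sum>x\<in>{l..r}. Q \<alpha> g x * u x) =
      (\<Sum>x\<in>{l..r}. g (x - 1) * u x) - (\<alpha> + inverse \<alpha>) * (\<Sum>x\<in>{l..r}. g x * u x) + (\<Sum>x\<in>{l..r}. g (x + 1) * u x)"
    by (simp add: Q_def algebra_simps sum.distrib sum_subtractf sum_distrib_left)
  also have "\<dots> = (\<Sum>y\<in>{l + 1..r - 1}. g y * Q \<alpha> u y)"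
    unfolding 1 2 3 by (simp add: Q_def algebra_simps sum.distrib sum_subtractf sum_distrib_left)
  finally show ?thesis by (simp add: u)
qed

text \<open>The solution of \<open>Q g = f\<close> with initial values zero; the addition formula for \<open>B\<close> shows
  that it vanishes to the right of the support of \<open>f\<close>.\<close>

lemma Q_exact:
  fixes f :: "int \<Rightarrow> 'k"
  assumes f: "\<And>x. x \<notin> {l..r} \<Longrightarrow> f x = 0"
    and fA: "(\<Sum>x\<in>{l..r}. f x * Afun \<alpha> x) = 0" and fB: "(\<Sum>x\<in>{l..r}. f x * Bfun \<alpha> x) = 0"
  shows "\<exists>g. (\<forall>x. x \<notin> {l + 1..r - 1} \<longrightarrow> g x = 0) \<and> Q \<alpha> g = f"
proof -
  define P where "P d = (if d > 0 then Bfun \<alpha> d else 0)" for d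
  define g where "g x = (\<Sum>y\<in>{l..r}. P (x - y) * f y)" for x
  \<comment> \<open>For \<open>d > 0\<close> all three values of \<open>P\<close> agree with
    \<open>B\<close>, at \<open>d = 1\<close> because \<open>B 0 = 0\<close>. At
    \<open>d = 0\<close> only \<open>P 1 = B 1 = 1\<close> survives, which is the delta
    function.\<close>
  have QP: "P (d - 1) - (\<alpha> + inverse \<alpha>) * P d + P (d + 1) = (if d = 0 then 1 else 0)" for d
  proof (cases "d > 0")
    case True
    then have "P (d - 1) = Bfun \<alpha> (d - 1)" "P (d + 1) = Bfun \<alpha> (d + 1)" "P d = Bfun \<alpha> d"
      by (cases "d = 1"; simp add: P_def)+
    then show ?thesis using Q_Bfun[of d] True by (simp add: Q_def)
  next
    case False
    then show ?thesis by (cases "d = 0"; cases "d = -1") (auto simp: P_def)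
  qed
  have "Q \<alpha> g x = f x" for x
  proof -
    have "Q \<alpha> g x = (\<Sum>y\<in>{l..r}. (P (x - y - 1) - (\<alpha> + inverse \<alpha>) * P (x - y) + P (x - y + 1)) * f y)"
      by (simp add: Q_def g_def algebra_simps sum.distrib sum_subtractf sum_distrib_left)
    also have "\<dots> = (\<Sum>y\<in>{l..r}. if y = x then f y else 0)"
      unfolding QP by (rule sum.cong) auto
    also have "\<dots> = f x"
      using f[of x] by (simp add: sum.delta')
    finally show ?thesis .
  qed
  moreover have "g x = 0" if "x \<notin> {l + 1..r - 1}" for x
  proof (cases "x \<le> l")
    case True
    then show ?thesis
      unfolding g_def by (intro sum.neutral) (auto simp: P_def)
  next
    case False
    then have "r \<le> x" using that by auto
    \<comment> \<open>For \<open>y = x\<close> the cutoff sets \<open>P\<close> to zero, and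
      \<open>B 0 = 0\<close> as well. This includes the point \<open>x = r\<close>, so
      \<open>g\<close> vanishes already there and not only beyond.\<close>
    then have PB: "P (x - y) = Bfun \<alpha> (x - y)" if "y \<in> {l..r}" for y
      using that by (cases "y = x") (auto simp: P_def)
    have "P (x - y) * f y = Bfun \<alpha> x * (f y * Afun \<alpha> y) - Afun \<alpha> x * (f y * Bfun \<alpha> y)" if "y \<in> {l..r}" for y
      unfolding PB[OF that] Bfun_diff by (simp add: algebra_simps)
    then have "g x = (\<Sum>y\<in>{l..r}. Bfun \<alpha> x * (f y * Afun \<alpha> y) - Afun \<alpha> x * (f y * Bfun \<alpha> y))"
      unfolding g_def by (intro sum.cong refl)
    also have "\<dots> = 0"
      by (simp add: sum_subtractf fA fB flip: sum_distrib_left)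
    finally show ?thesis .
  qed
  ultimately show ?thesis by blast
qed

end

text \<open>Length greater than 2 guarantees two integers in the open interval, hence the strict
  inequality: the functions dual to \<open>A\<close> and \<open>B\<close> live on two adjacent
  points. Shrinking the interval by 1 at both ends removes just its extreme integers.\<close>

lemma integer_interval:
  assumes "color I"
  obtains l r where "l < r"
    "{x. fst I < real_of_int x \<and> real_of_int x < snd I} = {l..r}"
    "{x. fst I + 1 < real_of_int x \<and> real_of_int x < snd I - 1} = {l + 1..r - 1}"
proof
  let ?l = "\<lfloor>fst I\<rfloor> + 1" and ?r = "\<lceil>snd I\<rceil> - 1"
  show "?l < ?r"
    using assms unfolding color_def by linarith
  show "{x. fst I < real_of_int x \<and> real_of_int x < snd I} = {?l..?r}"
    by (auto; linarith)
  show "{x. fst I + 1 < real_of_int x \<and> real_of_int x < snd I - 1} = {?l + 1..?r - 1}"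
    by (auto; linarith)
qed

section \<open>The complexes \<open>VV\<close>\<close>

lemma Map_simps [simp]:
  "carrier (Map S) = {f. \<forall>x. x \<notin> S \<longrightarrow> f x = 0}" "zero (Map S) = (\<lambda>_. 0)"
  "add (Map S) = (\<lambda>f g x. f x + g x)" "smult (Map S) = (\<lambda>c f x. c * f x)"
  by (simp_all add: Map_def)

lemma module_Map: "module scalars (Map S)"
  by (rule vector_spaceI) (simp_all add: algebra_simps)

lemma VV_simps [simp]:
  "Comp (VV \<alpha> I) (- 1) = Map {x. fst I + 1 < real_of_int x \<and> real_of_int x < snd I - 1}"
  "Comp (VV \<alpha> I) 0 = Map {x. fst I < real_of_int x \<and> real_of_int x < snd I}"
  "n \<noteq> - 1 \<Longrightarrow> n \<noteq> 0 \<Longrightarrow> Comp (VV \<alpha> I) n = Map {}"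
  "Diff (VV \<alpha> I) (- 1) = Q \<alpha>" "n \<noteq> - 1 \<Longrightarrow> Diff (VV \<alpha> I) n f = (\<lambda>_. 0)"
  by (simp_all add: VV_def)

lemma VV_ops [simp]:
  "zero (Comp (VV \<alpha> I) n) = (\<lambda>_. 0)" "add (Comp (VV \<alpha> I) n) = (\<lambda>f g x. f x + g x)"
  "smult (Comp (VV \<alpha> I) n) = (\<lambda>c f x. c * f x)"
  by (simp_all add: VV_def)

lemma module_VV: "module scalars (Comp (VV \<alpha> I) n)"
  by (simp add: VV_def module_Map)

lemma minus_VV:
  assumes "f \<in> carrier (Comp (VV \<alpha> I) n)" "g \<in> carrier (Comp (VV \<alpha> I) n)"
  shows "f \<ominus>\<^bsub>Comp (VV \<alpha> I) n\<^esub> g = (\<lambda>x. f x - g x)"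
  using minus_one_smult[OF module_VV assms(2)] by (simp only: a_minus_def VV_ops) (metis (no_types, lifting) diff_conv_add_uminus mult_minus1)

lemma Q_linear:
  "Q \<alpha> (\<lambda>x. f x + g x) = (\<lambda>x. Q \<alpha> f x + Q \<alpha> g x)" "Q \<alpha> (\<lambda>x. c * f x) = (\<lambda>x. c * Q \<alpha> f x)"
  "Q \<alpha> (\<lambda>x. f x - g x) = (\<lambda>x. Q \<alpha> f x - Q \<alpha> g x)" "Q \<alpha> (\<lambda>_. 0) = (\<lambda>_. 0)"
  by (auto simp: Q_def algebra_simps)

lemma VV_carrier_cases:
  assumes "f \<in> carrier (Comp (VV \<alpha> I) n)"
  obtains "n = - 1" | "n = 0" | "n \<noteq> - 1" "n \<noteq> 0" "f = (\<lambda>_. 0)"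
  using assms by (cases "n = - 1"; cases "n = 0") auto

lemma cochain_complex_VV: "cochain_complex (VV \<alpha> I)"
  unfolding cochain_complex_def
proof (intro conjI allI ballI module_VV)
  fix n
  show "linear_map (Comp (VV \<alpha> I) n) (Comp (VV \<alpha> I) (n + 1)) (Diff (VV \<alpha> I) n)"
  proof (cases "n = - 1")
    case True
    have "Q \<alpha> f x = 0" if "\<And>x. \<not> (fst I + 1 < real_of_int x \<and> real_of_int x < snd I - 1) \<Longrightarrow> f x = 0"
      "\<not> (fst I < real_of_int x \<and> real_of_int x < snd I)" for f x
      using that(2) by (simp add: Q_def, subst (1 2 3) that(1)) auto
    then show ?thesis
      using True by (intro linear_mapI) (auto simp: Q_linear)
  next
    case False
    then show ?thesis by (intro linear_mapI) (auto simp: VV_def)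
  qed
  show "Diff (VV \<alpha> I) (n + 1) (Diff (VV \<alpha> I) n f) = \<zero>\<^bsub>Comp (VV \<alpha> I) (n + 2)\<^esub>"
    if "f \<in> carrier (Comp (VV \<alpha> I) n)" for f
    by (cases "n = - 1"; cases "n = - 2") (simp_all add: Q_linear)
qed

text \<open>Everything about \<open>I\<close> is expressed by its least and greatest integers, so
  that the pairings become sums over \<open>{l..r}\<close>.\<close>

locale interval =
  fixes \<alpha> :: "'k::field_char_0" and I :: ival and l r :: int
  assumes \<alpha>: "\<alpha> \<noteq> 0" and lr: "l < r"
    and S0: "{x. fst I < real_of_int x \<and> real_of_int x < snd I} = {l..r}"
    and S1: "{x. fst I + 1 < real_of_int x \<and> real_of_int x < snd I - 1} = {l + 1..r - 1}"
begin

definition evA :: "(int \<Rightarrow> 'k) \<Rightarrow> 'k" where "evA f = (\<Sum>x\<in>{l..r}. f x * Afun \<alpha> x)"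
definition evB :: "(int \<Rightarrow> 'k) \<Rightarrow> 'k" where "evB f = (\<Sum>x\<in>{l..r}. f x * Bfun \<alpha> x)"

abbreviation V where "V \<equiv> VV \<alpha> I"

lemma V0: "carrier (Comp V 0) = {f. \<forall>x. x \<notin> {l..r} \<longrightarrow> f x = 0}"
  and V1: "carrier (Comp V (- 1)) = {f. \<forall>x. x \<notin> {l + 1..r - 1} \<longrightarrow> f x = 0}"
  by (simp_all add: S0 S1 del: atLeastAtMost_iff)

lemma phi_fun_ev:
  assumes "f \<in> carrier (Comp V 0)"
  shows "phi_fun \<alpha> f = cst (evA f) * qvar + cst (evB f) * pvar"
proof -
  have "f x = 0" if "x \<notin> {l..r}" for x
    using assms that unfolding V0 by blast
  then have "{x. f x * u x \<noteq> 0} \<subseteq> {l..r}" for u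
    by (metis (mono_tags, lifting) mem_Collect_eq mult_zero_left subsetI)
  then have "Sum_any (\<lambda>x. f x * u x) = (\<Sum>x\<in>{l..r}. f x * u x)" for u
    by (intro Sum_any.expand_superset) simp_all
  then show ?thesis by (simp add: phi_fun_def evA_def evB_def)
qed

lemma ev_linear:
  "evA (\<lambda>x. f x + g x) = evA f + evA g" "evB (\<lambda>x. f x + g x) = evB f + evB g"
  "evA (\<lambda>x. f x - g x) = evA f - evA g" "evB (\<lambda>x. f x - g x) = evB f - evB g"
  "evA (\<lambda>x. c * f x) = c * evA f" "evB (\<lambda>x. c * f x) = c * evB f"
  by (simp_all add: evA_def evB_def algebra_simps sum.distrib sum_subtractf sum_distrib_left)

lemma ev_Q: "g \<in> carrier (Comp V (- 1)) \<Longrightarrow> evA (Q \<alpha> g) = 0" "g \<in> carrier (Comp V (- 1)) \<Longrightarrow> evB (Q \<alpha> g) = 0"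
  unfolding evA_def evB_def V1 by (rule Q_adjoint[OF \<alpha>]; simp add: Q_Afun[OF \<alpha>] Q_Bfun[OF \<alpha>])+

lemma Q_closed: "g \<in> carrier (Comp V (- 1)) \<Longrightarrow> Q \<alpha> g \<in> carrier (Comp V 0)"
  using cochain_complexD(3)[OF cochain_complex_VV, of g \<alpha> I "- 1"] by simp

text \<open>An element of degree -1 vanishes at the adjacent points \<open>l - 1\<close> and
  \<open>l\<close>, from where the recurrence propagates zero everywhere.\<close>

lemma Q_inj:
  assumes "g \<in> carrier (Comp V (- 1))" "Q \<alpha> g = (\<lambda>_. 0)"
  shows "g = (\<lambda>_. 0)"
proof
  have z: "g x = 0" if "x \<notin> {l + 1..r - 1}" for x
    using assms(1) that unfolding V1 by blast
  show "g x = 0" for x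
    by (rule recurrence_unique[OF \<alpha>, of g "l - 1"]) (use assms(2) z in \<open>auto dest: fun_cong\<close>)
qed

text \<open>The solution by Cramer's rule of the two equations "pairing 1 with \<open>A\<close>,
  pairing 0 with \<open>B\<close>" on the points \<open>l\<close> and \<open>l + 1\<close>. The
  determinant is \<open>Bfun \<alpha> 1 = 1\<close> by the addition formula, so no division occurs.
  \<open>fp\<close> solves the system with right-hand sides exchanged.\<close>

definition fq :: "int \<Rightarrow> 'k" where
  "fq x = (if x = l then Bfun \<alpha> (l + 1) else if x = l + 1 then - Bfun \<alpha> l else 0)"

definition fp :: "int \<Rightarrow> 'k" where
  "fp x = (if x = l then - Afun \<alpha> (l + 1) else if x = l + 1 then Afun \<alpha> l else 0)"

lemma fq_closed: "fq \<in> carrier (Comp V 0)" and fp_closed: "fp \<in> carrier (Comp V 0)"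
  using lr by (auto simp: V0 fq_def fp_def simp del: VV_simps)

lemma ev_generators: "evA fq = 1" "evB fq = 0" "evA fp = 0" "evB fp = 1"
proof -
  have two: "(\<Sum>x\<in>{l..r}. f x * u x) = f l * u l + f (l + 1) * u (l + 1)"
    if "\<And>x. x \<noteq> l \<Longrightarrow> x \<noteq> l + 1 \<Longrightarrow> f x = 0" for f u :: "int \<Rightarrow> 'k"
  proof -
    have "(\<Sum>x\<in>{l..r}. f x * u x) = (\<Sum>x\<in>{l, l + 1}. f x * u x)"
      by (rule sum.mono_neutral_right) (use lr that in auto)
    then show ?thesis by simp
  qed
  have "Bfun \<alpha> (l + 1) * Afun \<alpha> l - Afun \<alpha> (l + 1) * Bfun \<alpha> l = 1"
    using Bfun_diff[OF \<alpha>, of "l + 1" l] Bfun_1[OF \<alpha>] by simp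
  then show "evA fq = 1" "evB fq = 0" "evA fp = 0" "evB fp = 1"
    unfolding evA_def evB_def by (subst two; simp add: fq_def fp_def algebra_simps)+
qed

lemma V0_exact:
  assumes "f \<in> carrier (Comp V 0)" "evA f = 0" "evB f = 0"
  shows "\<exists>g\<in>carrier (Comp V (- 1)). Q \<alpha> g = f"
  using Q_exact[OF \<alpha>, of l r f] assms unfolding V0 V1 evA_def evB_def by blast

lemma V0_decompose:
  assumes f: "f \<in> carrier (Comp V 0)"
  shows "\<exists>g\<in>carrier (Comp V (- 1)). f = (\<lambda>x. evA f * fq x + evB f * fp x + Q \<alpha> g x)"
proof -
  let ?h = "\<lambda>x. f x - (evA f * fq x + evB f * fp x)"
  have "?h \<in> carrier (Comp V 0)"
    using f fq_closed fp_closed by simp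
  moreover have "evA ?h = 0" "evB ?h = 0"
    by (simp_all add: ev_linear ev_generators)
  ultimately obtain g where "g \<in> carrier (Comp V (- 1))" "Q \<alpha> g = ?h"
    using V0_exact by blast
  then show ?thesis by (intro bexI[of _ g]) auto
qed

end


section \<open>The polynomial algebra, the isomorphism \<open>phi\<close> and the map
  \<open>Phi\<close>\<close>

lemma cst_simps [simp]:
  "cst 0 = 0" "cst 1 = 1" "cst (a + b) = cst a + cst b" "cst (a * b) = cst a * cst b"
  by (simp_all add: cst_def one_pCons)

lemma generators_eq_iff: "cst a * qvar + cst b * pvar = cst c * qvar + cst d * pvar \<longleftrightarrow> a = c \<and> b = d"
  by (simp add: cst_def qvar_def pvar_def)

lemma Kqp_mod_simps [simp]:
  "carrier (Kqp_mod S) = S" "add (Kqp_mod S) = (+)" "zero (Kqp_mod S) = 0" "smult (Kqp_mod S) = (\<lambda>c x. cst c * x)"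
  by (simp_all add: Kqp_mod_def)

lemma Kqp_simps [simp]:
  "Comp Kqp n = Kqp_mod (if n = 0 then UNIV else {0})" "Diff Kqp n x = 0" "Mult Kqp m n = (*)" "Unit Kqp = 1"
  by (simp_all add: Kqp_def)

lemma dgca_Kqp: "dgca (Kqp :: ('k::field, 'k poly poly) dga)"
proof -
  have [simp]: "cst (sgn_pow (m * n)) * (b * a) = a * b" if "m = 0 \<or> a = 0"
    for m n and a b :: "'k poly poly"
    using that by (auto simp: mult.commute)
  have "module scalars (Comp (Kqp :: ('k, 'k poly poly) dga) n)" for n
    by (rule vector_spaceI) (auto simp: algebra_simps)
  then show ?thesis
    unfolding dgca_def cochain_complex_def
    by (intro conjI allI ballI linear_mapI) (auto simp: algebra_simps split: if_splits)
qed

lemma chain_map_VV_inclusion: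
  assumes "D11 [I] J"
  shows "chain_map (VV \<alpha> I) (VV \<alpha> J) (\<lambda>n v. v)"
proof -
  have "fst J \<le> fst I" "snd I \<le> snd J"
    using assms greaterThanLessThan_subseteq_greaterThanLessThan[of "fst I" "snd I" "fst J" "snd J"]
    by (auto simp: D11_single color_def ivl_def)
  then have "carrier (Comp (VV \<alpha> I) n) \<subseteq> carrier (Comp (VV \<alpha> J) n)" for n
    by (auto simp: VV_def)
  moreover have "Diff (VV \<alpha> I) = Diff (VV \<alpha> J)"
    by (simp add: VV_def)
  ultimately show ?thesis
    unfolding chain_map_def by (intro conjI allI ballI linear_mapI) (auto simp del: VV_simps)
qed

lemma VV_op_single [simp]: "VV_op [I] J n [v] = v"
  by (simp add: VV_op_def)

lemma zero_closed_VV: "(\<lambda>_. 0) \<in> carrier (Comp (VV \<alpha> I) n)"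
  by (simp add: VV_def)

context interval
begin

lemmas V_complex = cochain_complex_VV[of \<alpha> I]

sublocale complex_space V
  by (rule complex_space.intro[OF V_complex])

lemma cocycles_0: "carrier (cocycles V 0) = carrier (Comp V 0)"
  using VV_simps(5)[of 0 \<alpha> I] by (simp del: VV_simps(2))

lemma coboundaries_0: "coboundaries V 0 = Q \<alpha> ` carrier (Comp V (- 1))"
  by (simp add: coboundaries_def del: VV_simps(1))

lemma coboundaries_0_iff:
  assumes "f \<in> carrier (Comp V 0)"
  shows "f \<in> coboundaries V 0 \<longleftrightarrow> evA f = 0 \<and> evB f = 0"
  unfolding coboundaries_0 using V0_exact[OF assms] ev_Q by (auto simp del: VV_simps)

lemma diff_closed: "f \<in> carrier (Comp V 0) \<Longrightarrow> g \<in> carrier (Comp V 0) \<Longrightarrow> (\<lambda>x. f x - g x) \<in> carrier (Comp V 0)"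
  by simp

lemma cohom_class_eq_ev:
  assumes "f \<in> carrier (Comp V 0)" "g \<in> carrier (Comp V 0)"
  shows "cohom_class V 0 f = cohom_class V 0 g \<longleftrightarrow> evA f = evA g \<and> evB f = evB g"
  using cohom_class_eq_iff[OF V_complex, of f 0 g] assms coboundaries_0_iff[OF diff_closed[OF assms]]
  by (simp add: cocycles_0 minus_VV ev_linear del: VV_simps cocycles_simps)

lemma phi_fun_eq_iff:
  "f \<in> carrier (Comp V 0) \<Longrightarrow> g \<in> carrier (Comp V 0) \<Longrightarrow>
    phi_fun \<alpha> f = phi_fun \<alpha> g \<longleftrightarrow> evA f = evA g \<and> evB f = evB g"
  by (simp only: phi_fun_ev generators_eq_iff)

lemma mem_cohom_class:
  assumes "f \<in> carrier (Comp V 0)" "g \<in> cohom_class V 0 f"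
  shows "phi_fun \<alpha> g = phi_fun \<alpha> f"
proof -
  interpret C: quotient_space "cocycles V 0" "coboundaries V 0"
    by (rule quotient_space_cohom[OF V_complex])
  have "g \<in> carrier (cocycles V 0)" "cohom_class V 0 g = cohom_class V 0 f"
    using C.mem_coset[of f g] assms unfolding cohom_class_def cocycles_0 by blast+
  then show ?thesis
    using cohom_class_eq_ev[of g f] phi_fun_eq_iff[of g f] assms(1) unfolding cocycles_0 by simp
qed

lemma self_cohom_class: "f \<in> carrier (Comp V 0) \<Longrightarrow> f \<in> cohom_class V 0 f"
  using quotient_space.self_coset[OF quotient_space_cohom[OF V_complex], of f 0]
  unfolding cohom_class_def cocycles_0 .

lemma phi_cohom_class:
  assumes "f \<in> carrier (Comp V 0)"
  shows "phi \<alpha> (cohom_class V 0 f) = phi_fun \<alpha> f"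
  unfolding phi_def
  by (rule the_elem_constant) (use self_cohom_class[OF assms] mem_cohom_class[OF assms] in blast)+

lemma phi_well_defined:
  assumes "X \<in> carrier (cohom V 0)" "f \<in> X"
  shows "phi \<alpha> X = phi_fun \<alpha> f"
  using assms phi_cohom_class mem_cohom_class unfolding carrier_cohom[OF V_complex] cocycles_0 by fastforce

lemma phi_fun_linear:
  assumes "f \<in> carrier (Comp V 0)"
  shows "g \<in> carrier (Comp V 0) \<Longrightarrow> phi_fun \<alpha> (\<lambda>x. f x + g x) = phi_fun \<alpha> f + phi_fun \<alpha> g"
    and "phi_fun \<alpha> (\<lambda>x. c * f x) = cst c * phi_fun \<alpha> f"
proof -
  show "phi_fun \<alpha> (\<lambda>x. f x + g x) = phi_fun \<alpha> f + phi_fun \<alpha> g" if g: "g \<in> carrier (Comp V 0)"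
  proof -
    have "(\<lambda>x. f x + g x) \<in> carrier (Comp V 0)" using assms g by simp
    then show ?thesis
      by (simp add: phi_fun_ev assms g ev_linear algebra_simps del: VV_simps)
  qed
  have "(\<lambda>x. c * f x) \<in> carrier (Comp V 0)" using assms by simp
  then show "phi_fun \<alpha> (\<lambda>x. c * f x) = cst c * phi_fun \<alpha> f"
    by (simp add: phi_fun_ev assms ev_linear algebra_simps del: VV_simps)
qed

text \<open>A class is determined by its two pairings, and \<open>a * fq + b * fp\<close> has the
  pairings \<open>a\<close> and \<open>b\<close>.\<close>

lemma phi_linear_iso: "linear_iso (cohom V 0) Kq_plus_Kp (phi \<alpha>)"
  unfolding linear_iso_def
proof
  have L: "linear_map (cocycles V 0) Kq_plus_Kp (phi_fun \<alpha>)"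
  proof (rule linear_mapI)
    show "phi_fun \<alpha> f \<in> carrier Kq_plus_Kp" if "f \<in> carrier (cocycles V 0)" for f
      using phi_fun_ev that unfolding cocycles_0 Kq_plus_Kp_def by auto
  qed (use phi_fun_linear cocycles_0 in \<open>auto simp: Kq_plus_Kp_def simp del: VV_simps\<close>)
  show "linear_map (cohom V 0) Kq_plus_Kp (phi \<alpha>)"
    unfolding cohom_def
    by (rule quotient_space.linear_map_quotI[OF quotient_space_cohom[OF V_complex] _ L])
      (use phi_cohom_class cocycles_0 in \<open>simp add: cohom_class_def del: VV_simps cocycles_simps\<close>)
  show "bij_betw (phi \<alpha>) (carrier (cohom V 0)) (carrier Kq_plus_Kp)"
    unfolding bij_betw_def carrier_cohom[OF V_complex] cocycles_0
  proof
    show "inj_on (phi \<alpha>) (cohom_class V 0 ` carrier (Comp V 0))"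
      using phi_cohom_class cohom_class_eq_ev phi_fun_eq_iff by (auto simp: inj_on_def simp del: VV_simps)
    have "\<exists>f\<in>carrier (Comp V 0). phi_fun \<alpha> f = cst a * qvar + cst b * pvar" for a b
    proof
      show f: "(\<lambda>x. a * fq x + b * fp x) \<in> carrier (Comp V 0)"
        using fq_closed fp_closed by simp
      show "phi_fun \<alpha> (\<lambda>x. a * fq x + b * fp x) = cst a * qvar + cst b * pvar"
        unfolding phi_fun_ev[OF f] by (simp add: ev_linear ev_generators)
    qed
    then have "cst a * qvar + cst b * pvar \<in> phi_fun \<alpha> ` carrier (Comp V 0)" for a b
      by (metis imageI)
    moreover have "phi \<alpha> ` cohom_class V 0 ` carrier (Comp V 0) = phi_fun \<alpha> ` carrier (Comp V 0)"
      unfolding image_image by (rule image_cong[OF refl phi_cohom_class])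
    moreover have "phi_fun \<alpha> ` carrier (Comp V 0) \<subseteq> carrier Kq_plus_Kp"
      using linear_mapD(1)[OF L] unfolding cocycles_0 by blast
    ultimately show "phi \<alpha> ` cohom_class V 0 ` carrier (Comp V 0) = carrier Kq_plus_Kp"
      by (auto simp: Kq_plus_Kp_def simp del: VV_simps)
  qed
qed

text \<open>In degree -1 this is injectivity of \<open>Q\<close>; in the other degrees the component
  itself is zero.\<close>

lemma cocycles_nonzero: "n \<noteq> 0 \<Longrightarrow> carrier (cocycles V n) = {\<lambda>_. 0}"
proof (cases "n = - 1")
  case True
  have "carrier (cocycles V (- 1)) = {f \<in> carrier (Comp V (- 1)). Q \<alpha> f = (\<lambda>_. 0)}"
    by (simp del: VV_simps(1))
  also have "\<dots> = {\<lambda>_. 0}"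
    using Q_inj Q_linear(4) by (auto simp del: VV_simps(1)) (simp add: V1)
  finally show ?thesis using True by simp
qed auto

lemma cohom_nonzero:
  assumes "n \<noteq> 0"
  shows "carrier (cohom V n) = {\<zero>\<^bsub>cohom V n\<^esub>}"
proof -
  have "\<zero>\<^bsub>cohom V n\<^esub> = cohom_class V n (\<lambda>_. 0)"
    using quotient_space.quot_zero[OF quotient_space_cohom[OF V_complex], of n]
    by (simp add: cohom_def cohom_class_def)
  then show ?thesis
    unfolding carrier_cohom[OF V_complex] cocycles_nonzero[OF assms] by simp
qed

lemma phi_chain_eq: "f \<in> carrier (Comp V n) \<Longrightarrow> phi_chain \<alpha> I n f = (if n = 0 then phi_fun \<alpha> f else 0)"
  by (cases "n = 0") (simp_all add: phi_chain_def phi_cohom_class del: VV_simps)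

lemma chain_map_phi: "chain_map V Kqp (phi_chain \<alpha> I)"
  unfolding chain_map_def
proof (intro conjI allI ballI)
  show "linear_map (Comp V n) (Comp Kqp n) (phi_chain \<alpha> I n)" for n
  proof (cases "n = 0")
    case True
    have "(\<lambda>x. f x + g x) \<in> carrier (Comp V 0)" "(\<lambda>x. c * f x) \<in> carrier (Comp V 0)"
      if "f \<in> carrier (Comp V 0)" "g \<in> carrier (Comp V 0)" for f g c
      using that by simp_all
    then show ?thesis
      unfolding True by (intro linear_mapI) (simp_all add: phi_chain_eq phi_fun_linear del: VV_simps)
  next
    case False
    then show ?thesis by (intro linear_mapI) (simp_all add: phi_chain_def)
  qed
  show "phi_chain \<alpha> I (n + 1) (Diff V n f) = Diff Kqp n (phi_chain \<alpha> I n f)"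
    if f: "f \<in> carrier (Comp V n)" for n f
  proof (cases "n = - 1")
    case True
    have "phi_fun \<alpha> (Q \<alpha> f) = 0"
      using phi_fun_ev[OF Q_closed] ev_Q f True by simp
    then show ?thesis
      using phi_chain_eq[OF Q_closed] f True by simp
  next
    case False
    then show ?thesis by (simp add: phi_chain_def)
  qed
qed

sublocale Phi: sym_hom V Kqp "phi_chain \<alpha> I"
  by (intro sym_hom.intro sym_hom_axioms.intro dgca_space.intro dgca_Kqp chain_map_phi complex_space_axioms)

lemma Phi_hom: "dga_hom (Ocl \<alpha> I) Kqp (Phi \<alpha> I)"
  unfolding Ocl_def Phi_def by (rule Phi.sym_ext_hom)

lemma Phi_cls: "keys x \<subseteq> sym_words V n \<Longrightarrow> Phi \<alpha> I n (sym_cls V n x) = Phi.word_eval n x"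
  unfolding Phi_def by (rule Phi.sym_ext_cls)

end

lemma intervalI:
  assumes "\<alpha> \<noteq> 0" "color I"
  obtains l r where "interval \<alpha> I l r"
  by (rule integer_interval[OF assms(2)], rule that, rule interval.intro[OF assms(1)])

section \<open>The operad algebra \<open>VV\<close>\<close>

lemma sum_list_nth: "(\<Sum>f\<leftarrow>fs. h f) = (\<Sum>i<length fs. h (fs ! i))"
  by (simp add: sum.list_conv_set_nth atLeast0LessThan)

lemma D11_algebra_VV:
  assumes "\<alpha> \<noteq> 0"
  shows "D11_algebra_sum (VV \<alpha>) (VV_op :: _ \<Rightarrow> _ \<Rightarrow> _ \<Rightarrow> (int \<Rightarrow> 'k::field_char_0) list \<Rightarrow> _)"
  unfolding D11_algebra_sum_def
proof (intro conjI allI impI ballI cochain_complex_VV)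
  show "chain_map (direct_sum (map (VV \<alpha>) Is)) (VV \<alpha> J) (VV_op Is J)" if D: "D11 Is J" for Is J
  proof -
    note inc = chain_mapD[OF chain_map_VV_inclusion[OF D11_member[OF D], of _ \<alpha>]]
    have mem: "vs ! i \<in> carrier (Comp (VV \<alpha> J) n)" "length vs = length Is"
      if "vs \<in> carrier (Comp (direct_sum (map (VV \<alpha>) Is)) n)" "i < length vs" for vs n i
      using that inc(2)[of "Is ! i" "vs ! i" n] by (auto simp: direct_sum_def list_all2_conv_all_nth simp del: VV_simps)
    show ?thesis
      unfolding chain_map_def
    proof (intro conjI allI ballI linear_mapI)
      fix n vs assume vs: "vs \<in> carrier (Comp (direct_sum (map (VV \<alpha>) Is)) n)"
      then have len: "length vs = length Is"
        by (auto simp: direct_sum_def dest: list_all2_lengthD)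
      show "VV_op Is J n vs \<in> carrier (Comp (VV \<alpha> J) n)"
      proof -
        have "(\<lambda>x. \<Sum>i<k. (vs ! i) x) \<in> carrier (Comp (VV \<alpha> J) n)" if "k \<le> length vs" for k
          using that
        proof (induction k)
          case 0
          then show ?case using zero_closed_VV by simp
        next
          case (Suc k)
          have "(\<lambda>x. \<Sum>i<k. (vs ! i) x) \<in> carrier (Comp (VV \<alpha> J) n)" "vs ! k \<in> carrier (Comp (VV \<alpha> J) n)"
            using Suc mem[OF vs] by simp_all
          from submodule_vsD(3)[OF module_VV module.carrier_is_submodule[OF module_VV] this]
          show ?case by simp
        qed
        then show ?thesis by (simp add: VV_op_def sum_list_nth)
      qed
      show "VV_op Is J n (c \<odot>\<^bsub>Comp (direct_sum (map (VV \<alpha>) Is)) n\<^esub> vs) = c \<odot>\<^bsub>Comp (VV \<alpha> J) n\<^esub> VV_op Is J n vs" for c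
        by (simp add: VV_op_def sum_list_nth direct_sum_def len sum_distrib_left del: VV_simps)
      show "VV_op Is J n (vs \<oplus>\<^bsub>Comp (direct_sum (map (VV \<alpha>) Is)) n\<^esub> us) = VV_op Is J n vs \<oplus>\<^bsub>Comp (VV \<alpha> J) n\<^esub> VV_op Is J n us"
        if us: "us \<in> carrier (Comp (direct_sum (map (VV \<alpha>) Is)) n)" for us
      proof -
        have "length us = length Is"
          using us by (auto simp: direct_sum_def dest: list_all2_lengthD)
        then show ?thesis
          by (simp add: VV_op_def sum_list_nth direct_sum_def len sum.distrib del: VV_simps)
      qed
      show "VV_op Is J (n + 1) (Diff (direct_sum (map (VV \<alpha>) Is)) n vs) = Diff (VV \<alpha> J) n (VV_op Is J n vs)"
        by (cases "n = - 1")
          (simp_all add: VV_op_def sum_list_nth direct_sum_def len Q_def[abs_def] sum.distrib sum_subtractf sum_distrib_left)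
    qed
  qed
  show "VV_op [I] I n [v] = v" for I n and v :: "int \<Rightarrow> 'k" by simp
  show "VV_op Js K n (map (\<lambda>i. VV_op (Iss ! i) (Js ! i) n (vss ! i)) [0..<length Js]) = VV_op (concat Iss) K n (concat vss)"
    if "D11 Js K \<and> list_all2 D11 Iss Js \<and>
      list_all2 (\<lambda>Is vs. vs \<in> carrier (Comp (direct_sum (map (VV \<alpha>) Is)) n)) Iss vss" for Iss Js K n vss
  proof -
    have len: "length vss = length Js"
      using that by (metis list_all2_lengthD)
    have "(\<Sum>f\<leftarrow>concat vss. f x) = (\<Sum>vs\<leftarrow>vss. \<Sum>f\<leftarrow>vs. f x)" for x
      by (induction vss) simp_all
    then show ?thesis
      by (simp add: VV_op_def sum_list_nth[of _ vss] len o_def interv_sum_list_conv_sum_set_nat atLeast0LessThan)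
  qed
  show "VV_op (permute_list \<sigma> Is) J n (permute_list \<sigma> vs) = VV_op Is J n vs"
    if "D11 Is J \<and> \<sigma> permutes {..<length Is} \<and> vs \<in> carrier (Comp (direct_sum (map (VV \<alpha>) Is)) n)" for Is J \<sigma> n vs
  proof -
    have "length vs = length Is"
      using that by (auto simp: direct_sum_def dest: list_all2_lengthD)
    then have "mset (permute_list \<sigma> vs) = mset vs"
      using that by (simp add: mset_permute_list)
    then have "(\<Sum>f\<leftarrow>permute_list \<sigma> vs. f x) = (\<Sum>f\<leftarrow>vs. f x)" for x
      by (metis mset_map sum_mset_sum_list)
    then show ?thesis by (simp add: VV_op_def)
  qed
qed

text \<open>\<open>A\<close> and \<open>B\<close> are functions on all integers, so extension by
  zero preserves the pairings, and these detect classes on both intervals. The dual functions of the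
  smaller interval thus represent every class of the larger one.\<close>

lemma locally_constant_VV:
  assumes "\<alpha> \<noteq> 0"
  shows "locally_constant_sum (VV (\<alpha> :: 'k::field_char_0)) VV_op"
  unfolding locally_constant_sum_def
proof (intro allI impI)
  fix I J assume D: "D11 [I] J"
  have "color I" "color J" using D by (simp_all add: D11_single)
  obtain l r where "interval \<alpha> I l r"
    by (rule intervalI[OF assms \<open>color I\<close>])
  then interpret I: interval \<alpha> I l r .
  obtain l' r' where "interval \<alpha> J l' r'"
    by (rule intervalI[OF assms \<open>color J\<close>])
  then interpret J: interval \<alpha> J l' r' .
  note c = chain_map_VV_inclusion[OF D, of \<alpha>]
  \<comment> \<open>\<open>phi_fun\<close> does not refer to an interval, so its two expressions can
    be compared coefficient by coefficient.\<close>
  have ev: "I.evA f = J.evA f \<and> I.evB f = J.evB f" if "f \<in> carrier (Comp (VV \<alpha> I) 0)" for f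
    using I.phi_fun_ev[OF that] J.phi_fun_ev[OF chain_mapD(2)[OF c that]] by (simp add: generators_eq_iff)
  show "quasi_iso (VV \<alpha> I) (VV \<alpha> J) (\<lambda>n v. VV_op [I] J n [v])"
    unfolding VV_op_single
  proof (rule quasi_isoI[OF I.V_complex J.V_complex c])
    fix n
    show "f \<in> coboundaries (VV \<alpha> I) n"
      if f: "f \<in> carrier (cocycles (VV \<alpha> I) n)" and b: "f \<in> coboundaries (VV \<alpha> J) n" for f
    proof (cases "n = 0")
      case True
      then have "f \<in> carrier (Comp (VV \<alpha> I) 0)"
        using f I.cocycles_0 by simp
      then show ?thesis
        using I.coboundaries_0_iff J.coboundaries_0_iff[OF chain_mapD(2)[OF c]] ev b True by simp
    next
      case False
      then have "f = (\<lambda>_. 0)"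
        using f I.cocycles_nonzero[OF False] by blast
      then show ?thesis
        using coboundary_zero[OF I.V_complex, of n] by simp
    qed
    show "\<exists>f\<in>carrier (cocycles (VV \<alpha> I) n). f \<ominus>\<^bsub>Comp (VV \<alpha> J) n\<^esub> h \<in> coboundaries (VV \<alpha> J) n"
      if h: "h \<in> carrier (cocycles (VV \<alpha> J) n)" for h
    proof (cases "n = 0")
      case True
      then have h0: "h \<in> carrier (Comp (VV \<alpha> J) 0)"
        using h J.cocycles_0 by simp
      let ?f = "\<lambda>x. J.evA h * I.fq x + J.evB h * I.fp x"
      have f: "?f \<in> carrier (Comp (VV \<alpha> I) 0)"
        using I.fq_closed I.fp_closed by simp
      have fJ: "?f \<in> carrier (Comp (VV \<alpha> J) 0)"
        by (rule chain_mapD(2)[OF c f])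
      have "I.evA ?f = J.evA h" "I.evB ?f = J.evB h"
        by (simp_all add: I.ev_linear I.ev_generators)
      then have "(\<lambda>x. ?f x - h x) \<in> coboundaries (VV \<alpha> J) 0"
        using ev[OF f] J.coboundaries_0_iff[OF J.diff_closed[OF fJ h0]] by (simp add: J.ev_linear)
      then show ?thesis
        using f minus_VV[OF fJ h0] I.cocycles_0 True by (intro bexI[of _ ?f]) simp_all
    next
      case False
      then have "h = (\<lambda>_. 0)" using h J.cocycles_nonzero[OF False] by blast
      then show ?thesis
        using minus_VV[OF zero_closed_VV zero_closed_VV, of \<alpha> J n] coboundary_zero[OF J.V_complex, of n]
        unfolding I.cocycles_nonzero[OF False] by simp
    qed
  qed
qed


section \<open>The contracting homotopy\<close>

context interval
begin

text \<open>On the complex the homotopy inverts \<open>Q\<close> after discarding the components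
  along \<open>fq\<close> and \<open>fp\<close>. On functions of degree 0 the choice is forced since
  \<open>Q\<close> is injective, and this uniqueness is also what makes the map linear.\<close>

definition contraction :: "int \<Rightarrow> (int \<Rightarrow> 'k) \<Rightarrow> int \<Rightarrow> 'k" where
  "contraction n f = (if n = 0 then SOME g. g \<in> carrier (Comp V (- 1)) \<and>
     f = (\<lambda>x. evA f * fq x + evB f * fp x + Q \<alpha> g x) else (\<lambda>_. 0))"

lemma contraction_props:
  assumes "f \<in> carrier (Comp V 0)"
  shows "contraction 0 f \<in> carrier (Comp V (- 1))" "f = (\<lambda>x. evA f * fq x + evB f * fp x + Q \<alpha> (contraction 0 f) x)"
  using someI_ex[OF V0_decompose[OF assms, unfolded Bex_def]] by (simp_all only: contraction_def if_True simp_thms)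

lemma contraction_eqI:
  assumes f: "f \<in> carrier (Comp V 0)" and g: "g \<in> carrier (Comp V (- 1))"
    and eq: "f = (\<lambda>x. evA f * fq x + evB f * fp x + Q \<alpha> g x)"
  shows "contraction 0 f = g"
proof -
  have "(\<lambda>x. contraction 0 f x - g x) = (\<lambda>_. 0)"
  proof (rule Q_inj)
    show "(\<lambda>x. contraction 0 f x - g x) \<in> carrier (Comp V (- 1))"
      using contraction_props(1)[OF f] g by simp
    have "Q \<alpha> (contraction 0 f) x = Q \<alpha> g x" for x
      using fun_cong[OF contraction_props(2)[OF f], of x] fun_cong[OF eq, of x] by simp
    then show "Q \<alpha> (\<lambda>x. contraction 0 f x - g x) = (\<lambda>_. 0)"
      by (simp add: Q_linear)
  qed
  then show ?thesis by (auto simp: fun_eq_iff)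
qed

lemma contraction_values: "contraction 0 fq = (\<lambda>_. 0)" "contraction 0 fp = (\<lambda>_. 0)"
  "g \<in> carrier (Comp V (- 1)) \<Longrightarrow> contraction 0 (Q \<alpha> g) = g" "n \<noteq> 0 \<Longrightarrow> contraction n f = (\<lambda>_. 0)"
proof -
  have z: "(\<lambda>_. 0) \<in> carrier (Comp V (- 1))" by simp
  show "contraction 0 fq = (\<lambda>_. 0)"
    by (rule contraction_eqI[OF fq_closed z]) (simp add: ev_generators Q_linear)
  show "contraction 0 fp = (\<lambda>_. 0)"
    by (rule contraction_eqI[OF fp_closed z]) (simp add: ev_generators Q_linear)
  show "contraction 0 (Q \<alpha> g) = g" if g: "g \<in> carrier (Comp V (- 1))"
    by (rule contraction_eqI[OF Q_closed[OF g] g]) (simp add: ev_Q[OF g])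
qed (simp add: contraction_def)

text \<open>Sums and multiples of chosen preimages satisfy the defining equation of the sum or
  multiple, so uniqueness applies. The degree is written \<open>n + - 1\<close> to match
  \<open>n + k\<close> in the lemmas on derivations.\<close>

lemma contraction_linear: "linear_map (Comp V n) (Comp V (n + - 1)) (contraction n)"
proof (cases "n = 0")
  case True
  have "linear_map (Comp V 0) (Comp V (- 1)) (contraction 0)"
  proof (rule linear_mapI)
    show "contraction 0 f \<in> carrier (Comp V (- 1))" if "f \<in> carrier (Comp V 0)" for f
      by (rule contraction_props[OF that])
    show "contraction 0 (f \<oplus>\<^bsub>Comp V 0\<^esub> f') = contraction 0 f \<oplus>\<^bsub>Comp V (- 1)\<^esub> contraction 0 f'"
      if f: "f \<in> carrier (Comp V 0)" "f' \<in> carrier (Comp V 0)" for f f'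
    proof (rule contraction_eqI)
      show "f \<oplus>\<^bsub>Comp V 0\<^esub> f' \<in> carrier (Comp V 0)" using f by simp
      show "contraction 0 f \<oplus>\<^bsub>Comp V (- 1)\<^esub> contraction 0 f' \<in> carrier (Comp V (- 1))"
        using contraction_props(1)[OF f(1)] contraction_props(1)[OF f(2)] by simp
      show "f \<oplus>\<^bsub>Comp V 0\<^esub> f' = (\<lambda>x. evA (f \<oplus>\<^bsub>Comp V 0\<^esub> f') * fq x + evB (f \<oplus>\<^bsub>Comp V 0\<^esub> f') * fp x
          + Q \<alpha> (contraction 0 f \<oplus>\<^bsub>Comp V (- 1)\<^esub> contraction 0 f') x)"
        unfolding VV_ops ev_linear Q_linear
        by (rule ext, subst fun_cong[OF contraction_props(2)[OF f(1)]], subst fun_cong[OF contraction_props(2)[OF f(2)]])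
          (simp add: algebra_simps)
    qed
    show "contraction 0 (c \<odot>\<^bsub>Comp V 0\<^esub> f) = c \<odot>\<^bsub>Comp V (- 1)\<^esub> contraction 0 f" if f: "f \<in> carrier (Comp V 0)" for c f
    proof (rule contraction_eqI)
      show "c \<odot>\<^bsub>Comp V 0\<^esub> f \<in> carrier (Comp V 0)" using f by simp
      show "c \<odot>\<^bsub>Comp V (- 1)\<^esub> contraction 0 f \<in> carrier (Comp V (- 1))"
        using contraction_props(1)[OF f] by simp
      show "c \<odot>\<^bsub>Comp V 0\<^esub> f = (\<lambda>x. evA (c \<odot>\<^bsub>Comp V 0\<^esub> f) * fq x + evB (c \<odot>\<^bsub>Comp V 0\<^esub> f) * fp x
          + Q \<alpha> (c \<odot>\<^bsub>Comp V (- 1)\<^esub> contraction 0 f) x)"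
        unfolding VV_ops ev_linear Q_linear
        by (rule ext, subst fun_cong[OF contraction_props(2)[OF f]]) (simp add: algebra_simps)
    qed
  qed
  then show ?thesis using True by simp
next
  case False
  then show ?thesis
    using zero_closed_VV[of \<alpha> I "n + - 1"] by (intro linear_mapI) (simp_all add: contraction_values del: VV_simps)
qed

abbreviation dW where "dW \<equiv> der 1 (Diff V) :: ((int \<Rightarrow> 'k) word \<Rightarrow>\<^sub>0 'k) \<Rightarrow> _"
abbreviation sW where "sW \<equiv> der (- 1) contraction :: ((int \<Rightarrow> 'k) word \<Rightarrow>\<^sub>0 'k) \<Rightarrow> _"

lemma dW_keys: "keys x \<subseteq> sym_words V n \<Longrightarrow> keys (dW x) \<subseteq> sym_words V (n + 1)"
  by (rule der_keys[OF Diff_closed])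

lemma sW_keys: "keys x \<subseteq> sym_words V n \<Longrightarrow> keys (sW x) \<subseteq> sym_words V (n + - 1)"
  by (rule der_keys[OF linear_mapD(1)[OF contraction_linear]])

lemma dW_ideal: "x \<in> sym_ideal V n \<Longrightarrow> dW x \<in> sym_ideal V (n + 1)"
  by (rule der_sym_ideal[OF cochain_complexD(2)[OF V_complex]])

lemma sW_ideal: "x \<in> sym_ideal V n \<Longrightarrow> sW x \<in> sym_ideal V (n + - 1)"
  by (rule der_sym_ideal[OF contraction_linear])

lemma dW_dW:
  assumes "keys x \<subseteq> sym_words V n"
  shows "dW (dW x) \<in> sym_ideal V (n + 2)"
  using assms
  by (induction rule: poly_mapping_keys_induct)
    (simp_all add: free_ext_add free_ext_pscale sym_ideal_zero sym_ideal_add sym_ideal_pscale der_der_word)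

section \<open>Weights of words and reduction of cocycles to weight zero\<close>

definition base_letters :: "(int \<times> (int \<Rightarrow> 'k)) set" where
  "base_letters = {(0, fq), (0, fp)}"

text \<open>The letters of the contractible summand: \<open>Q\<close> maps those of degree -1
  bijectively to those of degree 0, and the homotopy goes back.\<close>

definition exact_letters :: "(int \<times> (int \<Rightarrow> 'k)) set" where
  "exact_letters = {(0, Q \<alpha> g) | g. g \<in> carrier (Comp V (- 1))} \<union> {(- 1, g) | g. g \<in> carrier (Comp V (- 1))}"

definition weight :: "(int \<Rightarrow> 'k) word \<Rightarrow> nat" where
  "weight w = length (filter (\<lambda>a. a \<notin> base_letters) w)"

text \<open>Every letter is of one of the two kinds, so counting the letters outside
  \<open>base_letters\<close> makes sense. The weight is only bounded, because rewriting a letter as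
  a sum produces words of different weights.\<close>

definition special_words :: "nat \<Rightarrow> int \<Rightarrow> (int \<Rightarrow> 'k) word set" where
  "special_words m n = {w \<in> sym_words V n. set w \<subseteq> base_letters \<union> exact_letters \<and> weight w \<le> m}"

text \<open>In degree 0 the pairings separate the two kinds: both vanish on the image of
  \<open>Q\<close>, while \<open>fq\<close> and \<open>fp\<close> each have one pairing equal to
  1.\<close>

lemma exact_not_base: "a \<in> exact_letters \<Longrightarrow> a \<notin> base_letters"
  using ev_Q ev_generators by (auto simp: exact_letters_def base_letters_def simp del: VV_simps) (metis zero_neq_one)+

lemma base_closed: "a \<in> base_letters \<Longrightarrow> snd a \<in> carrier (Comp V (fst a)) \<and> fst a = 0"
  using fq_closed fp_closed by (auto simp: base_letters_def simp del: VV_simps)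

lemma special_words_sym_words: "special_words m n \<subseteq> sym_words V n"
  by (auto simp: special_words_def)

lemma special_words_mono: "m \<le> m' \<Longrightarrow> special_words m n \<subseteq> special_words m' n"
  by (auto simp: special_words_def)

lemma special_words_append: "u \<in> special_words m n \<Longrightarrow> v \<in> special_words m' n' \<Longrightarrow> u @ v \<in> special_words (m + m') (n + n')"
  by (auto simp: special_words_def weight_def sym_words_append)

text \<open>On generators the anticommutator is the projection onto the contractible summand, with
  value 0 on \<open>fq\<close> and \<open>fp\<close>. The ideal absorbs the letters with entry zero
  that arise.\<close>

lemma homotopy_letter:
  assumes "(p, v) \<in> base_letters \<union> exact_letters"
  shows "single [(p, Diff V (p - 1) (contraction p v))] 1 + single [(p, contraction (p + 1) (Diff V p v))] 1
    - single [(p, v)] (if (p, v) \<in> base_letters then 0 else 1) \<in> sym_ideal V p"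
proof -
  have z: "single [(n, \<lambda>_. 0)] c \<in> sym_ideal V n" for n c
    using sym_rel_zero[of n c] by simp
  consider "p = 0" "v = fq \<or> v = fp" | g where "p = 0" "v = Q \<alpha> g" "g \<in> carrier (Comp V (- 1))"
    | "p = - 1" "v \<in> carrier (Comp V (- 1))"
    using assms by (auto simp: base_letters_def exact_letters_def simp del: VV_simps)
  then show ?thesis
  proof cases
    case 1
    then have "(p, v) \<in> base_letters" "contraction p v = (\<lambda>_. 0)"
      by (auto simp: base_letters_def contraction_values)
    then show ?thesis
      using 1 z[of 0 1] by (simp add: Q_linear contraction_values sym_ideal_add)
  next
    case 2
    then have "(p, v) \<notin> base_letters" "contraction p v = g"
      using exact_not_base[of "(p, v)"] by (auto simp: exact_letters_def contraction_values simp del: VV_simps)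
    then show ?thesis
      using 2 z[of 0 1] by (simp add: contraction_values)
  next
    case 3
    then have "(p, v) \<notin> base_letters"
      by (auto simp: base_letters_def)
    then show ?thesis
      using 3 z[of "- 1" 1] contraction_values(3)[OF 3(2)] by (simp add: contraction_values)
  qed
qed

lemma homotopy_word:
  "w \<in> special_words m n \<Longrightarrow> dW (wder (- 1) contraction w) + sW (wder 1 (Diff V) w) - single w (of_nat (weight w)) \<in> sym_ideal V n"
proof (induction w arbitrary: n m)
  case Nil
  then show ?case by (simp add: weight_def sym_ideal_zero)
next
  case (Cons a w)
  obtain p v where a: "a = (p, v)" by (cases a)
  have v: "v \<in> carrier (Comp V p)" and w: "w \<in> special_words m (n - p)" and l: "(p, v) \<in> base_letters \<union> exact_letters"
    and ws: "w \<in> sym_words V (n - p)"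
    using Cons.prems a by (auto simp: special_words_def weight_def split: if_splits)
  let ?c = "if (p, v) \<in> base_letters then 0 else 1 :: 'k"
  let ?s = "\<lambda>w. single w (1 :: 'k)"
  \<comment> \<open>With these signs the mixed terms of the two orders cancel, and only terms in
    which both operators hit the same part of the word remain.\<close>
  have s: "sgn_pow (p - 1) = - sgn_pow p" "sgn_pow (- p - 1) = - sgn_pow p" "sgn_pow (- 1 - p) = - sgn_pow p"
    by (simp_all add: sgn_pow_if)
  have e1: "dW (wder (- 1) contraction (a # w)) + sW (wder 1 (Diff V) (a # w)) =
      (?s [(p, Diff V (p - 1) (contraction p v))] + ?s [(p, contraction (p + 1) (Diff V p v))]) * ?s w
      + ?s [(p, v)] * (dW (wder (- 1) contraction w) + sW (wder 1 (Diff V) w))"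
    unfolding a der_wder_Cons by (simp add: s pscale_distribs algebra_simps)
  have e2: "single (a # w) (of_nat (weight (a # w))) =
      single [(p, v)] ?c * ?s w + ?s [(p, v)] * single w (of_nat (weight w))"
    by (simp add: a weight_def algebra_simps single_add)
  have e: "dW (wder (- 1) contraction (a # w)) + sW (wder 1 (Diff V) (a # w)) - single (a # w) (of_nat (weight (a # w))) =
      (?s [(p, Diff V (p - 1) (contraction p v))] + ?s [(p, contraction (p + 1) (Diff V p v))] - single [(p, v)] ?c) * ?s w
      + ?s [(p, v)] * (dW (wder (- 1) contraction w) + sW (wder 1 (Diff V) w) - single w (of_nat (weight w)))"
    unfolding e1 e2 by (simp only: distrib_left distrib_right left_diff_distrib right_diff_distrib) simp
  have "(?s [(p, Diff V (p - 1) (contraction p v))] + ?s [(p, contraction (p + 1) (Diff V p v))] - single [(p, v)] ?c) * ?s w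
      \<in> sym_ideal V (p + (n - p))"
    by (rule sym_ideal_mult_right[OF homotopy_letter[OF l]]) (simp add: ws)
  moreover have "?s [(p, v)] * (dW (wder (- 1) contraction w) + sW (wder 1 (Diff V) w) - single w (of_nat (weight w)))
      \<in> sym_ideal V (p + (n - p))"
    by (rule sym_ideal_mult_left[OF Cons.IH[OF w]]) (use v in \<open>simp del: VV_simps\<close>)
  ultimately show ?case
    unfolding e using sym_ideal_add by simp
qed

definition weight_op :: "((int \<Rightarrow> 'k) word \<Rightarrow>\<^sub>0 'k) \<Rightarrow> ((int \<Rightarrow> 'k) word \<Rightarrow>\<^sub>0 'k)" where
  "weight_op = free_ext (\<lambda>w. single w (of_nat (weight w)))"

lemma homotopy:
  assumes "keys x \<subseteq> special_words m n"
  shows "dW (sW x) + sW (dW x) - weight_op x \<in> sym_ideal V n"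
  using assms
proof (induction rule: poly_mapping_keys_induct)
  case (single_add w c x)
  have "pscale c (dW (wder (- 1) contraction w) + sW (wder 1 (Diff V) w) - single w (of_nat (weight w))) \<in> sym_ideal V n"
    by (rule sym_ideal_pscale[OF homotopy_word[OF single_add(1)]])
  from sym_ideal_add[OF this single_add(3)] show ?case
    by (simp add: weight_op_def free_ext_add free_ext_pscale pscale_distribs algebra_simps)
qed (simp add: weight_op_def sym_ideal_zero)

text \<open>On words of weight \<open>k\<close> the anticommutator of \<open>d\<close> and \<open>s\<close> is multiplication by \<open>k\<close>, so that
  subtracting a multiple of it removes the words of maximal weight.\<close>

lemma reduce_weight:
  assumes x: "keys x \<subseteq> special_words (Suc m) n" and dx: "dW x \<in> sym_ideal V (n + 1)"
  shows "\<exists>y z. keys y \<subseteq> special_words m n \<and> dW y \<in> sym_ideal V (n + 1) \<and>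
    keys z \<subseteq> sym_words V (n + - 1) \<and> x - y - dW z \<in> sym_ideal V n"
proof -
  define c :: 'k where "c = 1 / of_nat (Suc m)"
  have c: "c * of_nat (Suc m) = 1"
    by (simp add: c_def del: of_nat_Suc)
  \<comment> \<open>The coefficient \<open>1 - c * of_nat (weight w)\<close> is zero exactly on the
    words of top weight \<open>Suc m\<close>.\<close>
  define y where "y = free_ext (\<lambda>w. single w (1 - c * of_nat (weight w))) x"
  define z where "z = pscale c (sW x)"
  have xs: "keys x \<subseteq> sym_words V n"
    using x special_words_sym_words by blast
  have y: "keys y \<subseteq> special_words m n"
    unfolding y_def
  proof (rule keys_free_ext[OF _ x])
    fix w assume w: "w \<in> special_words (Suc m) n"
    show "keys (single w (1 - c * of_nat (weight w))) \<subseteq> special_words m n"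
    proof (cases "weight w = Suc m")
      case True
      then show ?thesis using c by (simp del: of_nat_Suc)
    next
      case False
      then show ?thesis using w by (intro keys_closed) (auto simp: special_words_def)
    qed
  qed
  have z: "keys z \<subseteq> sym_words V (n + - 1)"
    unfolding z_def by (rule keys_closed, rule sW_keys[OF xs])
  have xy: "x - y = pscale c (weight_op x)"
    unfolding y_def weight_op_def
  proof (rule poly_mapping_keys_induct[OF subset_UNIV[of "keys x"]], goal_cases)
    case (2 w d x)
    have "single w d - single w (d * (1 - c * of_nat (weight w))) =
        single w (c * (d * of_nat (weight w)))"
      by (simp add: algebra_simps flip: single_diff)
    moreover have "single w d + x - free_ext (\<lambda>w. single w (1 - c * of_nat (weight w))) (single w d + x) =
        (single w d - single w (d * (1 - c * of_nat (weight w))))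
        + (x - free_ext (\<lambda>w. single w (1 - c * of_nat (weight w))) x)"
      by (simp add: free_ext_add)
    ultimately show ?case
      unfolding 2(3) by (simp add: free_ext_add pscale_distribs)
  qed simp
  \<comment> \<open>For a cocycle the half \<open>s d\<close> of the anticommutator lies in the
    ideal, so modulo the ideal \<open>weight_op x\<close> is the coboundary of
    \<open>sW x\<close>.\<close>
  have "sW (dW x) \<in> sym_ideal V n"
    using sW_ideal[OF dx] by simp
  then have "pscale c ((dW (sW x) + sW (dW x) - weight_op x) - sW (dW x)) \<in> sym_ideal V n"
    by (intro sym_ideal_pscale sym_ideal_minus homotopy[OF x])
  from sym_ideal_pscale[OF this, of "-1"]
  have i: "x - y - dW z \<in> sym_ideal V n"
    by (simp add: xy z_def free_ext_pscale pscale_distribs)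
  \<comment> \<open>This expression is \<open>dW y\<close> by linearity: the remainder
    \<open>y\<close> is again a cocycle modulo the ideal, so the reduction can be repeated.\<close>
  have "dW x - dW (x - y - dW z) - dW (dW z) \<in> sym_ideal V (n + 1)"
    using dW_dW[OF z] by (intro sym_ideal_minus dx dW_ideal[OF i]) (simp add: add.commute)
  then have "dW y \<in> sym_ideal V (n + 1)"
    by (simp add: free_ext_minus)
  then show ?thesis using y z i by blast
qed

lemma cocycle_reduce:
  "keys x \<subseteq> special_words m n \<Longrightarrow> dW x \<in> sym_ideal V (n + 1) \<Longrightarrow>
    \<exists>y z. keys y \<subseteq> special_words 0 n \<and> keys z \<subseteq> sym_words V (n + - 1) \<and> x - y - dW z \<in> sym_ideal V n"
proof (induction m arbitrary: x)
  case 0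
  then show ?case
    by (intro exI[of _ x] exI[of _ 0]) (simp add: sym_ideal_zero)
next
  case (Suc m)
  obtain y z where y: "keys y \<subseteq> special_words m n" "dW y \<in> sym_ideal V (n + 1)"
    and z: "keys z \<subseteq> sym_words V (n + - 1)" and i: "x - y - dW z \<in> sym_ideal V n"
    using reduce_weight[OF Suc.prems] by blast
  obtain y' z' where y': "keys y' \<subseteq> special_words 0 n"
    and z': "keys z' \<subseteq> sym_words V (n + - 1)" and i': "y - y' - dW z' \<in> sym_ideal V n"
    using Suc.IH[OF y] by blast
  have e: "x - y' - dW (z + z') = (x - y - dW z) + (y - y' - dW z')"
    by (simp add: free_ext_add algebra_simps)
  have "x - y' - dW (z + z') \<in> sym_ideal V n"
    unfolding e by (rule sym_ideal_add[OF i i'])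
  then show ?case
    using y' keys_closed(1)[OF z z'] by blast
qed

lemma special_letter:
  assumes v: "v \<in> carrier (Comp V p)"
  shows "\<exists>y. keys y \<subseteq> special_words 1 p \<and> single [(p, v)] 1 - y \<in> sym_ideal V p"
proof -
  have mem: "[(q, u)] \<in> special_words 1 q" if "(q, u) \<in> base_letters \<union> exact_letters" "u \<in> carrier (Comp V q)" for q u
    using that by (simp add: special_words_def weight_def del: VV_simps)
  from v show ?thesis
  proof (cases rule: VV_carrier_cases)
    case 1
    then have "(p, v) \<in> exact_letters" using v by (auto simp: exact_letters_def)
    then show ?thesis
      using mem[of p v] v by (intro exI[of _ "single [(p, v)] 1"]) (simp add: sym_ideal_zero del: VV_simps)
  next
    case 2
    have v0: "v \<in> carrier (Comp V 0)" using v 2 by simp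
    obtain g where g: "g \<in> carrier (Comp V (- 1))" and vg: "v = (\<lambda>x. evA v * fq x + evB v * fp x + Q \<alpha> g x)"
      using V0_decompose[OF v0] by blast
    let ?s = "\<lambda>u. single [(0 :: int, u)] (1 :: 'k)"
    let ?y = "pscale (evA v) (?s fq) + pscale (evB v) (?s fp) + ?s (Q \<alpha> g)"
    have L: "linear_map (Comp V 0) (Comp (Sym V) 0) (sym_gen V 0)"
      by (rule chain_mapD(1)[OF chain_map_sym_gen[OF complex_space_axioms]])
    have k: "keys (?s u) \<subseteq> sym_words V 0" if "u \<in> carrier (Comp V 0)" for u
      using that by (simp del: VV_simps)
    have Qg: "Q \<alpha> g \<in> carrier (Comp V 0)" by (rule Q_closed[OF g])
    have c: "(\<lambda>x. evA v * fq x) \<in> carrier (Comp V 0)" "(\<lambda>x. evB v * fp x) \<in> carrier (Comp V 0)"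
      "(\<lambda>x. evA v * fq x + evB v * fp x) \<in> carrier (Comp V 0)"
      using fq_closed fp_closed by simp_all
    \<comment> \<open>Linearity of \<open>sym_gen\<close> packages the linear relations needed to
      break the letter \<open>v\<close> into its three components.\<close>
    have "sym_cls V 0 (?s v) = sym_cls V 0 ?y"
    proof -
      have "sym_gen V 0 (\<lambda>x. evA v * fq x + evB v * fp x + Q \<alpha> g x) =
          evA v \<odot>\<^bsub>Comp (Sym V) 0\<^esub> sym_gen V 0 fq \<oplus>\<^bsub>Comp (Sym V) 0\<^esub> evB v \<odot>\<^bsub>Comp (Sym V) 0\<^esub> sym_gen V 0 fp
          \<oplus>\<^bsub>Comp (Sym V) 0\<^esub> sym_gen V 0 (Q \<alpha> g)"
        using linear_mapD(2)[OF L c(3) Qg] linear_mapD(2)[OF L c(1,2)]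
          linear_mapD(3)[OF L fq_closed, of "evA v"] linear_mapD(3)[OF L fp_closed, of "evB v"]
        by (simp only: VV_ops)
      then show ?thesis
        unfolding vg[symmetric] sym_gen_sym_cls
        using k[OF fq_closed] k[OF fp_closed] k[OF Qg] by (simp only: Sym_smult Sym_add keys_closed)
    qed
    then have "?s v - ?y \<in> sym_ideal V 0"
      using sym_cls_eq_iff[OF k[OF v0], of ?y] k[OF fq_closed] k[OF fp_closed] k[OF Qg] by (simp only: keys_closed simp_thms)
    moreover have "[(0, fq)] \<in> special_words 1 0" "[(0, fp)] \<in> special_words 1 0" "[(0, Q \<alpha> g)] \<in> special_words 1 0"
      by (rule mem; use fq_closed fp_closed Qg g in \<open>auto simp: base_letters_def exact_letters_def simp del: VV_simps\<close>)+
    then have "keys ?y \<subseteq> special_words 1 0"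
      by (intro keys_closed)
    ultimately show ?thesis using 2 by blast
  next
    \<comment> \<open>Outside degrees -1 and 0 the only letter has entry zero and lies in the ideal,
      so the empty combination represents it.\<close>
    case 3
    then show ?thesis
      using sym_rel_zero[of p 1] by (intro exI[of _ 0]) simp
  qed
qed

text \<open>Each letter is rewritten separately and may raise the bound on the weight by one; the
  bound therefore depends on the word.\<close>

lemma special_word: "w \<in> sym_words V n \<Longrightarrow> \<exists>m y. keys y \<subseteq> special_words m n \<and> single w 1 - y \<in> sym_ideal V n"
proof (induction w arbitrary: n)
  case Nil
  then show ?case
    by (intro exI[of _ 0] exI[of _ "single [] 1"]) (simp add: sym_ideal_zero special_words_def weight_def)
next
  case (Cons a w)
  obtain p v where a: "a = (p, v)" by (cases a)
  have v: "v \<in> carrier (Comp V p)" and w: "w \<in> sym_words V (n - p)"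
    using Cons.prems a by simp_all
  obtain y1 where y1: "keys y1 \<subseteq> special_words 1 p" "single [(p, v)] 1 - y1 \<in> sym_ideal V p"
    using special_letter[OF v] by blast
  obtain m y2 where y2: "keys y2 \<subseteq> special_words m (n - p)" "single w 1 - y2 \<in> sym_ideal V (n - p)"
    using Cons.IH[OF w] by blast
  have "keys (y1 * y2) \<subseteq> special_words (1 + m) (p + (n - p))"
    by (rule keys_mult_words[OF y1(1) y2(1) special_words_append])
  moreover have "single (a # w) 1 - y1 * y2 \<in> sym_ideal V (p + (n - p))"
  proof -
    have "single (a # w) 1 - y1 * y2 =
        (single [(p, v)] 1 - y1) * single w 1 + y1 * (single w 1 - y2)"
      by (simp add: a algebra_simps)
    moreover have "(single [(p, v)] 1 - y1) * single w 1 \<in> sym_ideal V (p + (n - p))"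
      by (rule sym_ideal_mult_right[OF y1(2)]) (simp add: w)
    moreover have "y1 * (single w 1 - y2) \<in> sym_ideal V (p + (n - p))"
      by (rule sym_ideal_mult_left[OF y2(2)]) (use y1(1) special_words_sym_words in blast)
    ultimately show ?thesis by (simp only: sym_ideal_add)
  qed
  ultimately show ?case by (metis add_diff_cancel_left' diff_add_cancel add.commute)
qed

lemma special_element:
  assumes "keys x \<subseteq> sym_words V n"
  shows "\<exists>m y. keys y \<subseteq> special_words m n \<and> x - y \<in> sym_ideal V n"
  using assms
proof (induction rule: poly_mapping_keys_induct)
  case zero
  then show ?case by (intro exI[of _ 0]) (simp add: sym_ideal_zero)
next
  case (single_add w c x)
  obtain m y where y: "keys y \<subseteq> special_words m n" "x - y \<in> sym_ideal V n"
    using single_add(3) by blast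
  obtain m' y' where y': "keys y' \<subseteq> special_words m' n" "single w 1 - y' \<in> sym_ideal V n"
    using special_word[OF single_add(1)] by blast
  have "keys (pscale c y' + y) \<subseteq> special_words (max m m') n"
    using y(1) y'(1) special_words_mono[of m "max m m'" n] special_words_mono[of m' "max m m'" n] by (intro keys_closed) auto
  moreover have e: "single w c + x - (pscale c y' + y) = pscale c (single w 1 - y') + (x - y)"
    by (simp add: pscale_distribs algebra_simps)
  have "single w c + x - (pscale c y' + y) \<in> sym_ideal V n"
    unfolding e by (rule sym_ideal_add[OF sym_ideal_pscale[OF y'(2)] y(2)])
  ultimately show ?case by blast
qed

lemma cocycle_representative:
  assumes x: "keys x \<subseteq> sym_words V n" and dx: "dW x \<in> sym_ideal V (n + 1)"
  shows "\<exists>y z. keys y \<subseteq> special_words 0 n \<and> keys z \<subseteq> sym_words V (n + - 1) \<and> x - y - dW z \<in> sym_ideal V n"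
proof -
  obtain m x' where x': "keys x' \<subseteq> special_words m n" "x - x' \<in> sym_ideal V n"
    using special_element[OF x] by blast
  have "dW x - dW (x - x') \<in> sym_ideal V (n + 1)"
    by (intro sym_ideal_minus dx dW_ideal x')
  then have "dW x' \<in> sym_ideal V (n + 1)"
    by (simp add: free_ext_minus)
  then obtain y z where "keys y \<subseteq> special_words 0 n" "keys z \<subseteq> sym_words V (n + - 1)"
    "x' - y - dW z \<in> sym_ideal V n"
    using cocycle_reduce[OF x'(1)] by blast
  moreover have "x - y - dW z = (x - x') + (x' - y - dW z)"
    by simp
  ultimately show ?thesis
    using sym_ideal_add[OF x'(2)] by metis
qed

end


section \<open>The quasi-isomorphism to the polynomial algebra\<close>

lemma linear_map_free_subset:
  "S \<subseteq> T \<Longrightarrow> linear_map (free_mod T) M f \<Longrightarrow> linear_map (free_mod S) M f"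
  using linear_mapD[of "free_mod T" M f] by (intro linear_mapI) auto

text \<open>The coefficient of \<open>q^i p^j\<close>: the outer polynomial variable is
  \<open>p\<close>, the inner one \<open>q\<close>.\<close>

definition coeff2 :: "'k::field poly poly \<Rightarrow> nat \<Rightarrow> nat \<Rightarrow> 'k" where
  "coeff2 P i j = coeff (coeff P j) i"

lemma coeff2_add: "coeff2 (P + R) i j = coeff2 P i j + coeff2 R i j"
  by (simp add: coeff2_def)

lemma coeff2_monomial: "coeff2 (cst c * (qvar ^ i * pvar ^ j)) i' j' = (if i = i' \<and> j = j' then c else 0)"
proof -
  have "pvar ^ j = monom (1 :: 'a poly) j"
    by (simp add: pvar_def monom_altdef)
  moreover have "qvar ^ i = [:monom (1 :: 'a) i:]"
    by (induction i) (simp_all add: qvar_def monom_Suc one_pCons monom_0)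
  ultimately show ?thesis
    by (simp add: coeff2_def cst_def smult_monom)
qed

context interval
begin

section \<open>Monomials as normal forms of words in the two dual functions\<close>

definition base_word :: "nat \<Rightarrow> nat \<Rightarrow> (int \<Rightarrow> 'k) word" where
  "base_word i j = replicate i (0, fq) @ replicate j (0, fp)"

lemma fq_neq_fp: "fq \<noteq> fp"
  using ev_generators by (metis zero_neq_one)

text \<open>The number of letters \<open>fq\<close> together with the length recovers both
  exponents, as \<open>fq\<close> and \<open>fp\<close> differ.\<close>

lemma base_word_inj: "base_word i j = base_word i' j' \<longleftrightarrow> i = i' \<and> j = j'"
proof
  assume "base_word i j = base_word i' j'"
  then have "count_list (base_word i j) (0, fq) = count_list (base_word i' j') (0, fq)"
    "length (base_word i j) = length (base_word i' j')" by simp_all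
  moreover have "count_list (replicate m x) y = (if x = y then m else 0)" for m and x y :: "int \<times> (int \<Rightarrow> 'k)"
    by (induction m) auto
  ultimately show "i = i' \<and> j = j'"
    using fq_neq_fp by (simp add: base_word_def)
qed simp

text \<open>Weight 0 leaves only base letters, all of degree 0. In other degrees the set is empty,
  so a cocycle reduced to weight 0 is zero there.\<close>

lemma special_words_0: "special_words 0 n = {w. set w \<subseteq> base_letters \<and> n = 0}"
proof -
  have "weight w = 0 \<longleftrightarrow> set w \<subseteq> base_letters" for w
    by (auto simp: weight_def filter_empty_conv)
  moreover have "w \<in> sym_words V n \<longleftrightarrow> n = 0" if "set w \<subseteq> base_letters" for w n
    using that
  proof (induction w arbitrary: n)
    case (Cons a w)
    then show ?case
      using base_closed[of a] by (cases a) (simp del: VV_simps)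
  qed simp
  ultimately show ?thesis
    by (auto simp: special_words_def)
qed

lemma special_words_0_append: "u \<in> special_words 0 0 \<Longrightarrow> v \<in> special_words 0 0 \<Longrightarrow> u @ v \<in> special_words 0 0"
  by (simp add: special_words_0)

lemma special_words_0_closed: "keys x \<subseteq> special_words 0 0 \<Longrightarrow> keys x \<subseteq> sym_words V 0"
  using special_words_sym_words by blast

lemma base_word_special_words: "base_word i j \<in> special_words 0 0"
  by (auto simp: special_words_0 base_word_def base_letters_def)

text \<open>A new letter \<open>fq\<close> extends the first block. A new letter \<open>fp\<close>
  is moved past that block with sign 1, the degrees being 0.\<close>

lemma base_word_sort:
  "w \<in> special_words 0 0 \<Longrightarrow> \<exists>i j. single w 1 - single (base_word i j) 1 \<in> sym_ideal V 0"
proof (induction w)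
  case Nil
  then show ?case
    by (intro exI[of _ 0]) (simp add: base_word_def sym_ideal_zero)
next
  case (Cons a w)
  have w: "w \<in> special_words 0 0" and a: "a \<in> base_letters" using Cons.prems by (simp_all add: special_words_0)
  have as: "[a] \<in> sym_words V 0"
    using base_closed[OF a] by (cases a) (simp del: VV_simps)
  obtain i j where ij: "single w 1 - single (base_word i j) 1 \<in> sym_ideal V 0"
    using Cons.IH[OF w] by blast
  have "single [a] 1 * (single w 1 - single (base_word i j) 1) \<in> sym_ideal V (0 + 0)"
    by (rule sym_ideal_mult_left[OF ij]) (simp add: as)
  then have 1: "single (a # w) 1 - single (a # base_word i j) 1 \<in> sym_ideal V 0"
    by (simp add: right_diff_distrib)
  show ?case
  proof (cases "a = (0, fq)")
    case True
    then have "a # base_word i j = base_word (Suc i) j" by (simp add: base_word_def)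
    then show ?thesis using 1 by metis
  next
    case False
    then have a': "a = (0, fp)" using a by (simp add: base_letters_def)
    have q: "replicate i (0, fq) \<in> sym_words V 0" and p: "replicate j (0, fp) \<in> sym_words V 0"
      using special_words_sym_words[of 0 0] by (auto simp: special_words_0 base_letters_def)
    have "single ([a] @ replicate i (0, fq)) 1 - single (replicate i (0, fq) @ [a]) (sgn_pow (0 * 0))
        \<in> sym_ideal V (0 + 0)"
      by (rule word_commute[OF as q])
    then have "(single ([a] @ replicate i (0, fq)) 1 - single (replicate i (0, fq) @ [a]) 1)
        * single (replicate j (0, fp)) 1 \<in> sym_ideal V (0 + 0)"
      by (intro sym_ideal_mult_right) (use p in simp_all)
    then have 2: "single (a # base_word i j) 1 - single (base_word i (Suc j)) 1 \<in> sym_ideal V 0"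
      by (simp add: left_diff_distrib base_word_def a')
    have e: "single (a # w) 1 - single (base_word i (Suc j)) 1 =
        (single (a # w) 1 - single (a # base_word i j) 1)
        + (single (a # base_word i j) 1 - single (base_word i (Suc j)) (1 :: 'k))"
      by simp
    have "single (a # w) 1 - single (base_word i (Suc j)) 1 \<in> sym_ideal V 0"
      unfolding e by (rule sym_ideal_add[OF 1 2])
    then show ?thesis by blast
  qed
qed

lemma base_element_sort:
  assumes "keys y \<subseteq> special_words 0 0"
  shows "\<exists>y'. keys y' \<subseteq> {base_word i j | i j. True} \<and> y - y' \<in> sym_ideal V 0"
  using assms
proof (induction rule: poly_mapping_keys_induct)
  case zero
  then show ?case by (intro exI[of _ 0]) (simp add: sym_ideal_zero)
next
  case (single_add w c x)
  obtain i j where ij: "single w 1 - single (base_word i j) 1 \<in> sym_ideal V 0"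
    using base_word_sort[OF single_add(1)] by blast
  obtain y where y: "keys y \<subseteq> {base_word i j | i j. True}" "x - y \<in> sym_ideal V 0"
    using single_add(3) by blast
  have e: "single w c + x - (single (base_word i j) c + y) =
      pscale c (single w 1 - single (base_word i j) 1) + (x - y)"
    by (simp add: pscale_distribs)
  have "single w c + x - (single (base_word i j) c + y) \<in> sym_ideal V 0"
    unfolding e by (rule sym_ideal_add[OF sym_ideal_pscale[OF ij] y(2)])
  moreover have "keys (single (base_word i j) c + y) \<subseteq> {base_word i j | i j. True}"
    by (intro keys_closed y) blast
  ultimately show ?case by blast
qed

lemma phi_generators: "phi_chain \<alpha> I 0 fq = qvar" "phi_chain \<alpha> I 0 fp = pvar"
  using phi_chain_eq[OF fq_closed] phi_chain_eq[OF fp_closed] phi_fun_ev[OF fq_closed] phi_fun_ev[OF fp_closed]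
  by (simp_all add: ev_generators)

lemma word_eval_base_word: "Phi.word_eval 0 (single (base_word i j) c) = cst c * (qvar ^ i * pvar ^ j)"
proof -
  have "word_prod Kqp (Phi.word_map (replicate j (0, fp))) = pvar ^ j"
    by (induction j) (simp_all add: phi_generators)
  then have "word_prod Kqp (Phi.word_map (base_word i j)) = qvar ^ i * pvar ^ j"
    unfolding base_word_def by (induction i) (simp_all add: phi_generators)
  then show ?thesis
    using Phi.word_eval_single[of "base_word i j" 0 c] subsetD[OF special_words_sym_words base_word_special_words] by simp
qed

lemma word_eval_add: "keys x \<subseteq> sym_words V 0 \<Longrightarrow> keys y \<subseteq> sym_words V 0 \<Longrightarrow>
    Phi.word_eval 0 (x + y) = Phi.word_eval 0 x + Phi.word_eval 0 y"
  using Phi.word_eval_add[of x 0 y] by simp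

text \<open>Distinct normal forms go to distinct monomials, so the polynomial shows the coefficients
  of a combination of normal forms.\<close>

lemma coeff2_T:
  assumes "keys y \<subseteq> {base_word i j | i j. True}"
  shows "coeff2 (Phi.word_eval 0 y) i j = lookup y (base_word i j)"
  using assms
proof (induction rule: poly_mapping_keys_induct)
  case zero
  then show ?case using Phi.word_eval_zero[of 0] by (simp add: coeff2_def)
next
  case (single_add w c x)
  obtain i' j' where w: "w = base_word i' j'" using single_add(1) by blast
  have "keys x \<subseteq> sym_words V 0"
    using single_add(2) base_word_special_words special_words_sym_words by blast
  moreover have "base_word i' j' \<in> sym_words V 0"
    using base_word_special_words special_words_sym_words by blast
  ultimately have "Phi.word_eval 0 (single w c + x) = cst c * (qvar ^ i' * pvar ^ j') + Phi.word_eval 0 x"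
    using word_eval_add[of "single w c" x] by (simp add: w word_eval_base_word)
  then show ?case
    using single_add(3) by (simp add: coeff2_add coeff2_monomial w lookup_add lookup_single base_word_inj when_def)
qed

text \<open>Modulo the ideal \<open>y\<close> is a combination of normal forms, whose coefficients
  can be read off from its image.\<close>

lemma base_injective:
  assumes y: "keys y \<subseteq> special_words 0 0" and T: "Phi.word_eval 0 y = 0"
  shows "y \<in> sym_ideal V 0"
proof -
  obtain y' where y': "keys y' \<subseteq> {base_word i j | i j. True}" "y - y' \<in> sym_ideal V 0"
    using base_element_sort[OF y] by blast
  have y'c: "keys y' \<subseteq> sym_words V 0"
    using y'(1) base_word_special_words special_words_sym_words by blast
  have "Phi.word_eval 0 y = Phi.word_eval 0 (y - y') + Phi.word_eval 0 y'"
    using word_eval_add[OF sym_ideal_keys[OF y'(2)] y'c] by simp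
  then have "Phi.word_eval 0 y' = 0"
    using T Phi.word_eval_sym_ideal[OF y'(2)] by simp
  have "y' = 0"
  proof (rule poly_mapping_eqI)
    fix w
    show "lookup y' w = lookup 0 w"
    proof (cases "w \<in> keys y'")
      case True
      then obtain i j where "w = base_word i j" using y'(1) by blast
      then show ?thesis
        using coeff2_T[OF y'(1), of i j] \<open>Phi.word_eval 0 y' = 0\<close> by (simp add: coeff2_def)
    qed (simp add: in_keys_iff)
  qed
  then show ?thesis using y'(2) by simp
qed

text \<open>The set \<open>R\<close> of values is closed under sums and products and contains all
  monomials. Horner's scheme, run first for polynomials in \<open>q\<close> and then for those in
  \<open>p\<close>, reaches everything.\<close>

lemma base_surjective: "\<exists>x. keys x \<subseteq> special_words 0 0 \<and> Phi.word_eval 0 x = P"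
proof -
  define R where "R = {P. \<exists>x. keys x \<subseteq> special_words 0 0 \<and> Phi.word_eval 0 x = P}"
  have add: "P + P' \<in> R" if P: "P \<in> R" and P': "P' \<in> R" for P P'
  proof -
    obtain x y where "keys x \<subseteq> special_words 0 0" "Phi.word_eval 0 x = P" "keys y \<subseteq> special_words 0 0" "Phi.word_eval 0 y = P'"
      using P P' by (auto simp: R_def)
    then show ?thesis
      unfolding R_def mem_Collect_eq
      by (intro exI[of _ "x + y"]) (simp add: word_eval_add special_words_0_closed keys_closed)
  qed
  have mult: "P * P' \<in> R" if P: "P \<in> R" and P': "P' \<in> R" for P P'
  proof -
    obtain x y where xy: "keys x \<subseteq> special_words 0 0" "Phi.word_eval 0 x = P" "keys y \<subseteq> special_words 0 0" "Phi.word_eval 0 y = P'"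
      using P P' by (auto simp: R_def)
    moreover have "Phi.word_eval (0 + 0) (x * y) = P * P'"
      using Phi.word_eval_mult[OF special_words_0_closed[OF xy(1)] special_words_0_closed[OF xy(3)]] xy by simp
    ultimately show ?thesis
      unfolding R_def mem_Collect_eq
      by (intro exI[of _ "x * y"]) (simp add: keys_mult_words[OF xy(1,3) special_words_0_append])
  qed
  have mono: "cst c * (qvar ^ i * pvar ^ j) \<in> R" for c i j
    unfolding R_def mem_Collect_eq
    by (intro exI[of _ "single (base_word i j) c"]) (simp add: word_eval_base_word base_word_special_words)
  have const: "[:a:] \<in> R" for a
  proof (induction a)
    case 0
    show ?case using mono[of 0 0 0] by simp
  next
    case (pCons c a)
    have "[:pCons c a:] = cst c * (qvar ^ 0 * pvar ^ 0) + (cst 1 * (qvar ^ 1 * pvar ^ 0)) * [:a:]"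
      by (simp add: cst_def qvar_def)
    then show ?case using add[OF mono mult[OF mono pCons(2)]] by metis
  qed
  have "P \<in> R"
  proof (induction P)
    case 0
    show ?case using mono[of 0 0 0] by simp
  next
    case (pCons a P)
    have "pCons a P = [:a:] + (cst 1 * (qvar ^ 0 * pvar ^ 1)) * P"
      by (simp add: pvar_def)
    then show ?case using add[OF const mult[OF mono pCons(2)]] by metis
  qed
  then show ?thesis by (simp add: R_def)
qed

text \<open>Differentiating a letter of degree 0 gives the letter of degree 1 with entry
  zero.\<close>

lemma base_cocycle:
  assumes "keys x \<subseteq> special_words 0 0"
  shows "dW x \<in> sym_ideal V 1"
proof -
  have "wder 1 (Diff V) w \<in> sym_ideal V 1" if "w \<in> special_words 0 0" for w
    using that
  proof (induction w)
    case Nil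
    then show ?case by (simp add: sym_ideal_zero)
  next
    case (Cons a w)
    obtain p v where a: "a = (p, v)" by (cases a)
    have w: "w \<in> special_words 0 0" and ab: "a \<in> base_letters" using Cons.prems by (simp_all add: special_words_0)
    have p: "p = 0" and v: "v \<in> carrier (Comp V 0)"
      using base_closed[OF ab] by (auto simp: a simp del: VV_simps)
    have ws: "w \<in> sym_words V 0" using w special_words_sym_words by blast
    have "single [(1, \<zero>\<^bsub>Comp V 1\<^esub>)] (1 :: 'k) * single w 1 \<in> sym_ideal V (1 + 0)"
      by (rule sym_ideal_mult_right[OF sym_rel_zero]) (simp add: ws)
    moreover have "single [(0, v)] 1 * wder 1 (Diff V) w \<in> sym_ideal V (0 + 1)"
      by (rule sym_ideal_mult_left[OF Cons.IH[OF w]]) (use v in \<open>simp del: VV_simps\<close>)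
    ultimately show ?case
      by (simp add: a p sym_ideal_add)
  qed
  with assms show ?thesis
    by (induction rule: poly_mapping_keys_induct)
      (simp_all add: free_ext_add free_ext_pscale sym_ideal_zero sym_ideal_add sym_ideal_pscale)
qed

lemma Kqp_minus_self: "(x :: 'k poly poly) \<in> carrier (Comp Kqp n) \<Longrightarrow> x \<ominus>\<^bsub>Comp Kqp n\<^esub> x = 0"
  using diff_eq_zero_iff[OF dgca_space.A_module[OF dgca_space.intro[OF dgca_Kqp]], of x n x] by simp

text \<open>For injectivity a cocycle is replaced by its representative \<open>y\<close> of weight
  0; evaluation kills the coboundary and the ideal, so \<open>y\<close> evaluates to zero and is in
  the ideal. In nonzero degrees \<open>y\<close> is zero outright. For surjectivity, words in base
  letters are cocycles.\<close>

theorem Phi_quasi_iso: "quasi_iso (Ocl \<alpha> I) Kqp (Phi \<alpha> I)"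
  unfolding Ocl_def
proof (rule quasi_isoI[OF cochain_complex_Sym dgcaD(1)[OF dgca_Kqp]])
  show "chain_map (Sym V) Kqp (Phi \<alpha> I)"
    using Phi_hom by (simp add: dga_hom_def Ocl_def)
  fix n
  have coboundaries_Kqp: "coboundaries Kqp n = {0 :: 'k poly poly}"
    by (auto simp: coboundaries_def)
  show "X \<in> coboundaries (Sym V) n"
    if X: "X \<in> carrier (cocycles (Sym V) n)" and P: "Phi \<alpha> I n X \<in> coboundaries Kqp n" for X
  proof -
    obtain x where x: "keys x \<subseteq> sym_words V n" "X = sym_cls V n x"
      using X by (auto simp: Sym_carrier)
    have "sym_cls V (n + 1) (dW x) = sym_cls V (n + 1) 0"
      using X by (simp add: x Sym_Diff Sym_zero)
    then have dx: "dW x \<in> sym_ideal V (n + 1)"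
      using sym_cls_eq_iff[OF dW_keys[OF x(1)], of 0] by simp
    obtain y z where y: "keys y \<subseteq> special_words 0 n" and z: "keys z \<subseteq> sym_words V (n + - 1)"
      and i: "x - y - dW z \<in> sym_ideal V n"
      using cocycle_representative[OF x(1) dx] by blast
    have dz: "keys (dW z) \<subseteq> sym_words V n"
      using dW_keys[OF z] by simp
    have ys: "keys y \<subseteq> sym_words V n"
      using y special_words_sym_words by blast
    have "y \<in> sym_ideal V n"
    proof (cases "n = 0")
      case True
      have Tx: "Phi.word_eval 0 x = 0"
        using P Phi_cls[OF x(1)] unfolding coboundaries_Kqp x(2) by (simp add: True)
      have Tz: "Phi.word_eval 0 (dW z) = 0"
        using Phi.word_eval_der[OF z] True by simp
      have Ti: "Phi.word_eval 0 (x - y - dW z) = 0"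
        using Phi.word_eval_sym_ideal[OF i] True by simp
      have "x = (x - y - dW z) + (y + dW z)" by simp
      moreover have "Phi.word_eval 0 ((x - y - dW z) + (y + dW z)) = Phi.word_eval 0 (x - y - dW z) + (Phi.word_eval 0 y + Phi.word_eval 0 (dW z))"
        using x(1) ys dz True by (simp only: word_eval_add keys_closed)
      ultimately have "Phi.word_eval 0 y = 0"
        using Tx Tz Ti by (metis add.left_neutral add.right_neutral)
      then show ?thesis
        using base_injective y True by simp
    next
      case False
      then have "y = 0" using y by (simp add: special_words_0)
      then show ?thesis by (simp add: sym_ideal_zero)
    qed
    then have "x - dW z \<in> sym_ideal V n"
      using sym_ideal_add[OF i] by fastforce
    then have "X = sym_cls V n (dW z)"
      using sym_cls_eq_iff[OF x(1) dz] x(2) by simp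
    also have "\<dots> = Diff (Sym V) (n - 1) (sym_cls V (n - 1) z)"
      using Sym_Diff[of z "n - 1"] z by simp
    finally show ?thesis
      unfolding coboundaries_def using sym_cls_closed[of z "n - 1"] z by simp
  qed
  show "\<exists>X\<in>carrier (cocycles (Sym V) n). Phi \<alpha> I n X \<ominus>\<^bsub>Comp Kqp n\<^esub> P \<in> coboundaries Kqp n"
    if P: "P \<in> carrier (cocycles Kqp n)" for P
  proof -
    have "\<exists>x. keys x \<subseteq> sym_words V n \<and> dW x \<in> sym_ideal V (n + 1) \<and> Phi.word_eval n x = P"
    proof (cases "n = 0")
      case True
      obtain x where "keys x \<subseteq> special_words 0 0" "Phi.word_eval 0 x = P"
        using base_surjective by blast
      then show ?thesis
        using base_cocycle[of x] special_words_0_closed[of x] True by (intro exI[of _ x]) simp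
    next
      case False
      then have "P = 0" using P by simp
      then show ?thesis
        using Phi.word_eval_zero[of n] by (intro exI[of _ 0]) (simp add: sym_ideal_zero)
    qed
    then obtain x where x: "keys x \<subseteq> sym_words V n" "dW x \<in> sym_ideal V (n + 1)" "Phi.word_eval n x = P"
      by blast
    have "sym_cls V n x \<in> carrier (cocycles (Sym V) n)"
      using x sym_cls_eq_iff[OF dW_keys[OF x(1)], of 0] by (simp add: sym_cls_closed Sym_Diff Sym_zero)
    moreover have "P \<in> carrier (Comp Kqp n)"
      using P by simp
    ultimately show ?thesis
      unfolding coboundaries_Kqp using Phi_cls[OF x(1)] x(3) Kqp_minus_self[of P n] by (metis singletonI)
  qed
qed

end

section \<open>The operad algebra \<open>Ocl\<close>\<close>

definition Ocl_map :: "'k::field \<Rightarrow> ival \<Rightarrow> ival \<Rightarrow> int \<Rightarrow> ((int \<Rightarrow> 'k) word \<Rightarrow>\<^sub>0 'k) set \<Rightarrow> ((int \<Rightarrow> 'k) word \<Rightarrow>\<^sub>0 'k) set" where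
  "Ocl_map \<alpha> I J = sym_map (VV \<alpha> J) (\<lambda>m v. VV_op [I] J m [v])"

lemma complex_space_VV: "complex_space (VV \<alpha> I)"
  by (rule complex_space.intro[OF cochain_complex_VV])

lemma sym_words_VV_mono:
  assumes "D11 [I] J" "w \<in> sym_words (VV \<alpha> I) n"
  shows "w \<in> sym_words (VV \<alpha> J) n"
  using assms(2) chain_mapD(2)[OF chain_map_VV_inclusion[OF assms(1), of \<alpha>]]
  by (auto simp: sym_words_def letters_def simp del: VV_simps)

lemma Ocl_map_sym_hom:
  assumes "D11 [I] J"
  shows "sym_hom (VV \<alpha> I) (Sym (VV \<alpha> J)) (\<lambda>n. sym_gen (VV \<alpha> J) n)"
  by (intro sym_hom.intro sym_hom_axioms.intro complex_space_VV dgca_space.intro complex_space.dgca_Sym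
      chain_map_comp[OF chain_map_VV_inclusion[OF assms] chain_map_sym_gen])

text \<open>Extension by zero leaves functions unchanged, so on representatives the structure map is
  the identity and only the ideal changes. Functoriality and naturality can then be read
  off.\<close>

lemma Ocl_map_cls:
  assumes D: "D11 [I] J" and x: "keys x \<subseteq> sym_words (VV \<alpha> I) n"
  shows "Ocl_map \<alpha> I J n (sym_cls (VV \<alpha> I) n x) = sym_cls (VV \<alpha> J) n x"
proof -
  interpret sym_hom "VV \<alpha> I" "Sym (VV \<alpha> J)" "\<lambda>n. sym_gen (VV \<alpha> J) n"
    by (rule Ocl_map_sym_hom[OF D])
  interpret J: complex_space "VV \<alpha> J" by (rule complex_space_VV)
  have "Ocl_map \<alpha> I J n (sym_cls (VV \<alpha> I) n x) = word_eval n x"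
    using sym_ext_cls[OF x] by (simp add: Ocl_map_def sym_map_def)
  also have "word_eval n x = sym_cls (VV \<alpha> J) n x"
  proof (rule free_linear_map_eqI[OF _ _ J.Sym_module _ x])
    show "linear_map (free_mod (sym_words (VV \<alpha> I) n)) (Comp (Sym (VV \<alpha> J)) n) (word_eval n)"
      using word_eval_linear by (simp add: sym_free_def)
    show "linear_map (free_mod (sym_words (VV \<alpha> I) n)) (Comp (Sym (VV \<alpha> J)) n) (sym_cls (VV \<alpha> J) n)"
      by (rule linear_map_free_subset[OF subsetI J.sym_cls_linear[unfolded sym_free_def]])
        (rule sym_words_VV_mono[OF D])
    show "word_eval n (single w 1) = sym_cls (VV \<alpha> J) n (single w 1)"
      if "w \<in> sym_words (VV \<alpha> I) n" for w
      using sym_word_prod[OF complex_space_VV sym_words_VV_mono[OF D that]] by (simp add: word_eval_single_one[OF that] word_map_def)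
  qed
  finally show ?thesis .
qed

lemma Ocl_map_hom: "D11 [I] J \<Longrightarrow> dga_hom (Ocl \<alpha> I) (Ocl \<alpha> J) (Ocl_map \<alpha> I J)"
  using sym_hom.sym_ext_hom[OF Ocl_map_sym_hom] by (simp add: Ocl_def Ocl_map_def sym_map_def)

lemma Ocl_carrierE:
  assumes "a \<in> carrier (Comp (Ocl \<alpha> I) n)"
  obtains x where "keys x \<subseteq> sym_words (VV \<alpha> I) n" "a = sym_cls (VV \<alpha> I) n x"
  using assms unfolding Ocl_def complex_space.Sym_carrier[OF complex_space_VV] by blast

lemma D11_functor_Ocl:
  "D11_functor (Ocl \<alpha>) (Ocl_map \<alpha>) (\<lambda>Is J w. word_prod (Ocl \<alpha> J) (map2 (\<lambda>I (n, a). (n, Ocl_map \<alpha> I J n a)) Is w)) (Ocl_op \<alpha>)"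
proof
  show "dgca (Ocl \<alpha> I)" for I
    unfolding Ocl_def by (rule complex_space.dgca_Sym[OF complex_space_VV])
  show "dga_hom (Ocl \<alpha> I) (Ocl \<alpha> J) (Ocl_map \<alpha> I J)" if "D11 [I] J" for I J
    by (rule Ocl_map_hom[OF that])
  show "Ocl_map \<alpha> I I n a = a" if "color I" "a \<in> carrier (Comp (Ocl \<alpha> I) n)" for I n a
    using that(2) by (rule Ocl_carrierE) (use that(1) in \<open>simp add: Ocl_map_cls D11_single\<close>)
  show "Ocl_map \<alpha> J K n (Ocl_map \<alpha> I J n a) = Ocl_map \<alpha> I K n a"
    if D: "D11 [I] J" "D11 [J] K" and a: "a \<in> carrier (Comp (Ocl \<alpha> I) n)" for I J K n a
  proof -
    obtain x where x: "keys x \<subseteq> sym_words (VV \<alpha> I) n" "a = sym_cls (VV \<alpha> I) n x"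
      using a by (rule Ocl_carrierE)
    have "D11 [I] K" "keys x \<subseteq> sym_words (VV \<alpha> J) n"
      using D x(1) sym_words_VV_mono[OF D(1)] by (auto simp: D11_single)
    then show ?thesis
      using D x by (simp add: Ocl_map_cls)
  qed
  show "word_prod (Ocl \<alpha> J) (map2 (\<lambda>I (n, a). (n, Ocl_map \<alpha> I J n a)) Is w) =
      word_prod (Ocl \<alpha> J) (tens (map (\<lambda>I. Ocl_map \<alpha> I J) Is) w)" for Is J w
    by (simp add: tens_def zip_map1 o_def case_prod_unfold)
  show "Ocl_op \<alpha> Is J = tensor_ext (Ocl \<alpha> J) (\<lambda>w. word_prod (Ocl \<alpha> J) (map2 (\<lambda>I (n, a). (n, Ocl_map \<alpha> I J n a)) Is w))" for Is J
    by (simp add: Ocl_op_def Ocl_map_def)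
qed

lemma D11_functor_Kqp:
  "D11_functor (const_alg (Kqp :: ('k::field, 'k poly poly) dga)) (\<lambda>I J n a. a) (\<lambda>Is J. word_prod Kqp) (const_op Kqp)"
proof
  show "dgca (const_alg (Kqp :: ('k, 'k poly poly) dga) I)" for I
    by (simp add: const_alg_def dgca_Kqp)
  show "dga_hom (const_alg (Kqp :: ('k, 'k poly poly) dga) I) (const_alg Kqp J) (\<lambda>n a. a)" for I J
    by (simp add: const_alg_def dga_hom_def chain_map_def linear_map_def)
  show "word_prod (Kqp :: ('k, 'k poly poly) dga) w = word_prod (const_alg Kqp J) (tens (map (\<lambda>I n a. a) Is) w)"
    if "w \<in> tensor_words (map (const_alg (Kqp :: ('k, 'k poly poly) dga)) Is) n" for Is J n w
  proof -
    have "tens (map (\<lambda>I n a. a) Is) w = w"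
      using tensor_words_length[OF that] by (intro nth_equalityI) (simp_all add: nth_tens)
    then show ?thesis by (simp add: const_alg_def)
  qed
  show "const_op (Kqp :: ('k, 'k poly poly) dga) Is J = tensor_ext (const_alg Kqp J) (word_prod Kqp)" for Is J
    by (simp add: const_op_def const_alg_def)
qed simp_all

text \<open>Naturality holds letter by letter, because in degree 0 \<open>phi_chain\<close> is given
  on either interval by the same formula \<open>phi_fun\<close>.\<close>

lemma Phi_Ocl_map:
  assumes \<alpha>: "(\<alpha> :: 'k::field_char_0) \<noteq> 0" and D: "D11 [I] J" and a: "a \<in> carrier (Comp (Ocl \<alpha> I) n)"
  shows "Phi \<alpha> J n (Ocl_map \<alpha> I J n a) = Phi \<alpha> I n a"
proof -
  have "color I" "color J" using D by (simp_all add: D11_single)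
  obtain l r where "interval \<alpha> I l r"
    by (rule intervalI[OF \<alpha> \<open>color I\<close>])
  then interpret I: interval \<alpha> I l r .
  obtain l' r' where "interval \<alpha> J l' r'"
    by (rule intervalI[OF \<alpha> \<open>color J\<close>])
  then interpret J: interval \<alpha> J l' r' .
  obtain x where x: "keys x \<subseteq> sym_words (VV \<alpha> I) n" "a = sym_cls (VV \<alpha> I) n x"
    using a by (rule Ocl_carrierE)
  have xJ: "keys x \<subseteq> sym_words (VV \<alpha> J) n"
    using x(1) sym_words_VV_mono[OF D] by blast
  have "J.Phi.word_eval n x = I.Phi.word_eval n x"
  proof (rule free_linear_map_eqI[OF _ _ I.Phi.A_module _ x(1)])
    show "linear_map (free_mod (sym_words (VV \<alpha> I) n)) (Comp Kqp n) (I.Phi.word_eval n)"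
      using I.Phi.word_eval_linear by (simp add: sym_free_def)
    show "linear_map (free_mod (sym_words (VV \<alpha> I) n)) (Comp Kqp n) (J.Phi.word_eval n)"
      by (rule linear_map_free_subset[OF subsetI J.Phi.word_eval_linear[unfolded sym_free_def]])
        (rule sym_words_VV_mono[OF D])
    fix w assume w: "w \<in> sym_words (VV \<alpha> I) n"
    have "J.Phi.word_map w = I.Phi.word_map w"
      unfolding I.Phi.word_map_def J.Phi.word_map_def
    proof (rule map_cong[OF refl])
      fix b assume "b \<in> set w"
      then have b: "snd b \<in> carrier (Comp (VV \<alpha> I) (fst b))"
        using w by (auto simp: sym_words_def letters_def simp del: VV_simps)
      show "(case b of (m, v) \<Rightarrow> (m, phi_chain \<alpha> J m v)) = (case b of (m, v) \<Rightarrow> (m, phi_chain \<alpha> I m v))"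
        using I.phi_chain_eq[OF b] J.phi_chain_eq[OF chain_mapD(2)[OF chain_map_VV_inclusion[OF D] b]]
        by (simp add: split_beta)
    qed
    then show "J.Phi.word_eval n (single w 1) = I.Phi.word_eval n (single w 1)"
      using I.Phi.word_eval_single_one[OF w] J.Phi.word_eval_single_one[OF sym_words_VV_mono[OF D w]] by simp
  qed
  then show ?thesis
    using D x xJ by (simp add: Ocl_map_cls I.Phi_cls J.Phi_cls)
qed

theorem mainTheorem1:
  fixes \<alpha> :: "'k::field_char_0"
  assumes "\<alpha> \<noteq> 0"
  shows
    "(\<forall>I. color I \<longrightarrow>
        (\<forall>X\<in>carrier (cohom (VV \<alpha> I) 0). \<forall>f\<in>X. phi \<alpha> X = phi_fun \<alpha> f) \<and>
        linear_iso (cohom (VV \<alpha> I) 0) Kq_plus_Kp (phi \<alpha>) \<and>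
        (\<forall>n. n \<noteq> 0 \<longrightarrow> carrier (cohom (VV \<alpha> I) n) = {\<zero>\<^bsub>cohom (VV \<alpha> I) n\<^esub>})) \<and>
     D11_algebra_sum (VV \<alpha>) VV_op \<and> locally_constant_sum (VV \<alpha>) VV_op \<and>
     D11_algebra_tensor (Ocl \<alpha>) (Ocl_op \<alpha>) \<and> locally_constant_tensor (Ocl \<alpha>) (Ocl_op \<alpha>) \<and>
     (\<forall>I. color I \<longrightarrow>
        dga_hom (Ocl \<alpha> I) Kqp (Phi \<alpha> I) \<and> quasi_iso (Ocl \<alpha> I) Kqp (Phi \<alpha> I)) \<and>
     compatible_with_operations (Ocl \<alpha>) (Ocl_op \<alpha>) (const_alg Kqp) (const_op Kqp) (Phi \<alpha>) \<and>
     D11_equivalence (Ocl \<alpha>) (Ocl_op \<alpha>) (const_alg Kqp) (const_op Kqp) (Phi \<alpha>)"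
proof -
  interpret Ocl: D11_functor "Ocl \<alpha>" "Ocl_map \<alpha>"
    "\<lambda>Is J w. word_prod (Ocl \<alpha> J) (map2 (\<lambda>I (n, a). (n, Ocl_map \<alpha> I J n a)) Is w)" "Ocl_op \<alpha>"
    by (rule D11_functor_Ocl)
  interpret K: D11_functor "const_alg (Kqp :: ('k, 'k poly poly) dga)" "\<lambda>I J n a. a" "\<lambda>Is J. word_prod Kqp" "const_op Kqp"
    by (rule D11_functor_Kqp)
  have cohomology: "(\<forall>X\<in>carrier (cohom (VV \<alpha> I) 0). \<forall>f\<in>X. phi \<alpha> X = phi_fun \<alpha> f) \<and>
      linear_iso (cohom (VV \<alpha> I) 0) Kq_plus_Kp (phi \<alpha>) \<and>
      (\<forall>n. n \<noteq> 0 \<longrightarrow> carrier (cohom (VV \<alpha> I) n) = {\<zero>\<^bsub>cohom (VV \<alpha> I) n\<^esub>})"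
    and Phi: "dga_hom (Ocl \<alpha> I) Kqp (Phi \<alpha> I) \<and> quasi_iso (Ocl \<alpha> I) Kqp (Phi \<alpha> I)"
    if I: "color I" for I
  proof -
    obtain l r where "interval \<alpha> I l r"
      by (rule intervalI[OF assms I])
    then interpret interval \<alpha> I l r .
    show "(\<forall>X\<in>carrier (cohom (VV \<alpha> I) 0). \<forall>f\<in>X. phi \<alpha> X = phi_fun \<alpha> f) \<and>
      linear_iso (cohom (VV \<alpha> I) 0) Kq_plus_Kp (phi \<alpha>) \<and>
      (\<forall>n. n \<noteq> 0 \<longrightarrow> carrier (cohom (VV \<alpha> I) n) = {\<zero>\<^bsub>cohom (VV \<alpha> I) n\<^esub>})"
      using phi_well_defined phi_linear_iso cohom_nonzero by blast
    show "dga_hom (Ocl \<alpha> I) Kqp (Phi \<alpha> I) \<and> quasi_iso (Ocl \<alpha> I) Kqp (Phi \<alpha> I)"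
      using Phi_hom Phi_quasi_iso by blast
  qed
  have compatible: "compatible_with_operations (Ocl \<alpha>) (Ocl_op \<alpha>) (const_alg Kqp) (const_op Kqp) (Phi \<alpha>)"
    by (rule D11_functor_compatible[OF D11_functor_Ocl D11_functor_Kqp])
      (simp_all add: const_alg_def Phi Phi_Ocl_map[OF assms])
  have locally_constant: "locally_constant_tensor (Ocl \<alpha>) (Ocl_op \<alpha>)"
    unfolding locally_constant_tensor_def
  proof (intro allI impI)
    fix I J assume D: "D11 [I] J"
    then have c: "color I" "color J" by (simp_all add: D11_single)
    have complex: "cochain_complex (Ocl \<alpha> I)" for I
      unfolding Ocl_def by (rule complex_space.cochain_complex_Sym[OF complex_space_VV])
    interpret OJ: dgca_space "Ocl \<alpha> J" by (rule dgca_space.intro[OF Ocl.F[OF c(2)]])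
    \<comment> \<open>A product of one letter carries a trailing unit, which
      \<open>Mult_Unit\<close> removes; the operation with one input is therefore the structure map
      itself.\<close>
    have op: "Ocl_op \<alpha> [I] J n (elem_tensor [Ocl \<alpha> I] [(n, a)]) = Ocl_map \<alpha> I J n a"
      if a: "a \<in> carrier (Comp (Ocl \<alpha> I) n)" for n a
      using Ocl.\<mu>_elem[OF c(2), of "[I]" "[(n, a)]" n] D a OJ.Mult_Unit[OF OJ.dga_homD(4)[OF Ocl_map_hom[OF D] a]]
      by simp
    have ch: "chain_map (Ocl \<alpha> I) (Ocl \<alpha> J) (\<lambda>n a. Ocl_op \<alpha> [I] J n (elem_tensor [Ocl \<alpha> I] [(n, a)]))"
    proof -
      note m = chain_mapD[OF OJ.dga_homD(1)[OF Ocl_map_hom[OF D, of \<alpha>]]]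
      show ?thesis
        unfolding chain_map_def
      proof (intro conjI allI ballI)
        show "linear_map (Comp (Ocl \<alpha> I) n) (Comp (Ocl \<alpha> J) n) (\<lambda>a. Ocl_op \<alpha> [I] J n (elem_tensor [Ocl \<alpha> I] [(n, a)]))" for n
          by (rule linear_map_cong[OF m(1) cochain_complexD(1)[OF complex]]) (simp add: op)
      qed (simp add: op m cochain_complexD(3)[OF complex])
    qed
    show "quasi_iso (Ocl \<alpha> I) (Ocl \<alpha> J) (\<lambda>n a. Ocl_op \<alpha> [I] J n (elem_tensor [Ocl \<alpha> I] [(n, a)]))"
      by (rule quasi_iso_cancel_left[OF complex complex dgcaD(1)[OF dgca_Kqp] ch
            Phi[OF c(2), THEN conjunct2] Phi[OF c(1), THEN conjunct2]])
        (simp add: op Phi_Ocl_map[OF assms D])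
  qed
  have equivalence: "D11_equivalence (Ocl \<alpha>) (Ocl_op \<alpha>) (const_alg Kqp) (const_op Kqp) (Phi \<alpha>)"
    unfolding D11_equivalence_def
    using Ocl.D11_algebra K.D11_algebra Phi compatible by (simp add: const_alg_def)
  show ?thesis
    using cohomology Phi compatible locally_constant equivalence Ocl.D11_algebra
      D11_algebra_VV[OF assms] locally_constant_VV[OF assms] by blast
qed

end
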